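(* Let $\mathcal K$ be one of the categories $\mathscr P\mathcal P$, $\mathcal M$ or $\mathcal{TL}$, let $m,n\in\mathbb N$ with $m\geq n$, and let $\sigma\in\mathcal K_{nm}$ with $r=\operatorname{rank}(\sigma)$. (i) If $r<n$, then the trivial maximal $\mathscr J^\sigma$-classes of $\mathcal K_{mn}^\sigma$ are the singleton sets $\{\alpha\}$ for $\alpha\in\mathcal K_{mn}$ with $\operatorname{rank}(\alpha)>r$. Moreover, the following are equivalent: - $\mathcal K_{mn}^\sigma$ has a nontrivial maximal $\mathscr J^\sigma$-class, - $\operatorname{Pre}(\sigma)\subseteq D_r(\mathcal K_{mn})$, - $\operatorname{Pre}(\sigma)=V(\sigma)$, in which case the nontrivial maximal $\mathscr J^\sigma$-class is the set $D_r^\sigma=\{\alpha\in P^\sigma:\operatorname{rank}(\alpha)=r\}$. (ii) If $r=n$, then the set $D_r^\sigma=\{\alpha\in P^\sigma:\operatorname{rank}(\alpha)=r\}$ is the maximum $\mathscr J^\sigma$-class of $\mathcal K_{mn}^\sigma$; it is a left-zero semigroup.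
   Context: $\mathbb N=\{0,1,2,\ldots\}$, $[n]=\{1,\ldots,n\}$ (with $[0]=\emptyset$), and $A'=\{a':a\in A\}$, $A''=\{a'':a\in A\}$ for $A\subseteq\mathbb N$. $\mathcal P_{mn}$ is the set of all set partitions of $[m]\cup[n]'$. For $\alpha\in\mathcal P_{mn}$ and $\beta\in\mathcal P_{nk}$, the product $\alpha\beta\in\mathcal P_{mk}$ is formed as follows: identify partitions with graphs whose connected components are the blocks; let $\alpha_\downarrow$ be the graph on $[m]\cup[n]''$ obtained from $\alpha$ by renaming each $x'$ to $x''$, let $\beta^\uparrow$ be the graph on $[n]''\cup[k]'$ obtained from $\beta$ by renaming each $x\in[n]$ to $x''$, and let $\Pi(\alpha,\beta)$ be their union on $[m]\cup[n]''\cup[k]'$; two elements of $[m]\cup[k]'$ are in the same block of $\alpha\beta$ iff they are in the same component of $\Pi(\alpha,\beta)$. The rank of $\alpha\in\mathcal P_{mn}$ is the number of blocks meeting both $[m]$ and $[n]'$. $\mathscr P\mathcal P$ is the category (object set $\mathbb N$) of planar partitions, i.e. those $\alpha\in\mathcal P_{mn}$ ($m,n\in\mathbb N$) represented by some graph drawn in the plane with vertices $x$ at $(x,1)$ and $x'$ at $(x,0)$, edges inside the rectangle $1\le x\le\max(m,n)$, $0\le y\le1$, and no edge crossings in the interior of the rectangle. $\mathcal{TL}$ (Temperley-Lieb) consists of the planar partitions all of whose blocks have size $2$; $\mathcal M$ (Motzkin) of the planar partitions all of whose blocks have size $1$ or $2$. $\mathcal K_{mn}=\mathcal K\cap\mathcal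 P_{mn}$, and $D_r(\mathcal K_{mn})=\{\alpha\in\mathcal K_{mn}:\operatorname{rank}(\alpha)=r\}$. For $\sigma\in\mathcal K_{nm}$, $\mathcal K_{mn}^\sigma$ is the set $\mathcal K_{mn}$ with operation $\alpha\star_\sigma\beta=\alpha\sigma\beta$; $P^\sigma=\operatorname{Reg}(\mathcal K_{mn}^\sigma)$ is the subsemigroup of its (von Neumann) regular elements. $\operatorname{Pre}(\sigma)=\{\alpha\in\mathcal K_{mn}:\sigma=\sigma\alpha\sigma\}$ and $V(\sigma)=\{\alpha\in\mathcal K_{mn}:\sigma=\sigma\alpha\sigma,\ \alpha=\alpha\sigma\alpha\}$. $\mathscr J^\sigma$ is Green's $\mathscr J$ relation of $\mathcal K_{mn}^\sigma$; $\mathscr J^\sigma$-classes are ordered by $J_\alpha\le J_\beta$ iff $\alpha$ belongs to the principal two-sided ideal of $\mathcal K_{mn}^\sigma$ generated by $\beta$. For any $\alpha\in\mathcal K_{mn}$ which is not of the form $\alpha=\gamma\sigma\delta$ with $\gamma,\delta\in\mathcal K$, the set $\{\alpha\}$ is a maximal $\mathscr J^\sigma$-class; the maximal $\mathscr J^\sigma$-classes of this form are called trivial, and all other maximal $\mathscr J^\sigma$-classes are called nontrivial. A left-zero semigroup is one with multiplication $uv=u$. *)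

theory Defs
  imports "HOL-Analysis.Analysis" "HOL-Library.Disjoint_Sets"
begin

text \<open>The vertices \<open>x\<close>, \<open>x''\<close> and \<open>x'\<close> are \<open>Upper x\<close>, \<open>Middle x\<close> and \<open>Lower x\<close>;
  middle vertices only occur when products are formed.\<close>

datatype vertex = Upper nat | Middle nat | Lower nat

definition vertices :: "nat \<Rightarrow> nat \<Rightarrow> vertex set" where
  "vertices m n = Upper ` {1..m} \<union> Lower ` {1..n}"

definition partitions :: "nat \<Rightarrow> nat \<Rightarrow> vertex set set set" where
  "partitions m n = {\<alpha>. partition_on (vertices m n) \<alpha>}"

definition part_rank :: "vertex set set \<Rightarrow> nat" where
  "part_rank \<alpha> = card {A \<in> \<alpha>. A \<inter> range Upper \<noteq> {} \<and> A \<inter> range Lower \<noteq> {}}"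


text \<open>A graph is given by its set of edges, an edge being the set of its two endpoints.\<close>

definition same_component :: "vertex set set \<Rightarrow> (vertex \<times> vertex) set" where
  "same_component E = {(u, v). {u, v} \<in> E}\<^sup>*"

definition components :: "vertex set \<Rightarrow> vertex set set \<Rightarrow> vertex set set" where
  "components V E = V // (same_component E \<inter> V \<times> V)"

definition graph_of :: "vertex set set \<Rightarrow> vertex set set" where
  "graph_of \<alpha> = {{u, v} | u v. u \<noteq> v \<and> (\<exists>A\<in>\<alpha>. u \<in> A \<and> v \<in> A)}"


fun lower_to_middle :: "vertex \<Rightarrow> vertex" where
  "lower_to_middle (Lower x) = Middle x"
| "lower_to_middle v = v"

fun upper_to_middle :: "vertex \<Rightarrow> vertex" where
  "upper_to_middle (Upper x) = Middle x"
| "upper_to_middle v = v"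

definition product_graph :: "vertex set set \<Rightarrow> vertex set set \<Rightarrow> vertex set set" where
  "product_graph \<alpha> \<beta> =
     image lower_to_middle ` graph_of \<alpha> \<union> image upper_to_middle ` graph_of \<beta>"

text \<open>For \<open>\<alpha> \<in> partitions m n\<close> and \<open>\<beta> \<in> partitions n k\<close> the outer vertices below are
  \<open>vertices m k\<close>, so the product need not carry \<open>m\<close>, \<open>n\<close> and \<open>k\<close> as arguments.
  It is meaningful only for composable \<open>\<alpha>\<close> and \<open>\<beta>\<close>.\<close>

definition outer_vertices :: "vertex set set \<Rightarrow> vertex set set \<Rightarrow> vertex set" where
  "outer_vertices \<alpha> \<beta> = (\<Union>\<alpha> \<inter> range Upper) \<union> (\<Union>\<beta> \<inter> range Lower)"

definition part_prod :: "vertex set set \<Rightarrow> vertex set set \<Rightarrow> vertex set set"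
    (infixl "\<odot>" 70) where
  "\<alpha> \<odot> \<beta> = components (outer_vertices \<alpha> \<beta>) (product_graph \<alpha> \<beta>)"


fun position :: "vertex \<Rightarrow> real \<times> real" where
  "position (Upper x) = (real x, 1)"
| "position (Lower x) = (real x, 0)"
| "position (Middle x) = (real x, 1 / 2)"

text \<open>An edge is drawn as an arc joining its endpoints inside the rectangle. Crossing-free is
  meant in the usual sense of a plane graph: an edge meets the vertex set only in its own
  endpoints, and two edges meet only in shared endpoints. It would not suffice to exclude common
  points in the interior of the rectangle: an edge from 1 to 3 along the upper side could then
  run through vertex 2, and the crossing blocks \<open>{1,3}\<close>, \<open>{2,2'}\<close> would count as planar.\<close>

definition planar_drawing ::
    "nat \<Rightarrow> nat \<Rightarrow> vertex set set \<Rightarrow> (vertex set \<Rightarrow> real \<Rightarrow> real \<times> real) \<Rightarrow> bool" where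
  "planar_drawing m n E \<gamma> \<longleftrightarrow>
     (\<forall>e\<in>E. e \<subseteq> vertices m n \<and> card e = 2 \<and>
        arc (\<gamma> e) \<and> {pathstart (\<gamma> e), pathfinish (\<gamma> e)} = position ` e \<and>
        path_image (\<gamma> e) \<subseteq> {1..real (max m n)} \<times> {0..1} \<and>
        path_image (\<gamma> e) \<inter> position ` vertices m n = position ` e) \<and>
     (\<forall>e\<in>E. \<forall>f\<in>E. e \<noteq> f \<longrightarrow>
        path_image (\<gamma> e) \<inter> path_image (\<gamma> f) \<subseteq> position ` (e \<inter> f))"

definition planar_partitions :: "nat \<Rightarrow> nat \<Rightarrow> vertex set set set" where
  "planar_partitions m n =
     {\<alpha> \<in> partitions m n. \<exists>E \<gamma>. components (vertices m n) E = \<alpha> \<and> planar_drawing m n E \<gamma>}"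

definition motzkin :: "nat \<Rightarrow> nat \<Rightarrow> vertex set set set" where
  "motzkin m n = {\<alpha> \<in> planar_partitions m n. \<forall>A\<in>\<alpha>. card A = 1 \<or> card A = 2}"

definition temperley_lieb :: "nat \<Rightarrow> nat \<Rightarrow> vertex set set set" where
  "temperley_lieb m n = {\<alpha> \<in> planar_partitions m n. \<forall>A\<in>\<alpha>. card A = 2}"


text \<open>Semigroups are given by a carrier \<open>S\<close> and an operation \<open>f\<close>.\<close>

definition semigroup_on :: "'a set \<Rightarrow> ('a \<Rightarrow> 'a \<Rightarrow> 'a) \<Rightarrow> bool" where
  "semigroup_on S f \<longleftrightarrow>
     (\<forall>x\<in>S. \<forall>y\<in>S. f x y \<in> S) \<and> (\<forall>x\<in>S. \<forall>y\<in>S. \<forall>z\<in>S. f (f x y) z = f x (f y z))"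

definition left_zero_semigroup :: "'a set \<Rightarrow> ('a \<Rightarrow> 'a \<Rightarrow> 'a) \<Rightarrow> bool" where
  "left_zero_semigroup S f \<longleftrightarrow> semigroup_on S f \<and> (\<forall>u\<in>S. \<forall>v\<in>S. f u v = u)"

definition regular_elements :: "'a set \<Rightarrow> ('a \<Rightarrow> 'a \<Rightarrow> 'a) \<Rightarrow> 'a set" where
  "regular_elements S f = {a \<in> S. \<exists>x\<in>S. a = f (f a x) a}"

definition principal_ideal :: "'a set \<Rightarrow> ('a \<Rightarrow> 'a \<Rightarrow> 'a) \<Rightarrow> 'a \<Rightarrow> 'a set" where
  "principal_ideal S f a =
     {a} \<union> {f x a | x. x \<in> S} \<union> {f a y | y. y \<in> S} \<union> {f (f x a) y | x y. x \<in> S \<and> y \<in> S}"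

definition green_J :: "'a set \<Rightarrow> ('a \<Rightarrow> 'a \<Rightarrow> 'a) \<Rightarrow> ('a \<times> 'a) set" where
  "green_J S f = {(a, b). a \<in> S \<and> b \<in> S \<and> principal_ideal S f a = principal_ideal S f b}"

definition J_classes :: "'a set \<Rightarrow> ('a \<Rightarrow> 'a \<Rightarrow> 'a) \<Rightarrow> 'a set set" where
  "J_classes S f = S // green_J S f"

definition J_le :: "'a set \<Rightarrow> ('a \<Rightarrow> 'a \<Rightarrow> 'a) \<Rightarrow> 'a set \<Rightarrow> 'a set \<Rightarrow> bool" where
  "J_le S f C D \<longleftrightarrow> (\<exists>a\<in>C. \<exists>b\<in>D. a \<in> principal_ideal S f b)"

definition maximal_J_classes :: "'a set \<Rightarrow> ('a \<Rightarrow> 'a \<Rightarrow> 'a) \<Rightarrow> 'a set set" where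
  "maximal_J_classes S f =
     {C \<in> J_classes S f. \<forall>D\<in>J_classes S f. J_le S f C D \<longrightarrow> D = C}"

definition maximum_J_class :: "'a set \<Rightarrow> ('a \<Rightarrow> 'a \<Rightarrow> 'a) \<Rightarrow> 'a set \<Rightarrow> bool" where
  "maximum_J_class S f C \<longleftrightarrow> C \<in> J_classes S f \<and> (\<forall>D\<in>J_classes S f. J_le S f D C)"


text \<open>Below, \<open>S\<close> is a hom-set \<open>K m n\<close> and \<open>\<sigma> \<in> K n m\<close>.\<close>

definition sandwich ::
    "vertex set set \<Rightarrow> vertex set set \<Rightarrow> vertex set set \<Rightarrow> vertex set set" where
  "sandwich \<sigma> \<alpha> \<beta> = \<alpha> \<odot> \<sigma> \<odot> \<beta>"

definition pre_inverses :: "vertex set set set \<Rightarrow> vertex set set \<Rightarrow> vertex set set set" where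
  "pre_inverses S \<sigma> = {\<alpha> \<in> S. \<sigma> = \<sigma> \<odot> \<alpha> \<odot> \<sigma>}"

definition inverses :: "vertex set set set \<Rightarrow> vertex set set \<Rightarrow> vertex set set set" where
  "inverses S \<sigma> = {\<alpha> \<in> S. \<sigma> = \<sigma> \<odot> \<alpha> \<odot> \<sigma> \<and> \<alpha> = \<alpha> \<odot> \<sigma> \<odot> \<alpha>}"

definition rank_class :: "nat \<Rightarrow> vertex set set set \<Rightarrow> vertex set set set" where
  "rank_class r S = {\<alpha> \<in> S. part_rank \<alpha> = r}"

definition regular_rank_class ::
    "vertex set set set \<Rightarrow> vertex set set \<Rightarrow> nat \<Rightarrow> vertex set set set" where
  "regular_rank_class S \<sigma> r = {\<alpha> \<in> regular_elements S (sandwich \<sigma>). part_rank \<alpha> = r}"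

text \<open>If \<open>\<gamma> \<odot> \<sigma> \<odot> \<delta>\<close> is to be defined and to lie in \<open>K m n\<close>, then
  \<open>\<gamma>\<close> and \<open>\<delta>\<close> both lie in \<open>K m n\<close>.\<close>

definition trivial_maximal_J_classes ::
    "vertex set set set \<Rightarrow> vertex set set \<Rightarrow> vertex set set set set" where
  "trivial_maximal_J_classes S \<sigma> =
     {C \<in> maximal_J_classes S (sandwich \<sigma>).
        \<exists>\<alpha>\<in>S. C = {\<alpha>} \<and> \<not> (\<exists>\<gamma>\<in>S. \<exists>\<delta>\<in>S. \<alpha> = \<gamma> \<odot> \<sigma> \<odot> \<delta>)}"

definition nontrivial_maximal_J_classes ::
    "vertex set set set \<Rightarrow> vertex set set \<Rightarrow> vertex set set set set" where
  "nontrivial_maximal_J_classes S \<sigma> =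
     maximal_J_classes S (sandwich \<sigma>) - trivial_maximal_J_classes S \<sigma>"

end

theory Submission
  imports Defs
begin

text \<open>The proof turns planarity into a combinatorial condition and then argues in a category.

\<^item> Read the boundary of the rectangle counterclockwise, starting at the upper right corner, so that
  the vertex \<open>x\<close> has position \<open>-x\<close> and \<open>x'\<close> has position \<open>x\<close>. A partition is planar iff it is
  noncrossing, that is, no block separates two points of another block in this linear order
  (\<open>planar_partitions_eq\<close>). If a drawing exists, the rectangle is bent into half an annulus, which
  puts all vertices on one line; there interlaced paths meet, by the Fashoda meet theorem.
  Conversely, the rectangle is stretched to a convex lens no three of whose vertices are collinear,
  and straight chords of the lens with non-interlaced endpoints meet only in shared endpoints.
\<^item> Composition is associative, and noncrossing partitions are closed under it: components of the
  product graph are drawn with chords in two stacked rectangles, where interlaced components would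
  again have to meet (\<open>noncrossing_prod\<close>). Block sizes at most two survive because components of
  the product graph are then walked through deterministically, and perfect matchings survive by a
  parity count.
\<^item> A diagram of rank \<open>q\<close> splits through the object \<open>q\<close> into a factor with a left inverse and a
  factor with a right inverse (\<open>diagrams_split\<close>), and the only endomorphism of \<open>n\<close> of rank \<open>n\<close> is the
  identity (\<open>full_rank_identity\<close>), because its blocks match the two rows monotonically. Hence rank is
  submultiplicative, a diagram that loses no rank under left multiplication can be recovered
  (\<open>left_stable\<close>), and \<open>\<sigma>\<beta>\<sigma> = \<sigma>\<close> as soon as \<open>\<sigma>\<beta>\<sigma>\<close> has the rank of \<open>\<sigma>\<close>.

Let \<open>S\<close> be the hom-set carrying the sandwich operation. The facts above give
\<open>V(\<sigma>) = D\<^sub>r\<^sup>\<sigma>\<close>; this set is one \<open>J\<close>-class, it lies below every pre-inverse of \<open>\<sigma>\<close> and above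
every element of \<open>S\<sigma>S\<close>, and only pre-inverses lie above it. An element outside \<open>S\<sigma>S\<close> lies in no
principal ideal but its own, and \<open>S\<sigma>S\<close> consists of the elements of rank at most \<open>r\<close>: the identity of a
smaller object factors through \<open>r\<close> (\<open>diagrams_ladder\<close>). So the only candidate for a nontrivial
maximal class is \<open>V(\<sigma>)\<close>, and it is maximal iff every pre-inverse already belongs to it. If
\<open>r = n\<close>, then \<open>\<sigma>\<alpha>\<close> is the identity for every \<open>\<alpha> \<in> V(\<sigma>)\<close>, so \<open>V(\<sigma>)\<close> acts on the right as identities.\<close>

section \<open>Interlaced paths in a rectangle meet\<close>

text \<open>The linear order in which a vertex is met on the boundary of the rectangle, read counterclockwise
from the upper right corner to the lower right corner. Middle vertices do not lie there; their value is
a dummy.\<close>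

fun boundary_pos :: "vertex \<Rightarrow> real" where
  "boundary_pos (Upper x) = - real x"
| "boundary_pos (Lower x) = real x"
| "boundary_pos (Middle x) = 0"

text \<open>Bends the rectangle of height \<open>h\<close> into half an annulus: the first coordinate becomes the radius,
the second the angle. The lower side goes to the positive and the upper side to the negative
half-line.\<close>

definition half_turn :: "real \<Rightarrow> real \<times> real \<Rightarrow> real^2" where
  "half_turn h z = vector [fst z * cos (pi * snd z / h), fst z * sin (pi * snd z / h)]"

text \<open>The abscissa of the image under \<open>half_turn\<close> of a point on the lower or the upper side. All points
off the lower side are treated as points of the upper side.\<close>

definition rim :: "real \<times> real \<Rightarrow> real" where
  "rim z = (if snd z = 0 then fst z else - fst z)"

lemma half_turn_nth [simp]:
  "half_turn h z $ 1 = fst z * cos (pi * snd z / h)"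
  "half_turn h z $ 2 = fst z * sin (pi * snd z / h)"
  by (simp_all add: half_turn_def)

lemma inj_on_half_turn:
  assumes "h > 0"
  shows "inj_on (half_turn h) ({1..M} \<times> {0..h})"
proof (rule inj_onI)
  fix z w
  assume z: "z \<in> {1..M} \<times> {0..h}" and w: "w \<in> {1..M} \<times> {0..h}" and e: "half_turn h z = half_turn h w"
  define s t where "s = pi * snd z / h" and "t = pi * snd w / h"
  have 1: "fst z * cos s = fst w * cos t" and 2: "fst z * sin s = fst w * sin t"
    using arg_cong[OF e, of "\<lambda>v. v $ 1"] arg_cong[OF e, of "\<lambda>v. v $ 2"]
    by (simp_all add: s_def t_def)
  have "(fst z)\<^sup>2 = (fst z * cos s)\<^sup>2 + (fst z * sin s)\<^sup>2"
    by (simp add: power_mult_distrib flip: distrib_left)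
  also have "\<dots> = (fst w)\<^sup>2"
    unfolding 1 2 by (simp add: power_mult_distrib flip: distrib_left)
  finally have f: "fst z = fst w" using z w by (auto simp: power2_eq_iff)
  have "cos s = cos t" using 1 f z by auto
  moreover have "s \<in> {0..pi}" "t \<in> {0..pi}"
    using z w assms by (auto simp: s_def t_def field_simps)
  ultimately have "s = t" using cos_inj_pi by auto
  then have "snd z = snd w" using assms by (simp add: s_def t_def)
  with f show "z = w" by (simp add: prod_eq_iff)
qed

lemma continuous_on_half_turn: "continuous_on S (half_turn h)"
proof -
  have "continuous_on S (\<lambda>z. \<chi> i::2. if i = 1 then fst z * cos (pi * snd z / h) else fst z * sin (pi * snd z / h))"
  proof (intro continuous_on_vec_lambda)
    fix i :: 2
    show "continuous_on S (\<lambda>z. if i = 1 then fst z * cos (pi * snd z / h) else fst z * sin (pi * snd z / h))"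
      by (cases "i = 1") (auto intro!: continuous_intros simp: divide_inverse)
  qed
  also have "(\<lambda>z. \<chi> i::2. if i = 1 then fst z * cos (pi * snd z / h) else fst z * sin (pi * snd z / h)) = half_turn h"
    by (auto simp: fun_eq_iff vec_eq_iff forall_2)
  finally show ?thesis .
qed

lemma half_turn_rim:
  assumes "snd z = 0 \<or> snd z = h" "h > 0"
  shows "half_turn h z $ 1 = rim z" "half_turn h z $ 2 = 0"
  using assms by (auto simp: rim_def)

text \<open>After the half turn both paths lie in one box and end on its lower side, where the interlacing
theorem \<open>fashoda_interlace\<close> applies.\<close>

lemma interlaced_paths_meet:
  fixes p q :: "real \<Rightarrow> real \<times> real"
  assumes h: "h > 0"
    and p: "path p" "path_image p \<subseteq> {1..M} \<times> {0..h}"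
      "snd (pathstart p) = 0 \<or> snd (pathstart p) = h" "snd (pathfinish p) = 0 \<or> snd (pathfinish p) = h"
    and q: "path q" "path_image q \<subseteq> {1..M} \<times> {0..h}"
      "snd (pathstart q) = 0 \<or> snd (pathstart q) = h" "snd (pathfinish q) = 0 \<or> snd (pathfinish q) = h"
    and rim: "rim (pathstart p) < rim (pathstart q)" "rim (pathstart q) < rim (pathfinish p)"
      "rim (pathfinish p) < rim (pathfinish q)"
  shows "path_image p \<inter> path_image q \<noteq> {}"
proof -
  define a b :: "real^2" where "a = vector [-M, 0]" and "b = vector [M, M]"
  have box: "half_turn h ` ({1..M} \<times> {0..h}) \<subseteq> cbox a b"
  proof
    fix v assume "v \<in> half_turn h ` ({1..M} \<times> {0..h})"
    then obtain x y where xy: "1 \<le> x" "x \<le> M" "0 \<le> y" "y \<le> h" "v = half_turn h (x, y)" by auto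
    define t where "t = pi * y / h"
    have t: "0 \<le> t" "t \<le> pi" using xy h by (auto simp: t_def field_simps)
    have "\<bar>x * cos t\<bar> \<le> M * 1" "\<bar>x * sin t\<bar> \<le> M * 1"
      using xy unfolding abs_mult by (intro mult_mono; simp)+
    moreover have "0 \<le> x * sin t" using sin_ge_zero[OF t] xy by simp
    ultimately show "v \<in> cbox a b"
      using xy by (auto simp: mem_box_cart forall_2 a_def b_def t_def)
  qed
  let ?p = "half_turn h \<circ> p" and ?q = "half_turn h \<circ> q"
  have "path ?p" "path ?q"
    using p(1) q(1) by (auto intro!: path_continuous_image continuous_on_half_turn)
  moreover have "path_image ?p \<subseteq> cbox a b" "path_image ?q \<subseteq> cbox a b"
    using p(2) q(2) box unfolding path_image_compose by blast+
  ultimately obtain z where z: "z \<in> path_image ?p" "z \<in> path_image ?q"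
    using half_turn_rim[OF p(3) h] half_turn_rim[OF p(4) h] half_turn_rim[OF q(3) h]
      half_turn_rim[OF q(4) h] rim
    by (elim fashoda_interlace[of ?p ?q a b])
       (auto simp add: pathstart_compose pathfinish_compose a_def simp del: half_turn_nth)
  then obtain s t where st: "s \<in> path_image p" "t \<in> path_image q" "half_turn h s = half_turn h t"
    by (auto simp: path_image_compose)
  then have "s = t" using inj_onD[OF inj_on_half_turn[OF h, of M]] p(2) q(2) by blast
  with st show ?thesis by auto
qed

section \<open>Chords of a convex lens\<close>

text \<open>Height of the lens over the abscissa \<open>x\<close>. It is strictly concave and at least 1 for
\<open>1 \<le> x \<le> M\<close>.\<close>

definition width :: "nat \<Rightarrow> real \<Rightarrow> real" where
  "width M x = 1 + x * (real M + 1 - x)"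

text \<open>The vertices are moved to the boundary of the convex region \<open>\<bar>y\<bar> \<le> width M x / 2\<close>. No three of
them are collinear. The value at middle vertices is a dummy.\<close>

fun lens :: "nat \<Rightarrow> vertex \<Rightarrow> real \<times> real" where
  "lens M (Upper x) = (real x, width M (real x) / 2)"
| "lens M (Lower x) = (real x, - width M (real x) / 2)"
| "lens M (Middle x) = (real x, 0)"

text \<open>Maps the lens back onto the rectangle, vertical line by vertical line.\<close>

definition flatten :: "nat \<Rightarrow> real \<times> real \<Rightarrow> real \<times> real" where
  "flatten M z = (fst z, 1 / 2 + snd z / width M (fst z))"

text \<open>The drawing of an edge: a straight segment in the lens, mapped back to the rectangle.\<close>

definition chord :: "nat \<Rightarrow> vertex \<Rightarrow> vertex \<Rightarrow> real \<Rightarrow> real \<times> real" where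
  "chord M u v = flatten M \<circ> linepath (lens M u) (lens M v)"

text \<open>Twice the signed area of the triangle \<open>p q s\<close>; positive iff it is oriented counterclockwise.\<close>

definition orient :: "real \<times> real \<Rightarrow> real \<times> real \<Rightarrow> real \<times> real \<Rightarrow> real" where
  "orient p q s = (fst q - fst p) * (snd s - snd p) - (snd q - snd p) * (fst s - fst p)"

lemma vertices_cases:
  assumes "u \<in> vertices m n"
  obtains x where "u = Upper x" "1 \<le> x" "x \<le> m" | x where "u = Lower x" "1 \<le> x" "x \<le> n"
  using assms by (auto simp: vertices_def)

lemma width_pos: "1 \<le> x \<Longrightarrow> x \<le> real M \<Longrightarrow> width M x \<ge> 1"
  by (auto simp: width_def)

lemma width_ge:
  assumes "1 \<le> a" "a \<le> real M" "1 \<le> b" "b \<le> c" "c \<le> real M"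
  shows "2 * width M a + (a - b) * (a - c) > 0"
proof (cases "a \<le> b \<or> c \<le> a")
  case True
  then have "0 \<le> (a - b) * (a - c)" using assms by (auto simp: zero_le_mult_iff)
  then show ?thesis using width_pos[of a M] assms by linarith
next
  case False
  then have "(a - b) * (c - a) \<le> a * (real M + 1 - a)"
    using assms by (intro mult_mono) auto
  moreover have "(a - b) * (a - c) = - ((a - b) * (c - a))" by (simp add: algebra_simps)
  ultimately show ?thesis
    using assms mult_nonneg_nonneg[of a "real M + 1 - a"] unfolding width_def by argo
qed

lemma orient_lens_eq:
  "orient (lens M (Lower x)) (lens M (Lower y)) (lens M (Lower z)) =
     (real y - real x) * (real z - real x) * (real z - real y) / 2"
  "orient (lens M (Upper x)) (lens M (Lower y)) (lens M (Lower z)) =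
     (real z - real y) * (2 * width M (real x) + (real x - real y) * (real x - real z)) / 2"
  "orient (lens M (Upper x)) (lens M (Upper y)) (lens M (Lower z)) =
     (real x - real y) * (2 * width M (real z) + (real z - real y) * (real z - real x)) / 2"
  "orient (lens M (Upper x)) (lens M (Upper y)) (lens M (Upper z)) =
     (real x - real y) * (real x - real z) * (real y - real z) / 2"
  by (simp_all add: orient_def width_def field_simps)

text \<open>The order \<open>boundary_pos\<close> runs counterclockwise around the lens.\<close>

lemma orient_lens_pos:
  assumes "u \<in> vertices M M" "v \<in> vertices M M" "w \<in> vertices M M"
    and "boundary_pos u < boundary_pos v" "boundary_pos v < boundary_pos w"
  shows "orient (lens M u) (lens M v) (lens M w) > 0"
  using assms
  by (elim vertices_cases) (auto simp: orient_lens_eq simp del: lens.simps intro!: mult_pos_pos width_ge)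

lemma boundary_pos_inj:
  assumes "u \<in> vertices m n" "v \<in> vertices m' n'" "boundary_pos u = boundary_pos v"
  shows "u = v"
  using assms by (elim vertices_cases) auto

lemma orient_rotate: "orient p q s = orient q s p"
  by (simp add: orient_def algebra_simps)

lemma orient_swap: "orient p q s = - orient p s q"
  by (simp add: orient_def algebra_simps)

text \<open>The line through two vertices separates the vertices strictly between them in the boundary order
from the remaining ones.\<close>

lemma orient_lens_sign:
  assumes "u \<in> vertices M M" "v \<in> vertices M M" "w \<in> vertices M M"
    and uv: "boundary_pos u < boundary_pos v"
  shows "boundary_pos w < boundary_pos u \<or> boundary_pos v < boundary_pos w
      \<Longrightarrow> orient (lens M u) (lens M v) (lens M w) > 0"
    and "boundary_pos u < boundary_pos w \<Longrightarrow> boundary_pos w < boundary_pos v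
      \<Longrightarrow> orient (lens M u) (lens M v) (lens M w) < 0"
    and "w = u \<or> w = v \<Longrightarrow> orient (lens M u) (lens M v) (lens M w) = 0"
proof -
  show "boundary_pos w < boundary_pos u \<or> boundary_pos v < boundary_pos w
      \<Longrightarrow> orient (lens M u) (lens M v) (lens M w) > 0"
    using orient_lens_pos[of u M v w] orient_lens_pos[of w M u v] assms orient_rotate by metis
  show "boundary_pos u < boundary_pos w \<Longrightarrow> boundary_pos w < boundary_pos v
      \<Longrightarrow> orient (lens M u) (lens M v) (lens M w) < 0"
    using orient_lens_pos[of u M w v] assms orient_swap[of "lens M u" "lens M v"] by simp
  show "w = u \<or> w = v \<Longrightarrow> orient (lens M u) (lens M v) (lens M w) = 0"
    by (auto simp: orient_def)
qed

lemma orient_linepath: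
  "orient p q (linepath a b t) = (1 - t) * orient p q a + t * orient p q b"
  by (simp add: orient_def linepath_def algebra_simps)

text \<open>For \<open>u\<close> before \<open>v\<close>: either both \<open>p\<close> and \<open>q\<close> lie between \<open>u\<close> and \<open>v\<close>, or neither does; coinciding
with \<open>u\<close> or \<open>v\<close> is allowed in both cases.\<close>

abbreviation not_interlaced :: "vertex \<Rightarrow> vertex \<Rightarrow> vertex \<Rightarrow> vertex \<Rightarrow> bool" where
  "not_interlaced u v p q \<equiv>
     (\<forall>w\<in>{p, q}. boundary_pos u \<le> boundary_pos w \<and> boundary_pos w \<le> boundary_pos v) \<or>
     (\<forall>w\<in>{p, q}. boundary_pos w \<le> boundary_pos u \<or> boundary_pos v \<le> boundary_pos w)"

text \<open>The signed distance from the line through \<open>u\<close> and \<open>v\<close> is affine along the other segment. Its values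
at \<open>p\<close> and \<open>q\<close> do not have opposite signs, as the pairs are not interlaced, so it can
vanish only at an endpoint, which is then \<open>u\<close> or \<open>v\<close>.\<close>

lemma lens_segments_meet:
  assumes V: "u \<in> vertices M M" "v \<in> vertices M M" "p \<in> vertices M M" "q \<in> vertices M M"
    and uv: "boundary_pos u < boundary_pos v"
    and ne: "{u, v} \<noteq> {p, q}" "p \<noteq> q"
    and cross: "not_interlaced u v p q"
    and s: "s \<in> {0..1}" and t: "t \<in> {0..1}"
    and eq: "linepath (lens M u) (lens M v) s = linepath (lens M p) (lens M q) t"
  shows "(t = 0 \<and> p \<in> {u, v}) \<or> (t = 1 \<and> q \<in> {u, v})"
proof -
  define F where "F w = orient (lens M u) (lens M v) (lens M w)" for w
  have sign: "boundary_pos w < boundary_pos u \<or> boundary_pos v < boundary_pos w \<Longrightarrow> F w > 0"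
    "boundary_pos u < boundary_pos w \<and> boundary_pos w < boundary_pos v \<Longrightarrow> F w < 0"
    "w \<in> {u, v} \<Longrightarrow> F w = 0" if "w \<in> vertices M M" for w
    using orient_lens_sign[OF V(1,2) that uv] by (auto simp: F_def)
  have zero: "F w = 0 \<longleftrightarrow> w \<in> {u, v}" if "w \<in> vertices M M" for w
    using sign[OF that] boundary_pos_inj[OF that V(1)] boundary_pos_inj[OF that V(2)]
    by (metis insertI1 insertI2 less_irrefl linorder_neqE_linordered_idom)
  have "(1 - t) * F p + t * F q = 0"
    using arg_cong[OF eq, of "orient (lens M u) (lens M v)"] sign(3)[of u] sign(3)[of v] V
    by (simp add: orient_linepath F_def)
  moreover have "(F p \<ge> 0 \<and> F q \<ge> 0) \<or> (F p \<le> 0 \<and> F q \<le> 0)"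
    using cross
  proof
    assume "\<forall>w\<in>{p, q}. boundary_pos u \<le> boundary_pos w \<and> boundary_pos w \<le> boundary_pos v"
    then have "F w \<le> 0" if "w \<in> {p, q}" for w
      using sign(2)[of w] zero[of w] V that boundary_pos_inj[of w M M]
      by (metis insertE insertI1 insertI2 less_eq_real_def singletonD)
    then show ?thesis by auto
  next
    assume "\<forall>w\<in>{p, q}. boundary_pos w \<le> boundary_pos u \<or> boundary_pos v \<le> boundary_pos w"
    then have "F w \<ge> 0" if "w \<in> {p, q}" for w
      using sign(1)[of w] zero[of w] V that boundary_pos_inj[of w M M]
      by (metis insertE insertI1 insertI2 less_eq_real_def singletonD)
    then show ?thesis by auto
  qed
  then have "((1 - t) * F p \<ge> 0 \<and> t * F q \<ge> 0) \<or> ((1 - t) * F p \<le> 0 \<and> t * F q \<le> 0)"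
    using t by (auto simp: mult_nonneg_nonneg mult_nonneg_nonpos)
  ultimately have *: "(1 - t) * F p = 0" "t * F q = 0" by linarith+
  show ?thesis
  proof (cases "t = 0 \<or> t = 1")
    case True
    then show ?thesis using * zero V by auto
  next
    case False
    then have "p \<in> {u, v}" "q \<in> {u, v}" using * zero V by auto
    then show ?thesis using ne by auto
  qed
qed

text \<open>Strict concavity of \<open>width\<close>: inner points of a chord are inner points of the lens. A vertical chord
joins the two sides, which is the case where the concavity gains nothing.\<close>

lemma lens_segment_interior:
  assumes "u \<in> vertices M M" "v \<in> vertices M M" "u \<noteq> v" "0 < t" "t < 1"
  defines "z \<equiv> linepath (lens M u) (lens M v) t"
  shows "\<bar>snd z\<bar> < width M (fst z) / 2"
proof -
  define a b where "a = fst (lens M u)" and "b = fst (lens M v)"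
  have ab: "width M a \<ge> 1" "width M b \<ge> 1"
    using assms(1,2) by (auto simp: a_def b_def elim!: vertices_cases intro!: width_pos)
  (* The quadratic term measures how far the chord lies inside the lens. *)
  have conc: "width M (fst z) = (1 - t) * width M a + t * width M b + t * (1 - t) * (a - b)\<^sup>2"
    by (simp add: z_def linepath_def a_def b_def width_def power2_eq_square algebra_simps)
  define P Q where "P = (1 - t) * width M a" and "Q = t * width M b"
  have PQ: "P > 0" "Q > 0" using ab assms by (auto simp: P_def Q_def)
  have ge: "width M (fst z) \<ge> P + Q" using conc assms by (simp add: P_def Q_def)
  have gt: "width M (fst z) > P + Q" if "a \<noteq> b" using that conc assms by (simp add: P_def Q_def)
  have sz: "snd z = (1 - t) * snd (lens M u) + t * snd (lens M v)"
    by (simp add: z_def linepath_def)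
  have sg: "snd (lens M u) = width M a / 2 \<or> snd (lens M u) = - width M a / 2"
    "snd (lens M v) = width M b / 2 \<or> snd (lens M v) = - width M b / 2"
    "a = b \<Longrightarrow> snd (lens M u) = - snd (lens M v)"
    using assms(1-3) by (auto simp: a_def b_def elim!: vertices_cases)
  have "snd z = (P + Q) / 2 \<and> a \<noteq> b \<or> snd z = - (P + Q) / 2 \<and> a \<noteq> b \<or>
      snd z = (P - Q) / 2 \<or> snd z = (Q - P) / 2"
    using sg(1)
  proof
    assume u: "snd (lens M u) = width M a / 2"
    from sg(2) show ?thesis
    proof
      assume v: "snd (lens M v) = width M b / 2"
      then have "a \<noteq> b" using sg(3) u ab by auto
      moreover have "snd z = (P + Q) / 2" unfolding sz u v P_def Q_def by (simp add: field_simps)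
      ultimately show ?thesis by blast
    next
      assume v: "snd (lens M v) = - width M b / 2"
      have "snd z = (P - Q) / 2" unfolding sz u v P_def Q_def by (simp add: field_simps)
      then show ?thesis by blast
    qed
  next
    assume u: "snd (lens M u) = - width M a / 2"
    from sg(2) show ?thesis
    proof
      assume v: "snd (lens M v) = width M b / 2"
      have "snd z = (Q - P) / 2" unfolding sz u v P_def Q_def by (simp add: field_simps)
      then show ?thesis by blast
    next
      assume v: "snd (lens M v) = - width M b / 2"
      then have "a \<noteq> b" using sg(3) u ab by auto
      moreover have "snd z = - (P + Q) / 2" unfolding sz u v P_def Q_def by (simp add: field_simps)
      ultimately show ?thesis by blast
    qed
  qed
  then show ?thesis using PQ ge gt by (auto simp: abs_if)
qed

lemma lens_segment_fst:
  assumes "u \<in> vertices M M" "v \<in> vertices M M" "t \<in> {0..1}"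
  shows "fst (linepath (lens M u) (lens M v) t) \<in> {1..real M}"
proof -
  have "fst (linepath (lens M u) (lens M v) t) = linepath (fst (lens M u)) (fst (lens M v)) t"
    by (simp add: linepath_def)
  also have "\<dots> \<in> closed_segment (fst (lens M u)) (fst (lens M v))"
    using assms(3) by (auto simp: linepath_image_01[symmetric] simp del: linepath_image_01)
  also have "\<dots> \<subseteq> {1..real M}"
    using assms(1,2) by (intro closed_segment_subset) (auto elim!: vertices_cases)
  finally show ?thesis .
qed

lemma flatten_lens:
  assumes "u \<in> vertices M M"
  shows "flatten M (lens M u) = position u"
  using assms
proof (elim vertices_cases)
  fix x assume "u = Upper x" "1 \<le> x" "x \<le> M"
  then show ?thesis using width_pos[of "real x" M] by (simp add: flatten_def)
next
  fix x assume "u = Lower x" "1 \<le> x" "x \<le> M"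
  then show ?thesis using width_pos[of "real x" M] by (simp add: flatten_def)
qed

lemma flatten_inj:
  assumes "flatten M z = flatten M w" "fst z \<in> {1..real M}"
  shows "z = w"
proof -
  have "fst z = fst w" using assms(1) by (simp add: flatten_def)
  moreover have "snd z = snd w"
    using assms calculation width_pos[of "fst z" M] by (simp add: flatten_def)
  ultimately show ?thesis by (simp add: prod_eq_iff)
qed

lemma continuous_on_flatten: "continuous_on ({1..real M} \<times> UNIV) (flatten M)"
proof -
  have "width M (fst z) \<noteq> 0" if "z \<in> {1..real M} \<times> UNIV" for z
    using width_pos[of "fst z" M] that by auto
  then show ?thesis unfolding flatten_def[abs_def] width_def by (intro continuous_intros) auto
qed

lemma chord_ends:
  assumes "u \<in> vertices M M" "v \<in> vertices M M"
  shows "pathstart (chord M u v) = position u" "pathfinish (chord M u v) = position v"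
  using assms by (simp_all add: chord_def pathstart_compose pathfinish_compose flatten_lens)

lemma path_chord:
  assumes "u \<in> vertices M M" "v \<in> vertices M M"
  shows "path (chord M u v)"
proof -
  have "path_image (linepath (lens M u) (lens M v)) \<subseteq> {1..real M} \<times> UNIV"
    unfolding path_image_def mem_Times_iff subset_iff using lens_segment_fst[OF assms] by blast
  then show ?thesis
    unfolding chord_def
    by (intro path_continuous_image continuous_on_subset[OF continuous_on_flatten]) auto
qed

lemma lens_inj:
  assumes "u \<in> vertices M M" "v \<in> vertices M M" "lens M u = lens M v"
  shows "u = v"
proof -
  have "width M (real x) \<noteq> - width M (real x)" if "1 \<le> x" "x \<le> M" for x
    using width_pos[of "real x" M] that by simp
  then show ?thesis using assms by (elim vertices_cases) auto
qed

lemma arc_chord: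
  assumes "u \<in> vertices M M" "v \<in> vertices M M" "u \<noteq> v"
  shows "arc (chord M u v)"
proof -
  have "arc (linepath (lens M u) (lens M v))" using lens_inj[OF assms(1,2)] assms(3) by (intro arc_linepath) auto
  then have inj: "inj_on (linepath (lens M u) (lens M v)) {0..1}" by (simp add: arc_def)
  have "inj_on (chord M u v) {0..1}"
  proof (rule inj_onI)
    fix s t :: real assume st: "s \<in> {0..1}" "t \<in> {0..1}" "chord M u v s = chord M u v t"
    then have "linepath (lens M u) (lens M v) s = linepath (lens M u) (lens M v) t"
      using lens_segment_fst[OF assms(1,2) st(1)] by - (rule flatten_inj[of M], simp_all add: chord_def)
    then show "s = t" using inj_onD[OF inj] st by blast
  qed
  then show ?thesis using path_chord[OF assms(1,2)] by (simp add: arc_def)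
qed

lemma chord_interior:
  assumes "u \<in> vertices M M" "v \<in> vertices M M" "u \<noteq> v" "0 < t" "t < 1"
  shows "fst (chord M u v t) \<in> {1..real M}" "0 < snd (chord M u v t)" "snd (chord M u v t) < 1"
proof -
  define z where "z = linepath (lens M u) (lens M v) t"
  have f: "fst z \<in> {1..real M}" using lens_segment_fst[OF assms(1,2)] assms by (simp add: z_def)
  then have w: "width M (fst z) > 0" using width_pos[of "fst z" M] by auto
  have "\<bar>snd z\<bar> < width M (fst z) / 2" using lens_segment_interior[OF assms] by (simp add: z_def)
  then have "- (1 / 2) < snd z / width M (fst z)" "snd z / width M (fst z) < 1 / 2"
    using w by (auto simp: field_simps abs_less_iff)
  then show "0 < snd (chord M u v t)" "snd (chord M u v t) < 1"
    unfolding chord_def flatten_def o_def snd_conv z_def[symmetric] by linarith+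
  show "fst (chord M u v t) \<in> {1..real M}"
    using f by (auto simp: chord_def flatten_def z_def[symmetric])
qed

lemma position_in_box:
  "u \<in> vertices M M \<Longrightarrow> position u \<in> {1..real M} \<times> {0..1}"
  by (auto elim!: vertices_cases)

lemma position_snd: "u \<in> vertices m n \<Longrightarrow> snd (position u) = 0 \<or> snd (position u) = 1"
  by (auto elim!: vertices_cases)

lemma chord_at_ends:
  assumes "u \<in> vertices M M" "v \<in> vertices M M"
  shows "chord M u v 0 = position u" "chord M u v 1 = position v"
  using chord_ends[OF assms] by (simp_all add: pathstart_def pathfinish_def)

lemma chord_image_box:
  assumes "u \<in> vertices M M" "v \<in> vertices M M" "u \<noteq> v"
  shows "path_image (chord M u v) \<subseteq> {1..real M} \<times> {0..1}"
proof
  fix z assume "z \<in> path_image (chord M u v)"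
  then obtain t where t: "t \<in> {0..1}" "z = chord M u v t" by (auto simp: path_image_def)
  show "z \<in> {1..real M} \<times> {0..1}"
  proof (cases "t = 0 \<or> t = 1")
    case True
    then show ?thesis using t position_in_box chord_at_ends assms by metis
  next
    case False
    then have "0 < t" "t < 1" using t by auto
    from chord_interior[OF assms this] show ?thesis using t by (auto simp: mem_Times_iff)
  qed
qed

lemma chord_image_rim:
  assumes "u \<in> vertices M M" "v \<in> vertices M M" "u \<noteq> v"
    and "z \<in> path_image (chord M u v)" "snd z = 0 \<or> snd z = 1"
  shows "z = position u \<or> z = position v"
proof -
  obtain t where t: "t \<in> {0..1}" "z = chord M u v t" using assms(4) by (auto simp: path_image_def)
  have "t = 0 \<or> t = 1"
  proof (rule ccontr)
    assume "\<not> ?thesis"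
    then have "0 < t" "t < 1" using t by auto
    from chord_interior[OF assms(1-3) this] show False using t assms(5) by auto
  qed
  then show ?thesis using t chord_at_ends[OF assms(1,2)] by auto
qed

lemma chords_meet:
  assumes V: "u \<in> vertices M M" "v \<in> vertices M M" "p \<in> vertices M M" "q \<in> vertices M M"
    and uv: "boundary_pos u < boundary_pos v"
    and ne: "{u, v} \<noteq> {p, q}" "p \<noteq> q"
    and cross: "not_interlaced u v p q"
  shows "path_image (chord M u v) \<inter> path_image (chord M p q) \<subseteq> position ` ({u, v} \<inter> {p, q})"
proof
  fix z assume "z \<in> path_image (chord M u v) \<inter> path_image (chord M p q)"
  then obtain s t where st: "s \<in> {0..1}" "t \<in> {0..1}" "z = chord M u v s" "z = chord M p q t"
    by (auto simp: path_image_def)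
  then have "linepath (lens M u) (lens M v) s = linepath (lens M p) (lens M q) t"
    using lens_segment_fst[OF V(1,2) st(1)] by - (rule flatten_inj[of M], simp_all add: chord_def)
  from lens_segments_meet[OF V uv ne cross st(1,2) this]
  show "z \<in> position ` ({u, v} \<inter> {p, q})"
    using st(4) chord_at_ends[OF V(3,4)] by auto
qed

section \<open>Planar partitions are the noncrossing partitions\<close>

text \<open>The equivalence relation of lying in a common block. A partition of the vertices is determined by
it, and most arguments below use it in place of the blocks.\<close>

definition conn :: "vertex set set \<Rightarrow> (vertex \<times> vertex) set" where
  "conn \<alpha> = {(u, v). \<exists>A\<in>\<alpha>. u \<in> A \<and> v \<in> A}"

lemma equiv_conn: "\<alpha> \<in> partitions m n \<Longrightarrow> equiv (vertices m n) (conn \<alpha>)"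
  unfolding partitions_def conn_def using equiv_partition_on by auto

lemma quotient_conn: "\<alpha> \<in> partitions m n \<Longrightarrow> vertices m n // conn \<alpha> = \<alpha>"
  unfolding partitions_def conn_def using partition_on_eq_quotient by auto

lemma partitions_eqI:
  "\<alpha> \<in> partitions m n \<Longrightarrow> \<beta> \<in> partitions m n \<Longrightarrow> conn \<alpha> = conn \<beta> \<Longrightarrow> \<alpha> = \<beta>"
  by (metis quotient_conn)

lemma conn_sym: "(u, v) \<in> conn \<alpha> \<Longrightarrow> (v, u) \<in> conn \<alpha>"
  by (auto simp: conn_def)

lemma conn_trans:
  "\<alpha> \<in> partitions m n \<Longrightarrow> (u, v) \<in> conn \<alpha> \<Longrightarrow> (v, w) \<in> conn \<alpha> \<Longrightarrow> (u, w) \<in> conn \<alpha>"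
  by (meson equiv_conn equivE transD)

lemma conn_refl_iff: "\<alpha> \<in> partitions m n \<Longrightarrow> (u, u) \<in> conn \<alpha> \<longleftrightarrow> u \<in> vertices m n"
  by (auto simp: conn_def partitions_def partition_on_def)

lemma conn_vertices: "\<alpha> \<in> partitions m n \<Longrightarrow> (u, v) \<in> conn \<alpha> \<Longrightarrow> u \<in> vertices m n \<and> v \<in> vertices m n"
  by (auto simp: conn_def partitions_def partition_on_def)

lemma conn_quotient:
  assumes "equiv V r"
  shows "conn (V // r) = r"
proof -
  have "(u, v) \<in> conn (V // r) \<longleftrightarrow> (\<exists>w\<in>V. (w, u) \<in> r \<and> (w, v) \<in> r)" for u v
    by (auto simp: conn_def quotient_def)
  also have "\<dots> u v \<longleftrightarrow> (u, v) \<in> r" for u v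
    using assms unfolding equiv_def refl_on_def sym_def trans_def by blast
  finally show ?thesis by auto
qed

lemma finite_vertices [simp]: "finite (vertices m n)"
  by (simp add: vertices_def)

lemma vertices_mono: "m \<le> m' \<Longrightarrow> n \<le> n' \<Longrightarrow> vertices m n \<subseteq> vertices m' n'"
  by (auto simp: vertices_def)

text \<open>No two distinct blocks are interlaced with respect to \<open>boundary_pos\<close>.\<close>

definition noncrossing :: "vertex set set \<Rightarrow> bool" where
  "noncrossing \<alpha> \<longleftrightarrow> (\<forall>a b c d. boundary_pos a < boundary_pos b \<longrightarrow> boundary_pos b < boundary_pos c \<longrightarrow>
     boundary_pos c < boundary_pos d \<longrightarrow> (a, c) \<in> conn \<alpha> \<longrightarrow> (b, d) \<in> conn \<alpha> \<longrightarrow> (a, b) \<in> conn \<alpha>)"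

lemma noncrossingD:
  "noncrossing \<alpha> \<Longrightarrow> boundary_pos a < boundary_pos b \<Longrightarrow> boundary_pos b < boundary_pos c \<Longrightarrow>
     boundary_pos c < boundary_pos d \<Longrightarrow> (a, c) \<in> conn \<alpha> \<Longrightarrow> (b, d) \<in> conn \<alpha> \<Longrightarrow> (a, b) \<in> conn \<alpha>"
  unfolding noncrossing_def by blast

text \<open>A walk along the steps of \<open>R\<close> is turned into a path, provided every step reachable from \<open>u\<close> can be
drawn inside \<open>S\<close>.\<close>

lemma walk_path:
  fixes pos :: "'a \<Rightarrow> 'b::topological_space"
  assumes "(u, v) \<in> R\<^sup>*" "pos u \<in> S"
    and step: "\<And>x y. (u, x) \<in> R\<^sup>* \<Longrightarrow> (x, y) \<in> R \<Longrightarrow>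
      \<exists>g. path g \<and> pathstart g = pos x \<and> pathfinish g = pos y \<and> path_image g \<subseteq> S"
  shows "\<exists>g. path g \<and> pathstart g = pos u \<and> pathfinish g = pos v \<and> path_image g \<subseteq> S"
  using assms(1)
proof (induction rule: rtrancl_induct)
  case base
  show ?case
    by (rule exI[of _ "\<lambda>_. pos u"])
       (use assms(2) in \<open>auto simp: path_def pathstart_def pathfinish_def path_image_def\<close>)
next
  case (step x y)
  then obtain g h where
    "path g" "pathstart g = pos u" "pathfinish g = pos x" "path_image g \<subseteq> S"
    "path h" "pathstart h = pos x" "pathfinish h = pos y" "path_image h \<subseteq> S"
    using assms(3) by metis
  then show ?case by (intro exI[of _ "g +++ h"]) (auto simp: path_image_join)
qed

lemma rim_position: "u \<in> vertices m n \<Longrightarrow> rim (position u) = boundary_pos u"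
  by (auto simp: rim_def elim!: vertices_cases)

lemma equiv_same_component:
  "equiv V (same_component E \<inter> V \<times> V)"
proof (rule equivI)
  have "sym {(u, v). {u, v} \<in> E}" by (auto simp: sym_def insert_commute)
  then have "sym (same_component E)" unfolding same_component_def by (rule sym_rtrancl)
  then show "sym (same_component E \<inter> V \<times> V)" by (auto simp: sym_def)
  have "trans (same_component E)" unfolding same_component_def by (rule trans_rtrancl)
  then show "trans (same_component E \<inter> V \<times> V)" by (auto simp: trans_def)
qed (auto simp: refl_on_def same_component_def)

lemma conn_components: "conn (components V E) = same_component E \<inter> V \<times> V"
  unfolding components_def by (intro conn_quotient equiv_same_component)

text \<open>Two interlaced blocks contain interlaced paths, which meet; edges of different components have
disjoint images.\<close>

lemma planar_imp_noncrossing: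
  assumes "\<alpha> \<in> planar_partitions m n"
  shows "noncrossing \<alpha>"
proof -
  obtain E \<gamma> where E: "components (vertices m n) E = \<alpha>" and dr: "planar_drawing m n E \<gamma>"
    and \<alpha>: "\<alpha> \<in> partitions m n"
    using assms by (auto simp: planar_partitions_def)
  define R where "R = {(u, v). {u, v} \<in> E}"
  have cn: "conn \<alpha> = R\<^sup>* \<inter> vertices m n \<times> vertices m n"
    using conn_components[of "vertices m n" E] E by (simp add: same_component_def R_def)
  have sym: "sym (R\<^sup>*)" by (intro sym_rtrancl) (auto simp: sym_def R_def insert_commute)
  (* The union of the drawn edges that touch the component of u. *)
  define S where "S u = (\<Union>e\<in>{e\<in>E. e \<inter> R\<^sup>* `` {u} \<noteq> {}}. path_image (\<gamma> e))" for u
  have edge: "e \<subseteq> vertices m n" "card e = 2" "path (\<gamma> e)"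
      "{pathstart (\<gamma> e), pathfinish (\<gamma> e)} = position ` e"
      "path_image (\<gamma> e) \<subseteq> {1..real (max m n)} \<times> {0..1}" if "e \<in> E" for e
    using dr that arc_imp_path unfolding planar_drawing_def by auto
  have Spath: "\<exists>g. path g \<and> pathstart g = position u \<and> pathfinish g = position v \<and> path_image g \<subseteq> S u"
    if uv: "(u, v) \<in> R\<^sup>*" "u \<noteq> v" for u v
  proof (rule walk_path[OF uv(1)])
    obtain w where "(u, w) \<in> R" using uv by (metis converse_rtranclE)
    then have e: "{u, w} \<in> E" by (simp add: R_def)
    then have "position u \<in> path_image (\<gamma> {u, w})"
      using edge(4)[OF e] by (metis image_eqI insertE insertI1 pathfinish_in_path_image pathstart_in_path_image singletonD)
    then show "position u \<in> S u" using e by (force simp: S_def)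
    fix x y assume xy: "(u, x) \<in> R\<^sup>*" "(x, y) \<in> R"
    then have e: "{x, y} \<in> E" by (simp add: R_def)
    let ?g = "\<gamma> {x, y}"
    have "path_image ?g \<subseteq> S u" using e xy by (auto simp: S_def)
    moreover have "{pathstart ?g, pathfinish ?g} = {position x, position y}" using edge(4)[OF e] by auto
    then have "(pathstart ?g = position x \<and> pathfinish ?g = position y) \<or>
        (pathstart ?g = position y \<and> pathfinish ?g = position x)" by (auto simp: doubleton_eq_iff)
    ultimately show "\<exists>g. path g \<and> pathstart g = position x \<and> pathfinish g = position y \<and> path_image g \<subseteq> S u"
      using edge(3)[OF e] by (elim disjE) (blast, intro exI[of _ "reversepath ?g"], auto)
  qed
  have Sbox: "S u \<subseteq> {1..real (max m n)} \<times> {0..1}" for u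
    unfolding S_def using edge(5) by blast
  have Sdisj: "(u, v) \<in> R\<^sup>*" if z: "z \<in> S u" "z \<in> S v" for u v z
  proof -
    obtain e f x y where ef: "e \<in> E" "f \<in> E" "x \<in> e" "(u, x) \<in> R\<^sup>*" "y \<in> f" "(v, y) \<in> R\<^sup>*"
      "z \<in> path_image (\<gamma> e)" "z \<in> path_image (\<gamma> f)"
      using z unfolding S_def by blast
    have near: "(p, q) \<in> R\<^sup>*" if "p \<in> g" "q \<in> g" "g \<in> E" for p q g
    proof (cases "p = q")
      case False
      then have "g = {p, q}" using edge(2)[OF that(3)] that by (auto simp: card_2_iff)
      then show ?thesis using that by (auto simp: R_def)
    qed auto
    have "\<exists>w. w \<in> e \<and> w \<in> f"
    proof (cases "e = f")
      case True
      then show ?thesis using ef by auto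
    next
      case False
      then have "z \<in> position ` (e \<inter> f)" using dr ef unfolding planar_drawing_def by blast
      then show ?thesis by auto
    qed
    then obtain w where "(x, w) \<in> R\<^sup>*" "(w, y) \<in> R\<^sup>*" using near ef by blast
    then show ?thesis using ef sym by (meson rtrancl_trans symD)
  qed
  show ?thesis
    unfolding noncrossing_def
  proof (intro allI impI)
    fix a b c d
    assume ord: "boundary_pos a < boundary_pos b" "boundary_pos b < boundary_pos c" "boundary_pos c < boundary_pos d"
      and ac: "(a, c) \<in> conn \<alpha>" and bd: "(b, d) \<in> conn \<alpha>"
    have V: "a \<in> vertices m n" "b \<in> vertices m n" "c \<in> vertices m n" "d \<in> vertices m n"
      using conn_vertices[OF \<alpha>] ac bd by blast+
    obtain g h where g: "path g" "pathstart g = position a" "pathfinish g = position c" "path_image g \<subseteq> S a"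
      and h: "path h" "pathstart h = position b" "pathfinish h = position d" "path_image h \<subseteq> S b"
      using Spath[of a c] Spath[of b d] ac bd ord cn by fastforce
    have "path_image g \<inter> path_image h \<noteq> {}"
      by (rule interlaced_paths_meet[where h = 1 and M = "real (max m n)"])
         (use g h Sbox[of a] Sbox[of b] V position_snd ord in \<open>auto simp: rim_position[OF V(1)] rim_position[OF V(2)]
           rim_position[OF V(3)] rim_position[OF V(4)] simp del: of_nat_max\<close>)
    then have "(a, b) \<in> R\<^sup>*" using g h Sdisj by blast
    then show "(a, b) \<in> conn \<alpha>" using V cn by auto
  qed
qed

lemma noncrossing_chord_sides:
  assumes "noncrossing \<alpha>" "\<alpha> \<in> partitions m n" "(u, v) \<in> conn \<alpha>" "(p, q) \<in> conn \<alpha>" "(u, p) \<notin> conn \<alpha>"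
    and uv: "boundary_pos u < boundary_pos v"
  shows "not_interlaced u v p q"
proof -
  have *: False if "(x, y) \<in> conn \<alpha>" "(u, x) \<notin> conn \<alpha>" and in_: "boundary_pos u < boundary_pos x" "boundary_pos x < boundary_pos v"
    and out: "boundary_pos y < boundary_pos u \<or> boundary_pos v < boundary_pos y" for x y
    using out
  proof
    assume "boundary_pos v < boundary_pos y"
    then show False using noncrossingD[OF assms(1), of u x v y] that assms(3) by auto
  next
    assume "boundary_pos y < boundary_pos u"
    then have "(y, u) \<in> conn \<alpha>" using noncrossingD[OF assms(1), of y u x v] that assms(3) conn_sym by auto
    then show False using that conn_trans[OF assms(2)] conn_sym by metis
  qed
  have "(u, q) \<notin> conn \<alpha>" using assms conn_trans[OF assms(2)] conn_sym by metis
  then show ?thesis using *[of p q] *[of q p] assms conn_sym by (auto simp: not_le) (meson linorder_not_le)+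
qed

text \<open>Every block is drawn as a star: chords from one chosen vertex to all others. Chords of one star share
their centre, and chords of different stars are not interlaced.\<close>

lemma noncrossing_imp_planar:
  assumes \<alpha>: "\<alpha> \<in> partitions m n" and nc: "noncrossing \<alpha>"
  shows "\<alpha> \<in> planar_partitions m n"
proof -
  define M where "M = max m n"
  define c :: "vertex set \<Rightarrow> vertex" where "c A = (SOME v. v \<in> A)" for A
  define E where "E = {{c A, v} | A v. A \<in> \<alpha> \<and> v \<in> A \<and> v \<noteq> c A}"
  define ends where "ends e = (SOME w. e = {fst w, snd w} \<and> boundary_pos (fst w) < boundary_pos (snd w))" for e
  define \<gamma> where "\<gamma> e = chord M (fst (ends e)) (snd (ends e))" for e
  have P: "partition_on (vertices m n) \<alpha>" using \<alpha> by (simp add: partitions_def)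
  have cA: "c A \<in> A" if "A \<in> \<alpha>" for A
    using that P unfolding c_def partition_on_def by (metis all_not_in_conv someI_ex)
  have VM: "v \<in> vertices M M" if "v \<in> vertices m n" for v
    using that vertices_mono[of m M n M] by (auto simp: M_def)
  have edge: "\<exists>u v A. e = {u, v} \<and> boundary_pos u < boundary_pos v \<and> \<gamma> e = chord M u v \<and>
       u \<in> vertices m n \<and> v \<in> vertices m n \<and> A \<in> \<alpha> \<and> u \<in> A \<and> v \<in> A \<and> c A \<in> {u, v}" if eE: "e \<in> E" for e
  proof -
    obtain A x where A: "A \<in> \<alpha>" "x \<in> A" "x \<noteq> c A" "e = {c A, x}" using eE unfolding E_def by blast
    have "c A \<in> vertices m n" "x \<in> vertices m n" using A cA P by (auto simp: partition_on_def)
    then have "boundary_pos (c A) \<noteq> boundary_pos x" using boundary_pos_inj A(3) by blast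
    then have "\<exists>w. e = {fst w, snd w} \<and> boundary_pos (fst w) < boundary_pos (snd w)"
      using A(4) by (metis fst_conv insert_commute linorder_neqE_linordered_idom snd_conv)
    then have "e = {fst (ends e), snd (ends e)} \<and> boundary_pos (fst (ends e)) < boundary_pos (snd (ends e))"
      unfolding ends_def by (rule someI_ex)
    moreover then have "{fst (ends e), snd (ends e)} = {c A, x}" using A by simp
    ultimately show ?thesis
      using A cA[OF A(1)] \<open>c A \<in> vertices m n\<close> \<open>x \<in> vertices m n\<close>
      by (intro exI[of _ "fst (ends e)"] exI[of _ "snd (ends e)"] exI[of _ A])
         (auto simp: \<gamma>_def doubleton_eq_iff)
  qed
  have "components (vertices m n) E = vertices m n // conn \<alpha>"
  proof -
    have "same_component E \<inter> vertices m n \<times> vertices m n = conn \<alpha>"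
    proof (intro equalityI subsetI; clarify)
      fix u v assume "(u, v) \<in> same_component E" and uv: "u \<in> vertices m n" "v \<in> vertices m n"
      from this(1) show "(u, v) \<in> conn \<alpha>" unfolding same_component_def
      proof (induction rule: rtrancl_induct)
        case base
        then show ?case using uv conn_refl_iff[OF \<alpha>] by auto
      next
        case (step y z)
        then have "(y, z) \<in> conn \<alpha>" using cA by (force simp: E_def conn_def doubleton_eq_iff)
        with step show ?case using conn_trans[OF \<alpha>] by blast
      qed
    next
      fix u v assume uv: "(u, v) \<in> conn \<alpha>"
      then obtain A where A: "A \<in> \<alpha>" "u \<in> A" "v \<in> A" by (auto simp: conn_def)
      have "(x, c A) \<in> same_component E \<and> (c A, x) \<in> same_component E" if "x \<in> A" for x
      proof (cases "x = c A")
        case False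
        then have "{c A, x} \<in> E" using A(1) that by (auto simp: E_def)
        then show ?thesis unfolding same_component_def by (auto simp: insert_commute)
      qed (simp add: same_component_def)
      then have "(u, c A) \<in> same_component E" "(c A, v) \<in> same_component E" using A by auto
      then show "(u, v) \<in> same_component E \<inter> vertices m n \<times> vertices m n"
        using conn_vertices[OF \<alpha> uv] unfolding same_component_def by (auto intro: rtrancl_trans)
    qed
    then show ?thesis by (simp add: components_def)
  qed
  then have comp: "components (vertices m n) E = \<alpha>" using quotient_conn[OF \<alpha>] by simp
  have "planar_drawing m n E \<gamma>"
    unfolding planar_drawing_def
  proof (intro conjI ballI impI)
    fix e assume "e \<in> E"
    then obtain u v A where e: "e = {u, v}" "boundary_pos u < boundary_pos v" "\<gamma> e = chord M u v"
      "u \<in> vertices m n" "v \<in> vertices m n" "A \<in> \<alpha>" "u \<in> A" "v \<in> A" using edge by metis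
    then have ne: "u \<noteq> v" by auto
    note V = VM[OF e(4)] VM[OF e(5)]
    show "e \<subseteq> vertices m n" using e by auto
    show "card e = 2" using e ne by auto
    show "arc (\<gamma> e)" using arc_chord[OF V ne] e by simp
    show "{pathstart (\<gamma> e), pathfinish (\<gamma> e)} = position ` e" using chord_ends[OF V] e by auto
    show "path_image (\<gamma> e) \<subseteq> {1..real (max m n)} \<times> {0..1}"
      using chord_image_box[OF V ne] e by (simp add: M_def)
    have "position u \<in> path_image (\<gamma> e)" "position v \<in> path_image (\<gamma> e)"
      using chord_ends[OF V] e by (metis pathstart_in_path_image, metis pathfinish_in_path_image)
    moreover have "z \<in> {position u, position v}" if "z \<in> path_image (\<gamma> e)" "z \<in> position ` vertices m n" for z
      using chord_image_rim[OF V ne, of z] that e position_snd by auto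
    ultimately show "path_image (\<gamma> e) \<inter> position ` vertices m n = position ` e"
      using e by auto
  next
    fix e f assume "e \<in> E" "f \<in> E" and ne: "e \<noteq> f"
    then obtain u v A p q B where e: "e = {u, v}" "boundary_pos u < boundary_pos v" "\<gamma> e = chord M u v"
      "u \<in> vertices m n" "v \<in> vertices m n" "A \<in> \<alpha>" "u \<in> A" "v \<in> A" "c A \<in> {u, v}" 
      and f: "f = {p, q}" "boundary_pos p < boundary_pos q" "\<gamma> f = chord M p q"
      "p \<in> vertices m n" "q \<in> vertices m n" "B \<in> \<alpha>" "p \<in> B" "q \<in> B" "c B \<in> {p, q}" using edge by metis
    have "not_interlaced u v p q"
    proof (cases "A = B")
      case True
      then show ?thesis using e f by auto
    next
      case False
      have "C = A \<and> C = B" if "C \<in> \<alpha>" "u \<in> C" "p \<in> C" for C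
        using e f that P unfolding partition_on_def disjoint_def by blast
      then have "(u, p) \<notin> conn \<alpha>" using False by (auto simp: conn_def)
      moreover have "(u, v) \<in> conn \<alpha>" "(p, q) \<in> conn \<alpha>" using e f by (auto simp: conn_def)
      ultimately show ?thesis using noncrossing_chord_sides[OF nc \<alpha>] e by blast
    qed
    then show "path_image (\<gamma> e) \<inter> path_image (\<gamma> f) \<subseteq> position ` (e \<inter> f)"
      using chords_meet[of u M v p q] VM e f ne by auto
  qed
  with comp \<alpha> show ?thesis by (auto simp: planar_partitions_def)
qed

lemma planar_partitions_eq: "planar_partitions m n = {\<alpha> \<in> partitions m n. noncrossing \<alpha>}"
  using planar_imp_noncrossing noncrossing_imp_planar planar_partitions_def by blast

section \<open>The product of partitions\<close>

text \<open>The partition into the level sets of a labelling.\<close>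

definition kernel_partition :: "nat \<Rightarrow> nat \<Rightarrow> (vertex \<Rightarrow> 'l) \<Rightarrow> vertex set set" where
  "kernel_partition m n L = vertices m n // {(u, v) \<in> vertices m n \<times> vertices m n. L u = L v}"

lemma equiv_kernel: "equiv V {(u, v) \<in> V \<times> V. L u = L v}"
  by (auto simp: equiv_def refl_on_def sym_def trans_def)

lemma kernel_partition_in [simp]: "kernel_partition m n L \<in> partitions m n"
  unfolding kernel_partition_def partitions_def mem_Collect_eq
  by (rule partition_on_quotient[OF equiv_kernel])

lemma conn_kernel:
  "conn (kernel_partition m n L) = {(u, v) \<in> vertices m n \<times> vertices m n. L u = L v}"
  unfolding kernel_partition_def by (rule conn_quotient[OF equiv_kernel])

text \<open>Adjacency in the product graph.\<close>

definition product_step :: "vertex set set \<Rightarrow> vertex set set \<Rightarrow> (vertex \<times> vertex) set" where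
  "product_step \<alpha> \<beta> = {(u, v). {u, v} \<in> product_graph \<alpha> \<beta>}"

lemma product_step_iff:
  "(u, v) \<in> product_step \<alpha> \<beta> \<longleftrightarrow>
     (\<exists>a b. (a, b) \<in> conn \<alpha> \<and> a \<noteq> b \<and> u = lower_to_middle a \<and> v = lower_to_middle b) \<or>
     (\<exists>a b. (a, b) \<in> conn \<beta> \<and> a \<noteq> b \<and> u = upper_to_middle a \<and> v = upper_to_middle b)"
proof -
  have *: "{u, v} \<in> image f ` graph_of \<gamma> \<longleftrightarrow> (\<exists>a b. (a, b) \<in> conn \<gamma> \<and> a \<noteq> b \<and> u = f a \<and> v = f b)" for f \<gamma>
  proof
    assume "{u, v} \<in> image f ` graph_of \<gamma>"
    then obtain a b where "a \<noteq> b" "(a, b) \<in> conn \<gamma>" "{u, v} = {f a, f b}"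
      by (auto simp: graph_of_def conn_def)
    then show "\<exists>a b. (a, b) \<in> conn \<gamma> \<and> a \<noteq> b \<and> u = f a \<and> v = f b"
      using conn_sym[of a b \<gamma>] by (auto simp: doubleton_eq_iff)
  next
    assume "\<exists>a b. (a, b) \<in> conn \<gamma> \<and> a \<noteq> b \<and> u = f a \<and> v = f b"
    then obtain a b where "(a, b) \<in> conn \<gamma>" "a \<noteq> b" "u = f a" "v = f b" by blast
    then have "{a, b} \<in> graph_of \<gamma>" "{u, v} = f ` {a, b}" by (auto simp: graph_of_def conn_def)
    then show "{u, v} \<in> image f ` graph_of \<gamma>" by blast
  qed
  show ?thesis unfolding product_step_def product_graph_def using * by auto
qed

lemma sym_product_step: "sym (product_step \<alpha> \<beta>)"
  by (auto simp: sym_def product_step_def insert_commute)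

lemma product_walk_sym:
  "(u, v) \<in> (product_step \<alpha> \<beta>)\<^sup>* \<Longrightarrow> (v, u) \<in> (product_step \<alpha> \<beta>)\<^sup>*"
  by (meson sym_product_step sym_rtrancl symD)

lemma conn_imp_walk1: "(a, b) \<in> conn \<alpha> \<Longrightarrow> (lower_to_middle a, lower_to_middle b) \<in> (product_step \<alpha> \<beta>)\<^sup>*"
  by (cases "a = b") (simp, blast intro: product_step_iff[THEN iffD2])

lemma conn_imp_walk2: "(a, b) \<in> conn \<beta> \<Longrightarrow> (upper_to_middle a, upper_to_middle b) \<in> (product_step \<alpha> \<beta>)\<^sup>*"
  by (cases "a = b") (simp, blast intro: product_step_iff[THEN iffD2])

lemma outer_vertices_eq:
  "\<alpha> \<in> partitions m n \<Longrightarrow> \<beta> \<in> partitions n k \<Longrightarrow> outer_vertices \<alpha> \<beta> = vertices m k"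
  by (auto simp: outer_vertices_def partitions_def partition_on_def vertices_def)

lemma conn_prod:
  assumes "\<alpha> \<in> partitions m n" "\<beta> \<in> partitions n k"
  shows "conn (\<alpha> \<odot> \<beta>) = (product_step \<alpha> \<beta>)\<^sup>* \<inter> vertices m k \<times> vertices m k"
  unfolding part_prod_def conn_components outer_vertices_eq[OF assms]
  by (simp add: same_component_def product_step_def)

lemma prod_in_partitions:
  assumes "\<alpha> \<in> partitions m n" "\<beta> \<in> partitions n k"
  shows "\<alpha> \<odot> \<beta> \<in> partitions m k"
  unfolding part_prod_def partitions_def components_def outer_vertices_eq[OF assms] mem_Collect_eq
  by (rule partition_on_quotient[OF equiv_same_component])

text \<open>Places the rows of a product graph on numbered levels, so that several product graphs fit together
into one graph on more than three rows.\<close>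

fun level :: "nat \<Rightarrow> nat \<Rightarrow> nat \<Rightarrow> vertex \<Rightarrow> nat \<times> nat" where
  "level i j k (Upper x) = (i, x)"
| "level i j k (Middle x) = (j, x)"
| "level i j k (Lower x) = (k, x)"

text \<open>The relation \<open>conn\<close> of a partition placed between the levels \<open>i\<close> and \<open>k\<close>. Middle vertices do not
occur, so their level is immaterial.\<close>

definition row_rel :: "nat \<Rightarrow> nat \<Rightarrow> vertex set set \<Rightarrow> ((nat \<times> nat) \<times> (nat \<times> nat)) set" where
  "row_rel i k \<alpha> = {(level i 0 k u, level i 0 k v) | u v. (u, v) \<in> conn \<alpha>}"

lemma level_inj:
  assumes "i \<noteq> j" "j \<noteq> k" "i \<noteq> k" "level i j k u = level i j k v"
  shows "u = v"
  using assms by (cases u; cases v) auto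

lemma level_vertices:
  assumes "u \<in> vertices m n"
  shows "level i j k (lower_to_middle u) = level i l j u"
    and "level i j k (upper_to_middle u) = level j l k u"
    and "level i j k u = level i l k u"
  using assms by (auto elim!: vertices_cases)

lemma product_walk_levels:
  assumes \<alpha>: "\<alpha> \<in> partitions m n" and \<beta>: "\<beta> \<in> partitions n k"
    and d: "i \<noteq> j" "j \<noteq> l" "i \<noteq> l"
  shows "(u, v) \<in> (product_step \<alpha> \<beta>)\<^sup>* \<longleftrightarrow>
    (level i j l u, level i j l v) \<in> (row_rel i j \<alpha> \<union> row_rel j l \<beta>)\<^sup>*" (is "_ \<longleftrightarrow> _ \<in> ?T\<^sup>*")
proof
  assume "(u, v) \<in> (product_step \<alpha> \<beta>)\<^sup>*"
  then show "(level i j l u, level i j l v) \<in> ?T\<^sup>*"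
  proof (induction rule: rtrancl_induct)
    case (step y z)
    have "(level i j l y, level i j l z) \<in> ?T"
      using step(2) unfolding product_step_iff
    proof (elim disjE exE conjE)
      fix a b assume "(a, b) \<in> conn \<alpha>" "y = lower_to_middle a" "z = lower_to_middle b"
      then show ?thesis
        using conn_vertices[OF \<alpha>, of a b] level_vertices(1)[of _ m n i j l 0]
        by (auto simp: row_rel_def)
    next
      fix a b assume "(a, b) \<in> conn \<beta>" "y = upper_to_middle a" "z = upper_to_middle b"
      then show ?thesis
        using conn_vertices[OF \<beta>, of a b] level_vertices(2)[of _ n k i j l 0]
        by (auto simp: row_rel_def)
    qed
    with step show ?case by (meson rtrancl.rtrancl_into_rtrancl)
  qed simp
next
  have "\<exists>w. y = level i j l w \<and> (u, w) \<in> (product_step \<alpha> \<beta>)\<^sup>*" if "(level i j l u, y) \<in> ?T\<^sup>*" for y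
    using that
  proof (induction rule: rtrancl_induct)
    case (step y z)
    then obtain w where w: "y = level i j l w" "(u, w) \<in> (product_step \<alpha> \<beta>)\<^sup>*" by auto
    from step(2) consider (1) a b where "(a, b) \<in> conn \<alpha>" "y = level i 0 j a" "z = level i 0 j b"
      | (2) a b where "(a, b) \<in> conn \<beta>" "y = level j 0 l a" "z = level j 0 l b"
      by (auto simp: row_rel_def)
    then show ?case
    proof cases
      case 1
      then have "y = level i j l (lower_to_middle a)" "z = level i j l (lower_to_middle b)"
        using conn_vertices[OF \<alpha>, of a b] level_vertices(1)[of _ m n i j l 0] by auto
      then show ?thesis
        using w level_inj[OF d] conn_imp_walk1[OF 1(1)] rtrancl_trans by metis
    next
      case 2
      then have "y = level i j l (upper_to_middle a)" "z = level i j l (upper_to_middle b)"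
        using conn_vertices[OF \<beta>, of a b] level_vertices(2)[of _ n k i j l 0] by auto
      then show ?thesis
        using w level_inj[OF d] conn_imp_walk2[OF 2(1)] rtrancl_trans by metis
    qed
  qed auto
  moreover assume "(level i j l u, level i j l v) \<in> ?T\<^sup>*"
  ultimately show "(u, v) \<in> (product_step \<alpha> \<beta>)\<^sup>*" using level_inj[OF d] by metis
qed

lemma row_rel_prod:
  assumes \<alpha>: "\<alpha> \<in> partitions m n" and \<beta>: "\<beta> \<in> partitions n k"
    and d: "i \<noteq> j" "j \<noteq> l" "i \<noteq> l"
  defines "W \<equiv> level i 0 l ` vertices m k"
  shows "row_rel i l (\<alpha> \<odot> \<beta>) = (row_rel i j \<alpha> \<union> row_rel j l \<beta>)\<^sup>* \<inter> W \<times> W"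
proof -
  have e: "level i 0 l u = level i j l u" if "u \<in> vertices m k" for u
    using level_vertices(3)[OF that, of i j l 0] by simp
  let ?f = "\<lambda>(u, v). (level i j l u, level i j l v)"
  have W: "W = level i j l ` vertices m k" unfolding W_def using e by (rule image_cong[OF refl])
  have "row_rel i l (\<alpha> \<odot> \<beta>) = (\<lambda>(u, v). (level i 0 l u, level i 0 l v)) ` conn (\<alpha> \<odot> \<beta>)"
    unfolding row_rel_def by auto
  also have "\<dots> = ?f ` conn (\<alpha> \<odot> \<beta>)"
    by (rule image_cong[OF refl]) (use e conn_vertices[OF prod_in_partitions[OF \<alpha> \<beta>]] in \<open>clarsimp\<close>)
  also have "\<dots> = (row_rel i j \<alpha> \<union> row_rel j l \<beta>)\<^sup>* \<inter> W \<times> W"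
  proof -
    have "?f (u, v) \<in> (row_rel i j \<alpha> \<union> row_rel j l \<beta>)\<^sup>* \<longleftrightarrow> (u, v) \<in> (product_step \<alpha> \<beta>)\<^sup>*" for u v
      using product_walk_levels[OF \<alpha> \<beta> d] by simp
    then show ?thesis unfolding W conn_prod[OF \<alpha> \<beta>] by (auto simp del: Un_iff)
  qed
  finally show ?thesis .
qed

text \<open>If only \<open>E1\<close> touches the hidden points \<open>H\<close>, then \<open>E1\<close> may be replaced by the reachability that
it induces on the visible points \<open>W\<close>: this does not affect which points outside \<open>H\<close> are joined.\<close>

lemma rtrancl_hide:
  assumes E1: "Field E1 \<subseteq> W \<union> H" and E2: "Field E2 \<inter> H = {}" and u: "u \<notin> H" and v: "v \<notin> H"
  shows "(u, v) \<in> (E1\<^sup>* \<inter> W \<times> W \<union> E2)\<^sup>* \<longleftrightarrow> (u, v) \<in> (E1 \<union> E2)\<^sup>*"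
proof
  assume "(u, v) \<in> (E1\<^sup>* \<inter> W \<times> W \<union> E2)\<^sup>*"
  moreover have "E1\<^sup>* \<subseteq> (E1 \<union> E2)\<^sup>*" by (intro rtrancl_mono) auto
  then have "E1\<^sup>* \<inter> W \<times> W \<union> E2 \<subseteq> (E1 \<union> E2)\<^sup>*" by auto
  then have "(E1\<^sup>* \<inter> W \<times> W \<union> E2)\<^sup>* \<subseteq> (E1 \<union> E2)\<^sup>*" by (metis rtrancl_idemp rtrancl_mono)
  ultimately show "(u, v) \<in> (E1 \<union> E2)\<^sup>*" by blast
next
  have shortcut: "(x, y) \<in> (E1\<^sup>* \<inter> W \<times> W \<union> E2)\<^sup>*" if "(x, y) \<in> E1\<^sup>*" "x \<notin> H" "y \<notin> H" for x y
  proof (cases "x = y")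
    case False
    then have "x \<in> Field E1" "y \<in> Field E1"
      using that(1) by (metis converse_rtranclE FieldI1, metis rtranclE FieldI2)
    then have "(x, y) \<in> E1\<^sup>* \<inter> W \<times> W" using that E1 by blast
    then show ?thesis by blast
  qed simp
  assume "(u, v) \<in> (E1 \<union> E2)\<^sup>*"
  then have "\<exists>w. w \<notin> H \<and> (u, w) \<in> (E1\<^sup>* \<inter> W \<times> W \<union> E2)\<^sup>* \<and> (w, v) \<in> E1\<^sup>*"
  proof (induction rule: rtrancl_induct)
    case base
    then show ?case using u by auto
  next
    case (step y z)
    then obtain w where w: "w \<notin> H" "(u, w) \<in> (E1\<^sup>* \<inter> W \<times> W \<union> E2)\<^sup>*" "(w, y) \<in> E1\<^sup>*" by auto
    from step(2) show ?case
    proof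
      assume "(y, z) \<in> E1"
      then show ?thesis using w by (meson rtrancl.rtrancl_into_rtrancl)
    next
      assume yz: "(y, z) \<in> E2"
      then have "y \<notin> H" "z \<notin> H" using E2 by (auto simp: Field_def)
      moreover have "(u, y) \<in> (E1\<^sup>* \<inter> W \<times> W \<union> E2)\<^sup>*"
        using shortcut[OF w(3,1) \<open>y \<notin> H\<close>] w(2) by auto
      ultimately show ?thesis using yz by (meson UnI2 rtrancl.rtrancl_into_rtrancl rtrancl.rtrancl_refl)
    qed
  qed
  then show "(u, v) \<in> (E1\<^sup>* \<inter> W \<times> W \<union> E2)\<^sup>*" using shortcut v by (meson rtrancl_trans)
qed

lemma Field_row_rel:
  assumes "\<alpha> \<in> partitions m n"
  shows "Field (row_rel i k \<alpha>) \<subseteq> level i 0 k ` vertices m n"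
proof
  fix x assume "x \<in> Field (row_rel i k \<alpha>)"
  then obtain u v where "(u, v) \<in> conn \<alpha>" "x = level i 0 k u \<or> x = level i 0 k v"
    unfolding Field_def row_rel_def by blast
  then show "x \<in> level i 0 k ` vertices m n" using conn_vertices[OF assms] by blast
qed

text \<open>Both bracketings describe reachability in the graph on the four levels 0 to 3; one hides level 1
first, the other one level 2.\<close>

lemma prod_assoc:
  assumes \<alpha>: "\<alpha> \<in> partitions m n" and \<beta>: "\<beta> \<in> partitions n k" and \<gamma>: "\<gamma> \<in> partitions k l"
  shows "\<alpha> \<odot> \<beta> \<odot> \<gamma> = \<alpha> \<odot> (\<beta> \<odot> \<gamma>)"
proof -
  note \<alpha>\<beta> = prod_in_partitions[OF \<alpha> \<beta>] and \<beta>\<gamma> = prod_in_partitions[OF \<beta> \<gamma>]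
  define A B C where "A = row_rel 0 1 \<alpha>" and "B = row_rel 1 2 \<beta>" and "C = row_rel 2 3 \<gamma>"
  have F: "Field A \<subseteq> level 0 0 1 ` vertices m n" "Field B \<subseteq> level 1 0 2 ` vertices n k"
    "Field C \<subseteq> level 2 0 3 ` vertices k l"
    unfolding A_def B_def C_def by (intro Field_row_rel \<alpha> \<beta> \<gamma>)+
  have img: "level i 0 j ` vertices p q = {i} \<times> {1..p} \<union> {j} \<times> {1..q}" for i j p q
    unfolding vertices_def image_Un image_image by auto
  have F1: "Field (A \<union> B) \<subseteq> level 0 0 2 ` vertices m k \<union> {1} \<times> UNIV" "Field C \<inter> {1} \<times> UNIV = {}"
    "Field (B \<union> C) \<subseteq> level 1 0 3 ` vertices n l \<union> {2} \<times> UNIV" "Field A \<inter> {2} \<times> UNIV = {}"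
  proof -
    have disj: "X \<inter> Z = {}" if "X \<subseteq> Y" "Y \<inter> Z = {}" for X Y Z :: "(nat \<times> nat) set"
      using that by blast
    show "Field C \<inter> {1} \<times> UNIV = {}" by (rule disj[OF F(3)]) (auto simp: img)
    show "Field A \<inter> {2} \<times> UNIV = {}" by (rule disj[OF F(1)]) (auto simp: img)
    have "level 0 0 1 ` vertices m n \<union> level 1 0 2 ` vertices n k
        \<subseteq> level 0 0 2 ` vertices m k \<union> {1} \<times> UNIV" unfolding img by auto
    then show "Field (A \<union> B) \<subseteq> level 0 0 2 ` vertices m k \<union> {1} \<times> UNIV"
      unfolding Field_Un by (rule subset_trans[OF Un_mono[OF F(1,2)]])
    have "level 1 0 2 ` vertices n k \<union> level 2 0 3 ` vertices k l
        \<subseteq> level 1 0 3 ` vertices n l \<union> {2} \<times> UNIV" unfolding img by auto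
    then show "Field (B \<union> C) \<subseteq> level 1 0 3 ` vertices n l \<union> {2} \<times> UNIV"
      unfolding Field_Un by (rule subset_trans[OF Un_mono[OF F(2,3)]])
  qed
  have "(u, v) \<in> conn (\<alpha> \<odot> \<beta> \<odot> \<gamma>) \<longleftrightarrow> (u, v) \<in> conn (\<alpha> \<odot> (\<beta> \<odot> \<gamma>))"
    if uv: "u \<in> vertices m l" "v \<in> vertices m l" for u v
  proof -
    let ?W1 = "level 0 0 2 ` vertices m k" and ?W2 = "level 1 0 3 ` vertices n l"
    define x y where "x = level 0 0 3 u" and "y = level 0 0 3 v"
    have xy: "x \<in> {0, 3} \<times> UNIV" "y \<in> {0, 3} \<times> UNIV"
      using uv by (auto simp: x_def y_def elim!: vertices_cases)
    have lx: "level 0 j 3 u = x" "level 0 j 3 v = y" for j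
      using level_vertices(3)[OF uv(1), of 0 j 3 0] level_vertices(3)[OF uv(2), of 0 j 3 0]
      by (auto simp: x_def y_def)
    have AB: "row_rel 0 2 (\<alpha> \<odot> \<beta>) = (A \<union> B)\<^sup>* \<inter> ?W1 \<times> ?W1"
      unfolding A_def B_def by (rule row_rel_prod[OF \<alpha> \<beta>]) simp_all
    have BC: "row_rel 1 3 (\<beta> \<odot> \<gamma>) = (B \<union> C)\<^sup>* \<inter> ?W2 \<times> ?W2"
      unfolding B_def C_def by (rule row_rel_prod[OF \<beta> \<gamma>]) simp_all
    have U: "A \<union> B \<union> C = B \<union> C \<union> A" by blast
    have U': "row_rel 1 3 (\<beta> \<odot> \<gamma>) \<union> A = A \<union> row_rel 1 3 (\<beta> \<odot> \<gamma>)" by (rule Un_commute)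
    have right: "(u, v) \<in> conn (\<alpha> \<odot> (\<beta> \<odot> \<gamma>)) \<longleftrightarrow> (x, y) \<in> (row_rel 1 3 (\<beta> \<odot> \<gamma>) \<union> A)\<^sup>*"
      using product_walk_levels[OF \<alpha> \<beta>\<gamma>, of 0 1 3 u v] uv
      unfolding U' by (simp add: A_def conn_prod[OF \<alpha> \<beta>\<gamma>] lx)
    have left: "(u, v) \<in> conn (\<alpha> \<odot> \<beta> \<odot> \<gamma>) \<longleftrightarrow> (x, y) \<in> (row_rel 0 2 (\<alpha> \<odot> \<beta>) \<union> C)\<^sup>*"
      using product_walk_levels[OF \<alpha>\<beta> \<gamma>, of 0 2 3 u v] uv
      by (simp add: C_def conn_prod[OF \<alpha>\<beta> \<gamma>] lx)
    have "(x, y) \<in> (row_rel 0 2 (\<alpha> \<odot> \<beta>) \<union> C)\<^sup>* \<longleftrightarrow> (x, y) \<in> (A \<union> B \<union> C)\<^sup>*"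
      unfolding AB by (rule rtrancl_hide[OF F1(1,2)], use xy in auto)
    moreover have "(x, y) \<in> (row_rel 1 3 (\<beta> \<odot> \<gamma>) \<union> A)\<^sup>* \<longleftrightarrow> (x, y) \<in> (A \<union> B \<union> C)\<^sup>*"
      unfolding BC U by (rule rtrancl_hide[OF F1(3,4)], use xy in auto)
    ultimately show ?thesis using left right by argo
  qed
  moreover have "conn (\<alpha> \<odot> \<beta> \<odot> \<gamma>) \<subseteq> vertices m l \<times> vertices m l"
    "conn (\<alpha> \<odot> (\<beta> \<odot> \<gamma>)) \<subseteq> vertices m l \<times> vertices m l"
    unfolding conn_prod[OF \<alpha>\<beta> \<gamma>] conn_prod[OF \<alpha> \<beta>\<gamma>] by (rule Int_lower2)+
  ultimately have iff: "(u, v) \<in> conn (\<alpha> \<odot> \<beta> \<odot> \<gamma>) \<longleftrightarrow> (u, v) \<in> conn (\<alpha> \<odot> (\<beta> \<odot> \<gamma>))" for u v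
    by (cases "(u, v) \<in> vertices m l \<times> vertices m l") blast+
  have "conn (\<alpha> \<odot> \<beta> \<odot> \<gamma>) = conn (\<alpha> \<odot> (\<beta> \<odot> \<gamma>))"
    by (intro equalityI subrelI) (erule iff[THEN iffD1], erule iff[THEN iffD2])
  from partitions_eqI[OF prod_in_partitions[OF \<alpha>\<beta> \<gamma>] prod_in_partitions[OF \<alpha> \<beta>\<gamma>] this]
  show ?thesis .
qed

text \<open>To compute a product it suffices to label its three rows so that labels are constant on blocks of
both factors and outer vertices with equal labels are joined by a walk.\<close>

lemma prod_eq_kernel:
  assumes \<alpha>: "\<alpha> \<in> partitions m n" and \<beta>: "\<beta> \<in> partitions n k"
    and 1: "\<And>a b. (a, b) \<in> conn \<alpha> \<Longrightarrow> L (lower_to_middle a) = L (lower_to_middle b)"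
    and 2: "\<And>a b. (a, b) \<in> conn \<beta> \<Longrightarrow> L (upper_to_middle a) = L (upper_to_middle b)"
    and 3: "\<And>u v. u \<in> vertices m k \<Longrightarrow> v \<in> vertices m k \<Longrightarrow> L u = L v \<Longrightarrow> (u, v) \<in> (product_step \<alpha> \<beta>)\<^sup>*"
  shows "\<alpha> \<odot> \<beta> = kernel_partition m k L"
proof -
  have "L u = L v" if "(u, v) \<in> (product_step \<alpha> \<beta>)\<^sup>*" for u v
    using that by (induction rule: rtrancl_induct) (auto simp: product_step_iff dest: 1 2)
  then have "conn (\<alpha> \<odot> \<beta>) = conn (kernel_partition m k L)"
    using 3 unfolding conn_kernel conn_prod[OF \<alpha> \<beta>] by auto
  then show ?thesis by (intro partitions_eqI[OF prod_in_partitions[OF \<alpha> \<beta>]]) auto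
qed

text \<open>A labelling of the upper row by \<open>f\<close> and of the lower row by \<open>g\<close>. Middle vertices do not occur in
partitions.\<close>

fun label :: "(nat \<Rightarrow> 'l) \<Rightarrow> (nat \<Rightarrow> 'l) \<Rightarrow> vertex \<Rightarrow> 'l" where
  "label f g (Upper x) = f x"
| "label f g (Lower x) = g x"
| "label f g (Middle x) = undefined"

abbreviation kernel2 :: "nat \<Rightarrow> nat \<Rightarrow> (nat \<Rightarrow> 'l) \<Rightarrow> (nat \<Rightarrow> 'l) \<Rightarrow> vertex set set" where
  "kernel2 m n f g \<equiv> kernel_partition m n (label f g)"

text \<open>Partitions given by labels are multiplied by forgetting the labels of the middle row, provided a
label shared by the outer rows also occurs in the middle.\<close>

lemma kernel2_prod:
  assumes common: "\<And>x z. x \<in> {1..m} \<Longrightarrow> z \<in> {1..k} \<Longrightarrow> f x = h z \<Longrightarrow> \<exists>y\<in>{1..n}. g y = f x"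
  shows "kernel2 m n f g \<odot> kernel2 n k g h = kernel2 m k f h"
proof -
  let ?\<alpha> = "kernel2 m n f g" and ?\<beta> = "kernel2 n k g h"
  define L where "L u = (case u of Upper x \<Rightarrow> f x | Middle x \<Rightarrow> g x | Lower x \<Rightarrow> h x)" for u
  have across: "(Upper x, Lower z) \<in> (product_step ?\<alpha> ?\<beta>)\<^sup>*"
    if xz: "x \<in> {1..m}" "z \<in> {1..k}" "f x = h z" for x z
  proof -
    obtain y where y: "y \<in> {1..n}" "g y = f x" using common[OF xz] by blast
    have "(Upper x, Lower y) \<in> conn ?\<alpha>" "(Upper y, Lower z) \<in> conn ?\<beta>"
      using y xz by (auto simp: conn_kernel vertices_def)
    from conn_imp_walk1[OF this(1), of ?\<beta>] conn_imp_walk2[OF this(2), of ?\<alpha>]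
    show ?thesis by simp
  qed
  have "?\<alpha> \<odot> ?\<beta> = kernel_partition m k L"
  proof (rule prod_eq_kernel[of _ m n])
    fix u v assume uv: "u \<in> vertices m k" "v \<in> vertices m k" and eq: "L u = L v"
    have "(u, v) \<in> (product_step ?\<alpha> ?\<beta>)\<^sup>* " if "u = Upper x" "v = Upper y" for x y
      using conn_imp_walk1[of u v ?\<alpha> ?\<beta>] that uv eq by (auto simp: conn_kernel L_def vertices_def)
    moreover have "(u, v) \<in> (product_step ?\<alpha> ?\<beta>)\<^sup>* " if "u = Lower x" "v = Lower y" for x y
      using conn_imp_walk2[of u v ?\<beta> ?\<alpha>] that uv eq by (auto simp: conn_kernel L_def vertices_def)
    ultimately show "(u, v) \<in> (product_step ?\<alpha> ?\<beta>)\<^sup>*"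
      using uv eq across product_walk_sym by (elim vertices_cases) (auto simp: L_def)
  qed (auto simp: conn_kernel L_def elim!: vertices_cases)
  also have "\<dots> = kernel2 m k f h"
    by (rule partitions_eqI[of _ m k]) (auto simp: conn_kernel L_def vertices_def)
  finally show ?thesis .
qed

definition block :: "vertex set set \<Rightarrow> vertex \<Rightarrow> vertex set" where
  "block \<alpha> u = conn \<alpha> `` {u}"

lemma block_eq_iff:
  assumes "\<alpha> \<in> partitions m n" "u \<in> vertices m n" "v \<in> vertices m n"
  shows "block \<alpha> u = block \<alpha> v \<longleftrightarrow> (u, v) \<in> conn \<alpha>"
  unfolding block_def by (rule eq_equiv_class_iff[OF equiv_conn[OF assms(1)] assms(2,3)])

lemma partition_eq_kernel:
  assumes "\<alpha> \<in> partitions m n" "\<And>u. u \<in> vertices m n \<Longrightarrow> L u = block \<alpha> u"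
  shows "\<alpha> = kernel_partition m n L"
proof (rule partitions_eqI[OF assms(1) kernel_partition_in])
  have "(u, v) \<in> conn \<alpha> \<longleftrightarrow> u \<in> vertices m n \<and> v \<in> vertices m n \<and> L u = L v" for u v
    using assms(2) block_eq_iff[OF assms(1)] conn_vertices[OF assms(1)] by metis
  then show "conn \<alpha> = conn (kernel_partition m n L)" unfolding conn_kernel by auto
qed

definition identity_partition :: "nat \<Rightarrow> vertex set set" where
  "identity_partition n = kernel2 n n (\<lambda>x. x) (\<lambda>x. x)"

lemma prod_identity_right:
  assumes \<alpha>: "\<alpha> \<in> partitions m n"
  shows "\<alpha> \<odot> identity_partition n = \<alpha>"
proof -
  define f g where "f x = block \<alpha> (Upper x)" and "g x = block \<alpha> (Lower x)" for x
  define L where "L u = (case u of Upper x \<Rightarrow> f x | Middle x \<Rightarrow> g x | Lower x \<Rightarrow> g x)" for u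
  have Lb: "L (lower_to_middle u) = block \<alpha> u" "L u = block \<alpha> u" if "u \<in> vertices m n" for u
    using that by (auto simp: L_def f_def g_def elim!: vertices_cases)
  have id: "identity_partition n \<in> partitions n n" by (simp add: identity_partition_def)
  have down: "(lower_to_middle u, u) \<in> (product_step \<alpha> (identity_partition n))\<^sup>*" if "u \<in> vertices m n" for u
    using that
  proof (elim vertices_cases)
    fix x assume "u = Lower x" "1 \<le> x" "x \<le> n"
    then have "(Upper x, Lower x) \<in> conn (identity_partition n)"
      by (auto simp: identity_partition_def conn_kernel vertices_def)
    from conn_imp_walk2[OF this] show ?thesis using \<open>u = Lower x\<close> by simp
  qed simp
  have "\<alpha> \<odot> identity_partition n = kernel_partition m n L"
  proof (rule prod_eq_kernel[OF \<alpha> id])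
    fix a b assume "(a, b) \<in> conn \<alpha>"
    then show "L (lower_to_middle a) = L (lower_to_middle b)"
      using Lb conn_vertices[OF \<alpha>, of a b] block_eq_iff[OF \<alpha>] by auto
  next
    fix u v assume uv: "u \<in> vertices m n" "v \<in> vertices m n" "L u = L v"
    then have "(u, v) \<in> conn \<alpha>" using Lb block_eq_iff[OF \<alpha>] by auto
    from conn_imp_walk1[OF this] show "(u, v) \<in> (product_step \<alpha> (identity_partition n))\<^sup>*"
      using down uv product_walk_sym by (meson rtrancl_trans)
  qed (auto simp: identity_partition_def conn_kernel L_def elim!: vertices_cases)
  also have "\<dots> = \<alpha>"
    using partition_eq_kernel[OF \<alpha>] Lb by metis
  finally show ?thesis .
qed

lemma path_image_chord_commute: "path_image (chord M u v) = path_image (chord M v u)"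
  by (simp add: chord_def path_image_compose closed_segment_commute)

section \<open>Products of noncrossing partitions\<close>

lemma chords_meet_imp_conn:
  assumes nc: "noncrossing \<alpha>" and \<alpha>: "\<alpha> \<in> partitions m n" and M: "m \<le> M" "n \<le> M"
    and ab: "(a, b) \<in> conn \<alpha>" "a \<noteq> b" and pq: "(p, q) \<in> conn \<alpha>" "p \<noteq> q"
    and z: "z \<in> path_image (chord M a b)" "z \<in> path_image (chord M p q)"
  shows "(a, p) \<in> conn \<alpha>"
proof -
  have V: "u \<in> vertices M M \<and> v \<in> vertices M M" if "(u, v) \<in> conn \<alpha>" for u v
    using conn_vertices[OF \<alpha> that] vertices_mono[OF M] by auto
  have *: "(x, p) \<in> conn \<alpha>" if xy: "(x, y) \<in> conn \<alpha>" "boundary_pos x < boundary_pos y"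
      "z \<in> path_image (chord M x y)" for x y
  proof (rule ccontr)
    assume n: "(x, p) \<notin> conn \<alpha>"
    have shared: "{x, y} \<inter> {p, q} = {}"
    proof (rule ccontr)
      assume "\<not> ?thesis"
      then consider "x = p" | "x = q" | "y = p" | "y = q" by blast
      then show False
        using n conn_refl_iff[OF \<alpha>, of p] conn_vertices[OF \<alpha> pq(1)] xy(1) conn_sym[OF pq(1)]
          conn_trans[OF \<alpha> xy(1), of p]
        by cases auto
    qed
    have "path_image (chord M x y) \<inter> path_image (chord M p q) \<subseteq> position ` ({x, y} \<inter> {p, q})"
    proof (rule chords_meet)
      show "not_interlaced x y p q"
        using noncrossing_chord_sides[OF nc \<alpha> xy(1) pq(1) n xy(2)] .
      show "{x, y} \<noteq> {p, q}" using shared by blast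
    qed (use V xy pq in blast)+
    then show False using shared z(2) xy(3) by auto
  qed
  have "boundary_pos a \<noteq> boundary_pos b"
    using boundary_pos_inj V[OF ab(1)] ab(2) by blast
  then consider "boundary_pos a < boundary_pos b" | "boundary_pos b < boundary_pos a" by linarith
  then show ?thesis
  proof cases
    case 1
    then show ?thesis using * ab z by blast
  next
    case 2
    then have "(b, p) \<in> conn \<alpha>" using *[of b a] ab conn_sym z path_image_chord_commute by blast
    then show ?thesis using ab conn_trans[OF \<alpha>] by blast
  qed
qed

text \<open>Positions of the three rows of a product graph in a rectangle of height 2.\<close>

fun stacked_position :: "vertex \<Rightarrow> real \<times> real" where
  "stacked_position (Upper x) = (real x, 2)"
| "stacked_position (Middle x) = (real x, 1)"
| "stacked_position (Lower x) = (real x, 0)"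

text \<open>The upper factor is drawn in the upper and the lower factor in the lower half of a rectangle of
height 2. Each component of the product graph becomes a set that joins its outer vertices by paths,
and sets of different components are disjoint, because the two halves share only the middle
vertices. Interlaced components would contradict \<open>interlaced_paths_meet\<close>.\<close>

lemma noncrossing_prod:
  assumes \<alpha>: "\<alpha> \<in> partitions m n" "noncrossing \<alpha>" and \<beta>: "\<beta> \<in> partitions n k" "noncrossing \<beta>"
  shows "noncrossing (\<alpha> \<odot> \<beta>)"
proof -
  define M where "M = max m (max n k)"
  have M3: "m \<le> M" "n \<le> M" "k \<le> M" by (auto simp: M_def)
  define W where "W = (product_step \<alpha> \<beta>)\<^sup>*"
  define lift :: "real \<times> real \<Rightarrow> real \<times> real" where "lift z = (fst z, snd z + 1)" for z
  have Wsym: "(v, u) \<in> W" if "(u, v) \<in> W" for u v using that product_walk_sym unfolding W_def by blast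
  have Wtrans: "(u, w) \<in> W" if "(u, v) \<in> W" "(v, w) \<in> W" for u v w
    using that unfolding W_def by (rule rtrancl_trans)
  have W\<alpha>: "(lower_to_middle a, lower_to_middle b) \<in> W" if "(a, b) \<in> conn \<alpha>" for a b
    using conn_imp_walk1[OF that] by (simp add: W_def)
  have W\<beta>: "(upper_to_middle a, upper_to_middle b) \<in> W" if "(a, b) \<in> conn \<beta>" for a b
    using conn_imp_walk2[OF that] by (simp add: W_def)
  have V\<alpha>: "a \<in> vertices m n" "b \<in> vertices m n" "a \<in> vertices M M" "b \<in> vertices M M"
    if "(a, b) \<in> conn \<alpha>" for a b
    using conn_vertices[OF \<alpha>(1) that] vertices_mono[of m M n M] M3 by auto
  have V\<beta>: "a \<in> vertices n k" "b \<in> vertices n k" "a \<in> vertices M M" "b \<in> vertices M M"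
    if "(a, b) \<in> conn \<beta>" for a b
    using conn_vertices[OF \<beta>(1) that] vertices_mono[of n M k M] M3 by auto
  have pos\<alpha>: "stacked_position (lower_to_middle a) = lift (position a)" if "a \<in> vertices m n" for a
    using that by (auto simp: lift_def elim!: vertices_cases)
  have pos\<beta>: "stacked_position (upper_to_middle a) = position a" if "a \<in> vertices n k" for a
    using that by (auto elim!: vertices_cases)
  (* The chords of the component of u in the upper and in the lower half. *)
  define S\<alpha> where "S\<alpha> u = {lift z | z a b. (a, b) \<in> conn \<alpha> \<and> a \<noteq> b \<and> (u, lower_to_middle a) \<in> W \<and>
    z \<in> path_image (chord M a b)}" for u
  define S\<beta> where "S\<beta> u = {z | z a b. (a, b) \<in> conn \<beta> \<and> a \<noteq> b \<and> (u, upper_to_middle a) \<in> W \<and>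
    z \<in> path_image (chord M a b)}" for u
  have step: "\<exists>g. path g \<and> pathstart g = stacked_position x \<and> pathfinish g = stacked_position y \<and>
      path_image g \<subseteq> S\<alpha> u \<union> S\<beta> u"
    if ux: "(u, x) \<in> W" and xy: "(x, y) \<in> product_step \<alpha> \<beta>" for u x y
    using xy unfolding product_step_iff
  proof (elim disjE exE conjE)
    fix a b assume ab: "(a, b) \<in> conn \<alpha>" "a \<noteq> b" "x = lower_to_middle a" "y = lower_to_middle b"
    note V = V\<alpha>[OF ab(1)]
    have "path (lift \<circ> chord M a b)"
      unfolding lift_def[abs_def]
      by (intro path_continuous_image path_chord V continuous_intros)
    moreover have "path_image (lift \<circ> chord M a b) \<subseteq> S\<alpha> u"
      unfolding path_image_compose S\<alpha>_def using ab ux by blast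
    ultimately show ?thesis
      using ab pos\<alpha> V chord_ends[OF V(3,4)]
      by (intro exI[of _ "lift \<circ> chord M a b"]) (auto simp: pathstart_compose pathfinish_compose)
  next
    fix a b assume ab: "(a, b) \<in> conn \<beta>" "a \<noteq> b" "x = upper_to_middle a" "y = upper_to_middle b"
    note V = V\<beta>[OF ab(1)]
    have "path_image (chord M a b) \<subseteq> S\<beta> u"
      unfolding S\<beta>_def using ab ux by blast
    then show ?thesis
      using ab pos\<beta> V chord_ends[OF V(3,4)] path_chord[OF V(3,4)]
      by (intro exI[of _ "chord M a b"]) auto
  qed
  have Spath: "\<exists>g. path g \<and> pathstart g = stacked_position u \<and> pathfinish g = stacked_position v \<and>
      path_image g \<subseteq> S\<alpha> u \<union> S\<beta> u" if uv: "(u, v) \<in> W" "u \<noteq> v" for u v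
  proof (rule walk_path[OF uv(1)[unfolded W_def]])
    obtain w where "(u, w) \<in> product_step \<alpha> \<beta>" using uv unfolding W_def by (metis converse_rtranclE)
    from step[OF _ this, of u] show "stacked_position u \<in> S\<alpha> u \<union> S\<beta> u"
      unfolding W_def using pathstart_in_path_image by (metis rtrancl.rtrancl_refl subsetD)
  qed (use step in \<open>simp add: W_def\<close>)
  have upper_box: "z \<in> {1..real M} \<times> {1..2}" if "z \<in> S\<alpha> u" for z u
    using that chord_image_box[OF V\<alpha>(3,4)] unfolding S\<alpha>_def lift_def by fastforce
  have lower_box: "z \<in> {1..real M} \<times> {0..1}" if "z \<in> S\<beta> u" for z u
    using that chord_image_box[OF V\<beta>(3,4)] unfolding S\<beta>_def by blast
  (* The two halves meet on the line of height 1, which chords touch only in middle vertices. *)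
  have mixed: "(u, v) \<in> W" if zu: "z \<in> S\<alpha> u" and zv: "z \<in> S\<beta> v" for z u v
  proof -
    obtain w a b where w: "z = lift w" "w \<in> path_image (chord M a b)" and ab: "(a, b) \<in> conn \<alpha>" "a \<noteq> b"
      "(u, lower_to_middle a) \<in> W" using zu unfolding S\<alpha>_def by blast
    obtain p q where pq: "(p, q) \<in> conn \<beta>" "p \<noteq> q" "(v, upper_to_middle p) \<in> W"
      and z: "z \<in> path_image (chord M p q)" using zv unfolding S\<beta>_def by blast
    have sz: "snd z = 1" using upper_box[OF zu] lower_box[OF zv] by (auto simp: mem_Times_iff)
    then have "snd w = 0" using w by (simp add: lift_def)
    then obtain c where c: "c \<in> {a, b}" "w = position c"
      using chord_image_rim[OF V\<alpha>(3,4)[OF ab(1)] ab(2) w(2)] by blast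
    obtain d where d: "d \<in> {p, q}" "z = position d"
      using chord_image_rim[OF V\<beta>(3,4)[OF pq(1)] pq(2) z] sz by blast
    have "c \<in> vertices m n" "d \<in> vertices n k" using c d V\<alpha>[OF ab(1)] V\<beta>[OF pq(1)] by auto
    then have "lower_to_middle c = upper_to_middle d"
      using \<open>snd w = 0\<close> sz w(1) c(2) d(2) by (auto simp: lift_def elim!: vertices_cases)
    moreover have "(lower_to_middle a, lower_to_middle c) \<in> W" "(upper_to_middle p, upper_to_middle d) \<in> W"
      using c d ab pq W\<alpha> W\<beta> unfolding W_def by blast+
    ultimately show ?thesis using ab(3) pq(3) Wsym Wtrans by metis
  qed
  have Sdisj: "(u, v) \<in> W" if zu: "z \<in> S\<alpha> u \<union> S\<beta> u" and zv: "z \<in> S\<alpha> v \<union> S\<beta> v" for z u v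
  proof -
    have "(u, v) \<in> W" if z: "z \<in> S\<alpha> u" "z \<in> S\<alpha> v"
    proof -
      obtain w a b where w: "z = lift w" "w \<in> path_image (chord M a b)" and ab: "(a, b) \<in> conn \<alpha>" "a \<noteq> b"
        "(u, lower_to_middle a) \<in> W" using z(1) unfolding S\<alpha>_def by blast
      obtain w' p q where w': "z = lift w'" "w' \<in> path_image (chord M p q)" and pq: "(p, q) \<in> conn \<alpha>" "p \<noteq> q"
        "(v, lower_to_middle p) \<in> W" using z(2) unfolding S\<alpha>_def by blast
      have "w' = w" using w w' by (auto simp: lift_def prod_eq_iff)
      then have "(a, p) \<in> conn \<alpha>"
        using chords_meet_imp_conn[OF \<alpha>(2,1) _ _ ab(1,2) pq(1,2) w(2)] w'(2) by (simp add: M_def)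
      then show ?thesis using W\<alpha> ab pq Wsym Wtrans by metis
    qed
    moreover have "(u, v) \<in> W" if z: "z \<in> S\<beta> u" "z \<in> S\<beta> v"
    proof -
      obtain a b where ab: "(a, b) \<in> conn \<beta>" "a \<noteq> b" "(u, upper_to_middle a) \<in> W" "z \<in> path_image (chord M a b)"
        using z(1) unfolding S\<beta>_def by blast
      obtain p q where pq: "(p, q) \<in> conn \<beta>" "p \<noteq> q" "(v, upper_to_middle p) \<in> W" "z \<in> path_image (chord M p q)"
        using z(2) unfolding S\<beta>_def by blast
      have "(a, p) \<in> conn \<beta>"
        using chords_meet_imp_conn[OF \<beta>(2,1) _ _ ab(1,2) pq(1,2) ab(4) pq(4)] by (simp add: M_def)
      then show ?thesis using W\<beta> ab pq Wsym Wtrans by metis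
    qed
    ultimately show ?thesis using zu zv mixed[of z u v] mixed[of z v u] Wsym by blast
  qed
  show ?thesis
    unfolding noncrossing_def
  proof (intro allI impI)
    fix a b c d
    assume ord: "boundary_pos a < boundary_pos b" "boundary_pos b < boundary_pos c" "boundary_pos c < boundary_pos d"
      and ac: "(a, c) \<in> conn (\<alpha> \<odot> \<beta>)" and bd: "(b, d) \<in> conn (\<alpha> \<odot> \<beta>)"
    have V: "a \<in> vertices m k" "b \<in> vertices m k" "c \<in> vertices m k" "d \<in> vertices m k"
      and Wab: "(a, c) \<in> W" "(b, d) \<in> W"
      using ac bd unfolding conn_prod[OF \<alpha>(1) \<beta>(1)] W_def by auto
    have rim: "rim (stacked_position u) = boundary_pos u"
      "snd (stacked_position u) = 0 \<or> snd (stacked_position u) = 2" if "u \<in> vertices m k" for u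
      using that by (auto simp: rim_def elim!: vertices_cases)
    have "a \<noteq> c" "b \<noteq> d" using ord by auto
    then obtain g h where
      g: "path g" "pathstart g = stacked_position a" "pathfinish g = stacked_position c" "path_image g \<subseteq> S\<alpha> a \<union> S\<beta> a"
      and h: "path h" "pathstart h = stacked_position b" "pathfinish h = stacked_position d" "path_image h \<subseteq> S\<alpha> b \<union> S\<beta> b"
      using Spath[OF Wab(1)] Spath[OF Wab(2)] by blast
    have box: "S\<alpha> u \<union> S\<beta> u \<subseteq> {1..real M} \<times> {0..2}" for u
    proof
      fix z assume "z \<in> S\<alpha> u \<union> S\<beta> u"
      then show "z \<in> {1..real M} \<times> {0..2}"
        using upper_box[of z u] lower_box[of z u] by (cases z) auto
    qed
    have "path_image g \<inter> path_image h \<noteq> {}"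
    proof (rule interlaced_paths_meet[where h = 2 and M = "real M"])
      show "path_image g \<subseteq> {1..real M} \<times> {0..2}" "path_image h \<subseteq> {1..real M} \<times> {0..2}"
        using g(4) h(4) box by blast+
    qed (use g h ord rim[OF V(1)] rim[OF V(2)] rim[OF V(3)] rim[OF V(4)] in \<open>auto simp del: stacked_position.simps\<close>)
    then have "(a, b) \<in> W" using g(4) h(4) Sdisj by blast
    then show "(a, b) \<in> conn (\<alpha> \<odot> \<beta>)" using V unfolding conn_prod[OF \<alpha>(1) \<beta>(1)] W_def by simp
  qed
qed

section \<open>Products of partitions with blocks of size at most two\<close>

text \<open>No vertex has two distinct partners, that is, all blocks have at most two elements.\<close>

definition small_blocks :: "vertex set set \<Rightarrow> bool" where
  "small_blocks \<alpha> \<longleftrightarrow> (\<forall>u v w. (u, v) \<in> conn \<alpha> \<longrightarrow> (u, w) \<in> conn \<alpha> \<longrightarrow> u \<noteq> v \<longrightarrow> u \<noteq> w \<longrightarrow> v = w)"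

lemma small_blocksD:
  "small_blocks \<alpha> \<Longrightarrow> (u, v) \<in> conn \<alpha> \<Longrightarrow> (u, w) \<in> conn \<alpha> \<Longrightarrow> u \<noteq> v \<Longrightarrow> u \<noteq> w \<Longrightarrow> v = w"
  unfolding small_blocks_def by blast

text \<open>A walk in the product graph that alternates between the factors is determined by its start. With
the factor to be used next recorded in a flag, the steps form a single-valued relation \<open>T\<close>. Its
orbit from an outer vertex \<open>u\<close> covers the component of \<open>u\<close>, and every other outer vertex of this
component is a dead end of the orbit; a single-valued relation leads to at most one dead end.\<close>

lemma small_blocks_prod:
  assumes \<alpha>: "\<alpha> \<in> partitions m n" "small_blocks \<alpha>" and \<beta>: "\<beta> \<in> partitions n k" "small_blocks \<beta>"
  shows "small_blocks (\<alpha> \<odot> \<beta>)"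
proof -
  define T where "T = {((lower_to_middle a, True), (lower_to_middle b, False)) | a b. (a, b) \<in> conn \<alpha> \<and> a \<noteq> b} \<union>
    {((upper_to_middle a, False), (upper_to_middle b, True)) | a b. (a, b) \<in> conn \<beta> \<and> a \<noteq> b}"
  have inj1: "a = b" if "lower_to_middle a = lower_to_middle b" "a \<in> vertices m n" "b \<in> vertices m n" for a b
    using that by (auto elim!: vertices_cases)
  have inj2: "a = b" if "upper_to_middle a = upper_to_middle b" "a \<in> vertices n k" "b \<in> vertices n k" for a b
    using that by (auto elim!: vertices_cases)
  have T1: "((x, True), (y, s)) \<in> T \<longleftrightarrow> \<not> s \<and> (\<exists>a b. (a, b) \<in> conn \<alpha> \<and> a \<noteq> b \<and> x = lower_to_middle a \<and> y = lower_to_middle b)"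
    and T2: "((x, False), (y, s)) \<in> T \<longleftrightarrow> s \<and> (\<exists>a b. (a, b) \<in> conn \<beta> \<and> a \<noteq> b \<and> x = upper_to_middle a \<and> y = upper_to_middle b)"
    for x y s by (auto simp: T_def)
  have det1: "y = y'" if "((x, True), (y, s)) \<in> T" "((x, True), (y', s')) \<in> T" for x y y' s s'
    using that small_blocksD[OF \<alpha>(2)] inj1 conn_vertices[OF \<alpha>(1)] unfolding T1 by metis
  have det2: "y = y'" if "((x, False), (y, s)) \<in> T" "((x, False), (y', s')) \<in> T" for x y y' s s'
    using that small_blocksD[OF \<beta>(2)] inj2 conn_vertices[OF \<beta>(1)] unfolding T2 by metis
  have sv: "single_valued T"
    unfolding single_valued_def
  proof (intro allI impI)
    fix p q r assume pq: "(p, q) \<in> T" "(p, r) \<in> T"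
    obtain x s y t y' t' where e: "p = (x, s)" "q = (y, t)" "r = (y', t')" by (cases p, cases q, cases r) auto
    show "q = r"
    proof (cases s)
      case True
      then show ?thesis using pq e det1[of x y t y' t'] T1 by auto
    next
      case False
      then show ?thesis using pq e det2[of x y t y' t'] T2 by auto
    qed
  qed
  have turn: "((y, s), (x, \<not> s)) \<in> T" if "((x, s), (y, \<not> s)) \<in> T" for x y s
    using that by (cases s) (simp_all add: T1 T2, (metis conn_sym)+)
  have flip: "t = (\<not> s)" if "((x, s), (y, t)) \<in> T" for x y s t
    using that T1 T2 by (cases s) auto
  have notU: "((Upper x, False), q) \<notin> T" for x q
    using T2 conn_vertices[OF \<beta>(1)] by (cases q) (auto elim!: vertices_cases dest!: conn_vertices[OF \<beta>(1)])
  have notL: "((Lower x, True), q) \<notin> T" for x q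
    using T1 by (cases q) (auto elim!: vertices_cases dest!: conn_vertices[OF \<alpha>(1)])
  have stepT: "((x, True), (y, False)) \<in> T \<or> ((x, False), (y, True)) \<in> T" if "(x, y) \<in> product_step \<alpha> \<beta>" for x y
    using that unfolding product_step_iff T1 T2 by blast
  have main: "v = w"
    if u: "u \<in> vertices m k" and v: "v \<in> vertices m k" "(u, v) \<in> (product_step \<alpha> \<beta>)\<^sup>*" "u \<noteq> v"
      and w: "w \<in> vertices m k" "(u, w) \<in> (product_step \<alpha> \<beta>)\<^sup>*" "u \<noteq> w" for u v w
  proof -
    (* The factor containing u is used first; the other flag admits no step from u. *)
    define s0 where "s0 = (case u of Upper x \<Rightarrow> True | _ \<Rightarrow> False)"
    have start: "\<not> ((u, \<not> s0), q) \<in> T" for q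
      using u notU notL by (elim vertices_cases) (auto simp: s0_def)
    have reach: "\<exists>s. ((u, s0), (y, s)) \<in> T\<^sup>*" if "(u, y) \<in> (product_step \<alpha> \<beta>)\<^sup>*" for y
      using that
    proof (induction rule: rtrancl_induct)
      case (step y z)
      then obtain s where s: "((u, s0), (y, s)) \<in> T\<^sup>*" by blast
      from stepT[OF step(2)] obtain t where t: "((y, t), (z, \<not> t)) \<in> T" by (metis (full_types))
      show ?case
      proof (cases "s = t")
        case True
        then show ?thesis using s t by (meson rtrancl.rtrancl_into_rtrancl)
      next
        case False
        then have st: "t = (\<not> s)" by blast
        show ?thesis
        proof (cases "(u, s0) = (y, s)")
          case True
          then show ?thesis using t start st by auto
        next
          case False
          with s obtain q where q: "((u, s0), q) \<in> T\<^sup>*" "(q, (y, s)) \<in> T" by (metis rtranclE)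
          obtain x r where xr: "q = (x, r)" by (cases q)
          then have "r = (\<not> s)" using flip[of x r y s] q(2) by simp
          then have q': "q = (x, \<not> s)" "((x, \<not> s), (y, s)) \<in> T" using q xr by simp_all
          then have "((y, \<not> s), (x, s)) \<in> T" using turn[of x "\<not> s" y] by simp
          then have "x = z" using t det1 det2 unfolding st by (cases s) auto
          then show ?thesis using q(1) q'(1) by auto
        qed
      qed
    qed auto
    have final: "\<exists>s. ((u, s0), (y, s)) \<in> T\<^sup>* \<and> (\<forall>q. ((y, s), q) \<notin> T)"
      if y: "y \<in> vertices m k" "(u, y) \<in> (product_step \<alpha> \<beta>)\<^sup>*" "u \<noteq> y" for y
    proof -
      obtain s where s: "((u, s0), (y, s)) \<in> T\<^sup>*" using reach[OF y(2)] by blast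
      then obtain q where q: "(q, (y, s)) \<in> T" using y(3) by (metis Pair_inject rtranclE)
      obtain x r where xr: "q = (x, r)" by (cases q)
      then have "r = (\<not> s)" using flip[of x r y s] q by simp
      then have "((x, \<not> s), (y, s)) \<in> T" using q xr by simp
      then have "((y, \<not> s), (x, s)) \<in> T" using turn[of x "\<not> s" y] by simp
      then have "\<forall>q. ((y, s), q) \<notin> T"
        using y(1) notU notL by (elim vertices_cases; cases s) auto
      with s show ?thesis by blast
    qed
    obtain s t where s: "((u, s0), (v, s)) \<in> T\<^sup>*" "\<forall>q. ((v, s), q) \<notin> T"
      and t: "((u, s0), (w, t)) \<in> T\<^sup>*" "\<forall>q. ((w, t), q) \<notin> T"
      using final[OF v] final[OF w] by blast
    from single_valued_confluent[OF sv s(1) t(1)] show "v = w"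
      using s(2) t(2) by (metis Pair_inject converse_rtranclE)
  qed
  show ?thesis
    unfolding small_blocks_def conn_prod[OF \<alpha>(1) \<beta>(1)] using main by blast
qed

text \<open>Every vertex has a partner in its block.\<close>

definition no_singletons :: "nat \<Rightarrow> nat \<Rightarrow> vertex set set \<Rightarrow> bool" where
  "no_singletons m n \<alpha> \<longleftrightarrow> (\<forall>u\<in>vertices m n. \<exists>v. v \<noteq> u \<and> (u, v) \<in> conn \<alpha>)"

lemma small_blocks_iff:
  assumes \<alpha>: "\<alpha> \<in> partitions m n"
  shows "(\<forall>A\<in>\<alpha>. card A = 1 \<or> card A = 2) \<longleftrightarrow> small_blocks \<alpha>"
    and "(\<forall>A\<in>\<alpha>. card A = 2) \<longleftrightarrow> small_blocks \<alpha> \<and> no_singletons m n \<alpha>"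
proof -
  have P: "partition_on (vertices m n) \<alpha>" using \<alpha> by (simp add: partitions_def)
  have blocks: "A \<noteq> {}" "finite A" "A \<subseteq> vertices m n" if "A \<in> \<alpha>" for A
    using P that finite_subset[OF _ finite_vertices[of m n]] unfolding partition_on_def by blast+
  have mem: "(u, v) \<in> conn \<alpha> \<longleftrightarrow> v \<in> A" if "A \<in> \<alpha>" "u \<in> A" for A u v
    using that P unfolding conn_def partition_on_def disjoint_def by blast
  have cases: "(card A = 1 \<or> card A = 2) \<longleftrightarrow> (\<forall>u\<in>A. \<forall>v\<in>A. \<forall>w\<in>A. u \<noteq> v \<longrightarrow> u \<noteq> w \<longrightarrow> v = w)"
    if A: "A \<in> \<alpha>" for A
  proof
    assume "card A = 1 \<or> card A = 2"
    then show "\<forall>u\<in>A. \<forall>v\<in>A. \<forall>w\<in>A. u \<noteq> v \<longrightarrow> u \<noteq> w \<longrightarrow> v = w"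
      by (auto simp: card_1_singleton_iff card_2_iff)
  next
    assume *: "\<forall>u\<in>A. \<forall>v\<in>A. \<forall>w\<in>A. u \<noteq> v \<longrightarrow> u \<noteq> w \<longrightarrow> v = w"
    obtain u where u: "u \<in> A" using blocks[OF A] by blast
    show "card A = 1 \<or> card A = 2"
    proof (cases "A = {u}")
      case False
      then obtain v where v: "v \<in> A" "v \<noteq> u" using u by blast
      have "A = {u, v}" using * u v by blast
      then show ?thesis using v by simp
    qed simp
  qed
  show small: "(\<forall>A\<in>\<alpha>. card A = 1 \<or> card A = 2) \<longleftrightarrow> small_blocks \<alpha>"
  proof
    assume L: "\<forall>A\<in>\<alpha>. card A = 1 \<or> card A = 2"
    show "small_blocks \<alpha>" unfolding small_blocks_def
    proof (intro allI impI)
      fix u v w assume uv: "(u, v) \<in> conn \<alpha>" "(u, w) \<in> conn \<alpha>" "u \<noteq> v" "u \<noteq> w"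
      then obtain A where "A \<in> \<alpha>" "u \<in> A" "v \<in> A" unfolding conn_def by blast
      then show "v = w" using L cases[of A] uv mem[of A u w] by blast
    qed
  next
    assume "small_blocks \<alpha>"
    then show "\<forall>A\<in>\<alpha>. card A = 1 \<or> card A = 2" using cases mem unfolding small_blocks_def by metis
  qed
  have two: "card A = 2 \<longleftrightarrow> (card A = 1 \<or> card A = 2) \<and> (\<forall>u\<in>A. \<exists>v\<in>A. v \<noteq> u)" if "A \<in> \<alpha>" for A
  proof -
    have "card A = 1 \<Longrightarrow> \<not> (\<forall>u\<in>A. \<exists>v\<in>A. v \<noteq> u)" by (auto simp: card_1_singleton_iff)
    moreover have "card A = 2 \<Longrightarrow> \<forall>u\<in>A. \<exists>v\<in>A. v \<noteq> u" by (auto simp: card_2_iff)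
    ultimately show ?thesis by auto
  qed
  have "no_singletons m n \<alpha> \<longleftrightarrow> (\<forall>A\<in>\<alpha>. \<forall>u\<in>A. \<exists>v\<in>A. v \<noteq> u)"
  proof
    assume *: "no_singletons m n \<alpha>"
    show "\<forall>A\<in>\<alpha>. \<forall>u\<in>A. \<exists>v\<in>A. v \<noteq> u"
    proof (intro ballI)
      fix A u assume A: "A \<in> \<alpha>" "u \<in> A"
      then obtain v where "v \<noteq> u" "(u, v) \<in> conn \<alpha>"
        using * blocks(3)[OF A(1)] unfolding no_singletons_def by blast
      then show "\<exists>v\<in>A. v \<noteq> u" using mem[OF A] by blast
    qed
  next
    assume *: "\<forall>A\<in>\<alpha>. \<forall>u\<in>A. \<exists>v\<in>A. v \<noteq> u"
    show "no_singletons m n \<alpha>" unfolding no_singletons_def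
    proof
      fix u assume "u \<in> vertices m n"
      then obtain A where "A \<in> \<alpha>" "u \<in> A" using P unfolding partition_on_def by blast
      then show "\<exists>v. v \<noteq> u \<and> (u, v) \<in> conn \<alpha>" using *[rule_format, of A u] mem[of A u] by blast
    qed
  qed
  then show "(\<forall>A\<in>\<alpha>. card A = 2) \<longleftrightarrow> small_blocks \<alpha> \<and> no_singletons m n \<alpha>"
    using small two by metis
qed

lemma even_card_matched:
  assumes \<alpha>: "\<alpha> \<in> partitions m n" and two: "\<forall>A\<in>\<alpha>. card A = 2"
    and C: "C \<subseteq> vertices m n" and closed: "\<And>u v. u \<in> C \<Longrightarrow> (u, v) \<in> conn \<alpha> \<Longrightarrow> v \<in> C"
  shows "even (card C)"
proof -
  have P: "partition_on (vertices m n) \<alpha>" using \<alpha> by (simp add: partitions_def)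
  define \<C> where "\<C> = {A \<in> \<alpha>. A \<subseteq> C}"
  have "\<exists>A\<in>\<C>. u \<in> A" if u: "u \<in> C" for u
  proof -
    obtain A where A: "A \<in> \<alpha>" "u \<in> A" using u C P unfolding partition_on_def by blast
    then have "A \<subseteq> C" using closed[OF u] unfolding conn_def by blast
    then show ?thesis using A by (auto simp: \<C>_def)
  qed
  then have U: "\<Union>\<C> = C" by (auto simp: \<C>_def)
  have "disjoint \<C>" using P unfolding partition_on_def \<C>_def disjoint_def by blast
  then have "card C = sum card \<C>"
    unfolding U[symmetric]
  proof (rule card_Union_disjoint)
    show "finite A" if "A \<in> \<C>" for A
      using that C finite_subset[OF _ finite_vertices[of m n]] unfolding \<C>_def by blast
  qed
  also have "\<dots> = (\<Sum>A\<in>\<C>. 2)" by (rule sum.cong) (auto simp: \<C>_def two)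
  finally show ?thesis by simp
qed

text \<open>Let the component of \<open>u\<close> in the product graph have \<open>a\<close>, \<open>b\<close> and \<open>c\<close> vertices in the three rows.
Perfect matchings make \<open>a + b\<close> and \<open>b + c\<close> even, hence also \<open>a + c\<close>, so \<open>u\<close> is not the only outer
vertex.\<close>

lemma no_singletons_prod:
  assumes \<alpha>: "\<alpha> \<in> partitions m n" "\<forall>A\<in>\<alpha>. card A = 2" and \<beta>: "\<beta> \<in> partitions n k" "\<forall>A\<in>\<beta>. card A = 2"
  shows "no_singletons m k (\<alpha> \<odot> \<beta>)"
  unfolding no_singletons_def
proof (rule ballI, rule ccontr)
  fix u assume u: "u \<in> vertices m k" and none: "\<not> (\<exists>v. v \<noteq> u \<and> (u, v) \<in> conn (\<alpha> \<odot> \<beta>))"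
  define R where "R = (product_step \<alpha> \<beta>)\<^sup>* `` {u}"
  have R: "v \<in> R \<longleftrightarrow> (u, v) \<in> (product_step \<alpha> \<beta>)\<^sup>*" for v by (simp add: R_def)
  have closed: "w \<in> R" if "v \<in> R" "(v, w) \<in> (product_step \<alpha> \<beta>)\<^sup>*" for v w
    using that unfolding R by (rule rtrancl_trans)
  define a b c where "a = {x \<in> {1..m}. Upper x \<in> R}" and "b = {x \<in> {1..n}. Middle x \<in> R}"
    and "c = {x \<in> {1..k}. Lower x \<in> R}"
  have fin: "finite a" "finite b" "finite c" by (auto simp: a_def b_def c_def)
  have "even (card {v \<in> vertices m n. lower_to_middle v \<in> R})"
    by (rule even_card_matched[OF \<alpha>])
       (use conn_imp_walk1[of _ _ \<alpha> \<beta>] closed conn_vertices[OF \<alpha>(1)] in blast)+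
  also have "{v \<in> vertices m n. lower_to_middle v \<in> R} = Upper ` a \<union> Lower ` b"
    by (auto simp: vertices_def a_def b_def)
  also have "card \<dots> = card a + card b"
    using fin by (subst card_Un_disjoint) (auto simp: card_image inj_on_def)
  finally have 1: "even (card a + card b)" .
  have "even (card {v \<in> vertices n k. upper_to_middle v \<in> R})"
    by (rule even_card_matched[OF \<beta>])
       (use conn_imp_walk2[of _ _ \<beta> \<alpha>] closed conn_vertices[OF \<beta>(1)] in blast)+
  also have "{v \<in> vertices n k. upper_to_middle v \<in> R} = Upper ` b \<union> Lower ` c"
    by (auto simp: vertices_def b_def c_def)
  also have "card \<dots> = card b + card c"
    using fin by (subst card_Un_disjoint) (auto simp: card_image inj_on_def)
  finally have 2: "even (card b + card c)" .
  have "{v \<in> vertices m k. v \<in> R} = Upper ` a \<union> Lower ` c"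
    by (auto simp: vertices_def a_def c_def)
  moreover have "card (Upper ` a \<union> Lower ` c) = card a + card c"
    using fin by (subst card_Un_disjoint) (auto simp: card_image inj_on_def)
  moreover have "{v \<in> vertices m k. v \<in> R} = {u}"
    using none u unfolding conn_prod[OF \<alpha>(1) \<beta>(1)] R by blast
  ultimately have "card a + card c = card {u}" by metis
  then have "card a + card c = 1" by simp
  then show False using 1 2 by presburger
qed

section \<open>The three categories\<close>

text \<open>The three categories in one definition: no flag for planar partitions, \<open>s\<close> for block sizes at most
two, and \<open>t\<close> for block size exactly two.\<close>

definition diagrams :: "bool \<Rightarrow> bool \<Rightarrow> nat \<Rightarrow> nat \<Rightarrow> vertex set set set" where
  "diagrams s t m n = {\<alpha> \<in> partitions m n. noncrossing \<alpha> \<and>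
     (s \<or> t \<longrightarrow> small_blocks \<alpha>) \<and> (t \<longrightarrow> no_singletons m n \<alpha>)}"

lemma diagrams_eq:
  "planar_partitions = diagrams False False" "motzkin = diagrams True False" "temperley_lieb = diagrams True True"
proof -
  show "planar_partitions = diagrams False False"
    by (simp add: fun_eq_iff planar_partitions_eq diagrams_def)
  have "motzkin m n = diagrams True False m n" for m n
    unfolding motzkin_def diagrams_def planar_partitions_eq using small_blocks_iff(1)[of _ m n] by blast
  then show "motzkin = diagrams True False" by (simp add: fun_eq_iff)
  have "temperley_lieb m n = diagrams True True m n" for m n
    unfolding temperley_lieb_def diagrams_def planar_partitions_eq using small_blocks_iff(2)[of _ m n] by blast
  then show "temperley_lieb = diagrams True True" by (simp add: fun_eq_iff)
qed

lemma block_unique: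
  "\<alpha> \<in> partitions m n \<Longrightarrow> A \<in> \<alpha> \<Longrightarrow> B \<in> \<alpha> \<Longrightarrow> u \<in> A \<Longrightarrow> u \<in> B \<Longrightarrow> A = B"
  unfolding partitions_def partition_on_def disjoint_def by blast

lemma diagramsD:
  assumes "\<alpha> \<in> diagrams s t m n"
  shows "\<alpha> \<in> partitions m n" "noncrossing \<alpha>" "s \<or> t \<Longrightarrow> small_blocks \<alpha>" "t \<Longrightarrow> no_singletons m n \<alpha>"
  using assms by (auto simp: diagrams_def)

lemma diagrams_prod:
  assumes "\<alpha> \<in> diagrams s t m n" "\<beta> \<in> diagrams s t n k"
  shows "\<alpha> \<odot> \<beta> \<in> diagrams s t m k"
proof -
  note a = diagramsD[OF assms(1)] and b = diagramsD[OF assms(2)]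
  have "no_singletons m k (\<alpha> \<odot> \<beta>)" if t
    using no_singletons_prod[OF a(1) _ b(1)] a(3,4) b(3,4) that
      small_blocks_iff(2)[OF a(1)] small_blocks_iff(2)[OF b(1)] by blast
  then show ?thesis
    unfolding diagrams_def
    using prod_in_partitions[OF a(1) b(1)] noncrossing_prod[OF a(1,2) b(1,2)]
      small_blocks_prod[OF a(1) _ b(1)] a(3) b(3) by blast
qed

abbreviation boundary_increasing :: "vertex set \<Rightarrow> (vertex \<Rightarrow> vertex) \<Rightarrow> bool" where
  "boundary_increasing V \<phi> \<equiv>
     (\<forall>u\<in>V. \<forall>v\<in>V. boundary_pos u < boundary_pos v \<longrightarrow> boundary_pos (\<phi> u) < boundary_pos (\<phi> v))"

abbreviation boundary_decreasing :: "vertex set \<Rightarrow> (vertex \<Rightarrow> vertex) \<Rightarrow> bool" where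
  "boundary_decreasing V \<phi> \<equiv>
     (\<forall>u\<in>V. \<forall>v\<in>V. boundary_pos u < boundary_pos v \<longrightarrow> boundary_pos (\<phi> v) < boundary_pos (\<phi> u))"

text \<open>Membership in the category is inherited along a map of vertices that preserves or reverses the
boundary order. For block size exactly two the image must be a union of blocks.\<close>

lemma diagrams_pullback:
  assumes \<alpha>: "\<alpha> \<in> diagrams s t m n"
    and \<phi>: "\<phi> ` vertices p q \<subseteq> vertices m n"
    and mono: "(boundary_increasing (vertices p q) \<phi>) \<or>
      (boundary_decreasing (vertices p q) \<phi>)"
    and L: "\<And>u v. u \<in> vertices p q \<Longrightarrow> v \<in> vertices p q \<Longrightarrow> L u = L v \<longleftrightarrow> (\<phi> u, \<phi> v) \<in> conn \<alpha>"
    and saturated: "\<And>u v. t \<Longrightarrow> u \<in> vertices p q \<Longrightarrow> (\<phi> u, v) \<in> conn \<alpha> \<Longrightarrow> v \<in> \<phi> ` vertices p q"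
  shows "kernel_partition p q L \<in> diagrams s t p q"
proof -
  note a = diagramsD[OF \<alpha>]
  let ?\<kappa> = "kernel_partition p q L"
  have cn: "(u, v) \<in> conn ?\<kappa> \<longleftrightarrow> u \<in> vertices p q \<and> v \<in> vertices p q \<and> (\<phi> u, \<phi> v) \<in> conn \<alpha>" for u v
    using L by (auto simp: conn_kernel)
  have inj: "\<phi> u \<noteq> \<phi> v" if "u \<in> vertices p q" "v \<in> vertices p q" "u \<noteq> v" for u v
  proof -
    have "boundary_pos u \<noteq> boundary_pos v" using boundary_pos_inj that by blast
    then have "boundary_pos (\<phi> u) \<noteq> boundary_pos (\<phi> v)"
      using mono that by (metis less_irrefl linorder_neqE_linordered_idom)
    then show ?thesis by auto
  qed
  have "noncrossing ?\<kappa>"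
    unfolding noncrossing_def
  proof (intro allI impI)
    fix x y z w
    assume ord: "boundary_pos x < boundary_pos y" "boundary_pos y < boundary_pos z" "boundary_pos z < boundary_pos w"
      and xz: "(x, z) \<in> conn ?\<kappa>" and yw: "(y, w) \<in> conn ?\<kappa>"
    have V: "x \<in> vertices p q" "y \<in> vertices p q" "z \<in> vertices p q" "w \<in> vertices p q"
      and c: "(\<phi> x, \<phi> z) \<in> conn \<alpha>" "(\<phi> y, \<phi> w) \<in> conn \<alpha>" using xz yw cn by auto
    have "(\<phi> x, \<phi> y) \<in> conn \<alpha>"
      using mono
    proof
      assume "boundary_increasing (vertices p q) \<phi>"
      then show ?thesis using noncrossingD[OF a(2) _ _ _ c] V ord by blast
    next
      assume "boundary_decreasing (vertices p q) \<phi>"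
      then have "(\<phi> w, \<phi> z) \<in> conn \<alpha>"
        using noncrossingD[OF a(2) _ _ _ conn_sym[OF c(2)] conn_sym[OF c(1)]] V ord by blast
      then show ?thesis using c conn_sym conn_trans[OF a(1)] by metis
    qed
    then show "(x, y) \<in> conn ?\<kappa>" using V cn by blast
  qed
  moreover have "small_blocks ?\<kappa>" if "s \<or> t"
    unfolding small_blocks_def
  proof (intro allI impI)
    fix u v w assume uv: "(u, v) \<in> conn ?\<kappa>" "(u, w) \<in> conn ?\<kappa>" "u \<noteq> v" "u \<noteq> w"
    then have "\<phi> v = \<phi> w"
      using small_blocksD[OF a(3)[OF that], of "\<phi> u" "\<phi> v" "\<phi> w"] inj cn by blast
    then show "v = w" using inj[of v w] uv cn by blast
  qed
  moreover have "no_singletons p q ?\<kappa>" if t: t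
    unfolding no_singletons_def
  proof
    fix u assume u: "u \<in> vertices p q"
    then obtain z where z: "z \<noteq> \<phi> u" "(\<phi> u, z) \<in> conn \<alpha>"
      using a(4)[OF t] \<phi> unfolding no_singletons_def by blast
    then obtain v where "v \<in> vertices p q" "z = \<phi> v" using saturated[OF t u] by blast
    then show "\<exists>v. v \<noteq> u \<and> (u, v) \<in> conn ?\<kappa>"
      using u z cn[of u v] by (intro exI[of _ v]) auto
  qed
  ultimately show ?thesis by (simp add: diagrams_def)
qed

section \<open>Transversal blocks and splitting\<close>

text \<open>The blocks meeting both rows, listed from left to right: the \<open>i\<close>-th one contains the upper vertex
\<open>\<mu> i\<close> and the lower vertex \<open>\<nu> i\<close>.\<close>

definition transversal_enumeration ::
    "nat \<Rightarrow> nat \<Rightarrow> vertex set set \<Rightarrow> (nat \<Rightarrow> nat) \<Rightarrow> (nat \<Rightarrow> nat) \<Rightarrow> bool" where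
  "transversal_enumeration m n \<alpha> \<mu> \<nu> \<longleftrightarrow> (let I = {1..part_rank \<alpha>} in
     strict_mono_on I \<mu> \<and> \<mu> ` I \<subseteq> {1..m} \<and> strict_mono_on I \<nu> \<and> \<nu> ` I \<subseteq> {1..n} \<and>
     (\<forall>i\<in>I. (Upper (\<mu> i), Lower (\<nu> i)) \<in> conn \<alpha>) \<and>
     (\<forall>i\<in>I. \<forall>j\<in>I. (Lower (\<nu> i), Lower (\<nu> j)) \<in> conn \<alpha> \<longrightarrow> i = j) \<and>
     (\<forall>x y. (Upper x, Lower y) \<in> conn \<alpha> \<longrightarrow> (\<exists>i\<in>I. (Lower (\<nu> i), Lower y) \<in> conn \<alpha>)))"

lemma transversal_enumerationD:
  assumes "transversal_enumeration m n \<alpha> \<mu> \<nu>"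
  shows "strict_mono_on {1..part_rank \<alpha>} \<mu>" "\<mu> ` {1..part_rank \<alpha>} \<subseteq> {1..m}"
    "strict_mono_on {1..part_rank \<alpha>} \<nu>" "\<nu> ` {1..part_rank \<alpha>} \<subseteq> {1..n}"
    "\<And>i. i \<in> {1..part_rank \<alpha>} \<Longrightarrow> (Upper (\<mu> i), Lower (\<nu> i)) \<in> conn \<alpha>"
    "\<And>i j. i \<in> {1..part_rank \<alpha>} \<Longrightarrow> j \<in> {1..part_rank \<alpha>} \<Longrightarrow> (Lower (\<nu> i), Lower (\<nu> j)) \<in> conn \<alpha> \<Longrightarrow> i = j"
    "\<And>x y. (Upper x, Lower y) \<in> conn \<alpha> \<Longrightarrow> \<exists>i\<in>{1..part_rank \<alpha>}. (Lower (\<nu> i), Lower y) \<in> conn \<alpha>"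
  using assms unfolding transversal_enumeration_def Let_def by blast+

text \<open>The blocks are ordered by their least lower vertex; any choice of upper vertices is then increasing,
since the partition is noncrossing.\<close>

lemma transversal_enumeration_exists:
  assumes \<alpha>: "\<alpha> \<in> partitions m n" and nc: "noncrossing \<alpha>"
  shows "\<exists>\<mu> \<nu>. transversal_enumeration m n \<alpha> \<mu> \<nu>"
proof -
  have P: "partition_on (vertices m n) \<alpha>" using \<alpha> by (simp add: partitions_def)
  define T where "T = {A \<in> \<alpha>. A \<inter> range Upper \<noteq> {} \<and> A \<inter> range Lower \<noteq> {}}"
  define low where "low A = (LEAST y. Lower y \<in> A)" for A
  have low: "Lower (low A) \<in> A" if A: "A \<in> T" for A
  proof -
    obtain y where "Lower y \<in> A" using A by (auto simp: T_def)
    then show ?thesis unfolding low_def by (rule LeastI)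
  qed
  note same = block_unique[OF \<alpha>]
  have mem: "(u, v) \<in> conn \<alpha> \<longleftrightarrow> v \<in> A" if "A \<in> \<alpha>" "u \<in> A" for A u v
    using that same unfolding conn_def by blast
  have T\<alpha>: "T \<subseteq> \<alpha>" by (auto simp: T_def)
  have inj: "inj_on low T"
  proof (rule inj_onI)
    fix A B assume AB: "A \<in> T" "B \<in> T" "low A = low B"
    show "A = B" by (rule same[of A B "Lower (low A)"]) (use AB T\<alpha> low[OF AB(1)] low[OF AB(2)] in auto)
  qed
  have finT: "finite T" using finite_elements[OF _ P] T\<alpha> finite_subset by auto
  define Y where "Y = low ` T"
  have Y: "finite Y" "card Y = part_rank \<alpha>"
    using finT card_image[OF inj] by (auto simp: Y_def part_rank_def T_def)
  obtain h where h: "bij_betw h {..<card Y} Y" "strict_mono_on {..<card Y} h"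
    using ex_bij_betw_strict_mono_card[OF Y(1)] by blast
  define I where "I = {1..part_rank \<alpha>}"
  define \<nu> where "\<nu> i = h (i - 1)" for i
  have I1: "i - 1 \<in> {..<card Y}" if "i \<in> I" for i using that by (auto simp: I_def Y)
  have \<nu>mono: "strict_mono_on I \<nu>"
  proof (rule strict_mono_onI)
    fix i j assume ij: "i \<in> I" "j \<in> I" "i < j"
    then have "i - 1 < j - 1" by (auto simp: I_def)
    then show "\<nu> i < \<nu> j" unfolding \<nu>_def using strict_mono_onD[OF h(2)] I1 ij by blast
  qed
  have \<nu>Y: "\<nu> i \<in> Y" if "i \<in> I" for i
    using bij_betwE[OF h(1)] I1[OF that] by (auto simp: \<nu>_def)
  define B where "B i = (SOME A. A \<in> T \<and> low A = \<nu> i)" for i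
  have B: "B i \<in> T" "low (B i) = \<nu> i" if "i \<in> I" for i
  proof -
    have "\<exists>A. A \<in> T \<and> low A = \<nu> i" using \<nu>Y[OF that] by (auto simp: Y_def)
    from someI_ex[OF this] show "B i \<in> T" "low (B i) = \<nu> i" by (auto simp: B_def)
  qed
  have B\<nu>: "Lower (\<nu> i) \<in> B i" if "i \<in> I" for i using low[OF B(1)[OF that]] B(2)[OF that] by simp
  have B\<alpha>: "B i \<in> \<alpha>" if "i \<in> I" for i using B(1)[OF that] T\<alpha> by blast
  define \<mu> where "\<mu> i = (SOME x. Upper x \<in> B i)" for i
  have B\<mu>: "Upper (\<mu> i) \<in> B i" if "i \<in> I" for i
  proof -
    have "\<exists>x. Upper x \<in> B i" using B(1)[OF that] by (auto simp: T_def)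
    then show ?thesis unfolding \<mu>_def by (rule someI_ex)
  qed
  have distinct: "i = j" if "i \<in> I" "j \<in> I" "(u, v) \<in> conn \<alpha>" "u \<in> B i" "v \<in> B j" for i j u v
  proof -
    have "v \<in> B i" using mem[OF B\<alpha>[OF that(1)] that(4)] that(3) by blast
    then have "B i = B j" using same B\<alpha> that by blast
    then have "\<nu> i = \<nu> j" using B that by metis
    then show ?thesis using strict_mono_on_imp_inj_on[OF \<nu>mono] that by (meson inj_onD)
  qed
  have \<mu>mono: "strict_mono_on I \<mu>"
  proof (rule strict_mono_onI, rule ccontr)
    fix i j assume ij: "i \<in> I" "j \<in> I" "i < j" and n: "\<not> \<mu> i < \<mu> j"
    have cc: "(Upper (\<mu> i), Lower (\<nu> i)) \<in> conn \<alpha>" "(Upper (\<mu> j), Lower (\<nu> j)) \<in> conn \<alpha>"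
      using mem[OF B\<alpha> B\<mu>] B\<nu> ij by blast+
    have "(Upper (\<mu> i), Upper (\<mu> j)) \<in> conn \<alpha>"
    proof (cases "\<mu> i = \<mu> j")
      case True
      then show ?thesis using conn_refl_iff[OF \<alpha>] conn_vertices[OF \<alpha> cc(1)] by auto
    next
      case False
      have "\<nu> i > 0" using conn_vertices[OF \<alpha> cc(1)] by (auto simp: vertices_def)
      then have pos: "- real (\<mu> j) < real (\<nu> i)" by linarith
      show ?thesis
        using False noncrossingD[OF nc _ _ _ cc] n strict_mono_onD[OF \<nu>mono ij] pos by simp
    qed
    from distinct[OF ij(1,2) this B\<mu>[OF ij(1)] B\<mu>[OF ij(2)]] show False using ij by simp
  qed
  have V: "B i \<subseteq> vertices m n" if "i \<in> I" for i
    using B\<alpha>[OF that] P unfolding partition_on_def by blast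
  have "transversal_enumeration m n \<alpha> \<mu> \<nu>"
    unfolding transversal_enumeration_def Let_def I_def[symmetric]
  proof (intro conjI ballI allI impI \<mu>mono \<nu>mono)
    show "\<mu> ` I \<subseteq> {1..m}" "\<nu> ` I \<subseteq> {1..n}"
      using B\<mu> B\<nu> V by (force simp: vertices_def)+
    show "(Upper (\<mu> i), Lower (\<nu> i)) \<in> conn \<alpha>" if "i \<in> I" for i
      using mem[OF B\<alpha> B\<mu>] B\<nu> that by blast
    show "i = j" if "i \<in> I" "j \<in> I" "(Lower (\<nu> i), Lower (\<nu> j)) \<in> conn \<alpha>" for i j
      using distinct that B\<nu> by blast
    fix x y assume "(Upper x, Lower y) \<in> conn \<alpha>"
    then obtain A where A: "A \<in> \<alpha>" "Upper x \<in> A" "Lower y \<in> A" by (auto simp: conn_def)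
    then have AT: "A \<in> T" by (auto simp: T_def)
    then have "low A \<in> h ` {..<card Y}" using bij_betw_imp_surj_on[OF h(1)] by (auto simp: Y_def)
    then obtain i where i: "i < card Y" "low A = h i" by auto
    then have iI: "Suc i \<in> I" "\<nu> (Suc i) = low A" by (auto simp: I_def Y \<nu>_def)
    then have "B (Suc i) = A" using inj_onD[OF inj] B[OF iI(1)] AT by simp
    then have "(Lower (\<nu> (Suc i)), Lower y) \<in> conn \<alpha>"
      using mem[OF B\<alpha> B\<nu>] iI(1) A(3) by blast
    then show "\<exists>i\<in>I. (Lower (\<nu> i), Lower y) \<in> conn \<alpha>" using iI(1) by blast
  qed
  then show ?thesis by blast
qed

lemma part_rank_le:
  assumes "\<alpha> \<in> partitions m n" "noncrossing \<alpha>"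
  shows "part_rank \<alpha> \<le> m" "part_rank \<alpha> \<le> n"
proof -
  obtain \<mu> \<nu> where "transversal_enumeration m n \<alpha> \<mu> \<nu>" using transversal_enumeration_exists[OF assms] by blast
  note e = transversal_enumerationD[OF this]
  show "part_rank \<alpha> \<le> m" using card_inj_on_le[OF strict_mono_on_imp_inj_on[OF e(1)] e(2)] by simp
  show "part_rank \<alpha> \<le> n" using card_inj_on_le[OF strict_mono_on_imp_inj_on[OF e(3)] e(4)] by simp
qed

lemma strict_mono_on_interval_id:
  fixes f :: "nat \<Rightarrow> nat"
  assumes mono: "strict_mono_on {1..n} f" and f: "f ` {1..n} \<subseteq> {1..n}" and i: "i \<in> {1..n}"
  shows "f i = i"
proof -
  have lower: "i \<le> f i" if "i \<in> {1..n}" for i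
    using that
  proof (induction i)
    case (Suc i)
    show ?case
    proof (cases "i = 0")
      case True
      then show ?thesis using f Suc.prems by force
    next
      case False
      then show ?thesis using Suc strict_mono_onD[OF mono, of i "Suc i"] by force
    qed
  qed simp
  have inj: "inj_on f {1..n}" using mono by (rule strict_mono_on_imp_inj_on)
  have "f ` {i..n} \<subseteq> {i..n}"
  proof
    fix y assume "y \<in> f ` {i..n}"
    then obtain j where "y = f j" "j \<in> {1..n}" "i \<le> j" using i by auto
    then show "y \<in> {i..n}" using lower[of j] f by fastforce
  qed
  moreover have "inj_on f {i..n}" using inj by (rule inj_on_subset) (use i in auto)
  ultimately have "f ` {i..n} = {i..n}" by (intro endo_inj_surj) auto
  then obtain j where j: "j \<in> {i..n}" "f j = i" using i by (metis atLeastAtMost_iff imageE order_refl)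
  then show ?thesis using lower[of j] i by (cases "j = i") auto
qed

lemma full_rank_identity:
  assumes \<alpha>: "\<alpha> \<in> partitions n n" and nc: "noncrossing \<alpha>" and rank: "part_rank \<alpha> = n"
  shows "\<alpha> = identity_partition n"
proof -
  obtain \<mu> \<nu> where "transversal_enumeration n n \<alpha> \<mu> \<nu>" using transversal_enumeration_exists[OF \<alpha> nc] by blast
  note e = transversal_enumerationD[OF this, unfolded rank]
  have id: "\<mu> i = i" "\<nu> i = i" if "i \<in> {1..n}" for i
    using strict_mono_on_interval_id e that by blast+
  have up: "(Upper i, Lower i) \<in> conn \<alpha>" if "i \<in> {1..n}" for i using e(5)[OF that] id[OF that] by simp
  have low: "(Lower i, Lower j) \<in> conn \<alpha> \<longleftrightarrow> i = j" if "i \<in> {1..n}" "j \<in> {1..n}" for i j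
    using e(6)[OF that] id that conn_refl_iff[OF \<alpha>] by (auto simp: vertices_def)
  define L where "L = label (\<lambda>x. x) (\<lambda>x::nat. x)"
  have down: "(u, Lower (L u)) \<in> conn \<alpha>" "L u \<in> {1..n}" if "u \<in> vertices n n" for u
    using that up low by (auto simp: L_def elim!: vertices_cases)
  have "(u, v) \<in> conn \<alpha> \<longleftrightarrow> L u = L v" if "u \<in> vertices n n" "v \<in> vertices n n" for u v
    using low[OF down(2)[OF that(1)] down(2)[OF that(2)]] down(1)[OF that(1)] down(1)[OF that(2)]
      conn_sym conn_trans[OF \<alpha>] by metis
  then have "conn \<alpha> = conn (kernel_partition n n L)"
    using conn_vertices[OF \<alpha>] unfolding conn_kernel by blast
  then show ?thesis
    unfolding identity_partition_def L_def[symmetric] by (rule partitions_eqI[OF \<alpha> kernel_partition_in])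
qed

text \<open>Every transversal block of the product passes through the middle row.\<close>

lemma part_rank_prod_le_middle:
  assumes \<alpha>: "\<alpha> \<in> partitions m n" and \<beta>: "\<beta> \<in> partitions n k"
  shows "part_rank (\<alpha> \<odot> \<beta>) \<le> n"
proof -
  define W where "W = (product_step \<alpha> \<beta>)\<^sup>*"
  define T where "T = {A \<in> \<alpha> \<odot> \<beta>. A \<inter> range Upper \<noteq> {} \<and> A \<inter> range Lower \<noteq> {}}"
  have middle: "v \<in> range Upper \<or> (\<exists>y\<in>{1..n}. (u, Middle y) \<in> W)"
    if "(u, v) \<in> (product_step \<alpha> \<beta>)\<^sup>*" "u \<in> range Upper" for u v
    using that
  proof (induction rule: rtrancl_induct)
    case (step v w)
    show ?case
    proof (cases "\<exists>y\<in>{1..n}. (u, Middle y) \<in> W")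
      case False
      then obtain x where x: "v = Upper x" using step by blast
      from step(2) show ?thesis unfolding product_step_iff
      proof (elim disjE exE conjE)
        fix a b assume ab: "(a, b) \<in> conn \<alpha>" "w = lower_to_middle b"
        have "b \<in> vertices m n" using conn_vertices[OF \<alpha> ab(1)] by simp
        then show ?thesis
        proof (elim vertices_cases)
          fix y assume "b = Lower y" "1 \<le> y" "y \<le> n"
          then show ?thesis using ab step(1,2) unfolding W_def by (auto intro: rtrancl_into_rtrancl)
        qed (use ab in auto)
      next
        fix a b assume ab: "(a, b) \<in> conn \<beta>" "v = upper_to_middle a"
        then show ?thesis using x conn_vertices[OF \<beta> ab(1)] by (auto elim!: vertices_cases)
      qed
    qed blast
  qed simp
  have ex: "\<exists>y. y \<in> {1..n} \<and> (\<exists>u\<in>A. (u, Middle y) \<in> W)" if A: "A \<in> T" for A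
  proof -
    obtain x z where xz: "Upper x \<in> A" "Lower z \<in> A" using A by (auto simp: T_def)
    then have "(Upper x, Lower z) \<in> conn (\<alpha> \<odot> \<beta>)" using A by (auto simp: conn_def T_def)
    then have "(Upper x, Lower z) \<in> (product_step \<alpha> \<beta>)\<^sup>*" unfolding conn_prod[OF \<alpha> \<beta>] by blast
    from middle[OF this] show ?thesis using xz(1) by blast
  qed
  define f where "f A = (SOME y. y \<in> {1..n} \<and> (\<exists>u\<in>A. (u, Middle y) \<in> W))" for A
  have f: "f A \<in> {1..n}" "\<exists>u\<in>A. (u, Middle (f A)) \<in> W" if "A \<in> T" for A
    using someI_ex[OF ex[OF that]] by (auto simp: f_def)
  have P: "partition_on (vertices m k) (\<alpha> \<odot> \<beta>)"
    using prod_in_partitions[OF \<alpha> \<beta>] by (simp add: partitions_def)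
  have "inj_on f T"
  proof (rule inj_onI)
    fix A B assume AB: "A \<in> T" "B \<in> T" "f A = f B"
    obtain u v where uv: "u \<in> A" "v \<in> B" "(u, Middle (f A)) \<in> W" "(v, Middle (f A)) \<in> W"
      using f(2)[OF AB(1)] f(2)[OF AB(2)] AB(3) by auto
    have in\<alpha>\<beta>: "A \<in> \<alpha> \<odot> \<beta>" "B \<in> \<alpha> \<odot> \<beta>" using AB by (auto simp: T_def)
    then have "u \<in> vertices m k" "v \<in> vertices m k" using uv P unfolding partition_on_def by blast+
    moreover have "(u, v) \<in> W"
      using uv product_walk_sym unfolding W_def by (meson rtrancl_trans)
    ultimately have "(u, v) \<in> conn (\<alpha> \<odot> \<beta>)" unfolding conn_prod[OF \<alpha> \<beta>] W_def by blast
    then obtain C where "C \<in> \<alpha> \<odot> \<beta>" "u \<in> C" "v \<in> C" by (auto simp: conn_def)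
    then show "A = B" using uv(1,2) in\<alpha>\<beta> block_unique[OF prod_in_partitions[OF \<alpha> \<beta>]] by metis
  qed
  moreover have "f ` T \<subseteq> {1..n}" using f by blast
  ultimately have "card T \<le> card {1..n}" by (rule card_inj_on_le) simp
  then show ?thesis by (simp add: part_rank_def T_def)
qed

text \<open>All five partitions are kernels of labellings by blocks of \<open>\<alpha>\<close>: \<open>f\<close> and \<open>g\<close> label the upper and
the lower row, and \<open>T i\<close> is the \<open>i\<close>-th transversal block. The factors and their one-sided inverses are
pulled back from \<open>\<alpha>\<close> along monotone maps, which send the new row of size \<open>q\<close> to chosen vertices
of the transversal blocks.\<close>

lemma diagrams_split:
  assumes \<alpha>: "\<alpha> \<in> diagrams s t m n"
  defines "q \<equiv> part_rank \<alpha>"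
  shows "\<exists>\<alpha>\<^sub>1\<in>diagrams s t m q. \<exists>\<alpha>\<^sub>2\<in>diagrams s t q n. \<exists>\<tau>\<^sub>1\<in>diagrams s t q m. \<exists>\<tau>\<^sub>2\<in>diagrams s t n q.
    \<alpha> = \<alpha>\<^sub>1 \<odot> \<alpha>\<^sub>2 \<and> \<tau>\<^sub>1 \<odot> \<alpha>\<^sub>1 = identity_partition q \<and> \<alpha>\<^sub>2 \<odot> \<tau>\<^sub>2 = identity_partition q"
proof -
  note a = diagramsD[OF \<alpha>]
  obtain \<mu> \<nu> where "transversal_enumeration m n \<alpha> \<mu> \<nu>" using transversal_enumeration_exists[OF a(1,2)] by blast
  note e = transversal_enumerationD[OF this, folded q_def]
  have range: "1 \<le> \<mu> i \<and> \<mu> i \<le> m" "1 \<le> \<nu> i \<and> \<nu> i \<le> n" if "i \<in> {1..q}" for i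
    using e(2,4) that by (meson atLeastAtMost_iff image_subset_iff)+
  have mono: "\<mu> i < \<mu> j" "\<nu> i < \<nu> j" if "i \<in> {1..q}" "j \<in> {1..q}" "i < j" for i j
    using strict_mono_onD[OF e(1)] strict_mono_onD[OF e(3)] that by blast+
  define f g T where "f x = block \<alpha> (Upper x)" and "g y = block \<alpha> (Lower y)" and "T i = block \<alpha> (Lower (\<nu> i))" for x y i
  have T\<mu>: "T i = block \<alpha> (Upper (\<mu> i))" if "i \<in> {1..q}" for i
    unfolding T_def using block_eq_iff[OF a(1)] conn_vertices[OF a(1) e(5)[OF that]] e(5)[OF that] conn_sym by metis
  have Tinj: "i = j" if "T i = T j" "i \<in> {1..q}" "j \<in> {1..q}" for i j
  proof -
    have "Lower (\<nu> i) \<in> vertices m n" "Lower (\<nu> j) \<in> vertices m n"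
      using range[OF that(2)] range[OF that(3)] by (auto simp: vertices_def)
    then show ?thesis using that(1) e(6)[OF that(2,3)] block_eq_iff[OF a(1)] by (simp add: T_def)
  qed
  have through: "\<exists>i\<in>{1..q}. T i = f x" if "f x = g y" "x \<in> {1..m}" "y \<in> {1..n}" for x y
  proof -
    have "(Upper x, Lower y) \<in> conn \<alpha>"
      using that block_eq_iff[OF a(1), of "Upper x" "Lower y"] by (auto simp: f_def g_def vertices_def)
    then obtain i where i: "i \<in> {1..q}" "(Lower (\<nu> i), Lower y) \<in> conn \<alpha>" using e(7) by blast
    then have "T i = g y"
      using block_eq_iff[OF a(1)] conn_vertices[OF a(1) i(2)] by (auto simp: T_def g_def)
    then show ?thesis using that i by auto
  qed
  have eq\<alpha>: "\<alpha> = kernel2 m n f g"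
    by (rule partition_eq_kernel[OF a(1)]) (auto simp: f_def g_def elim!: vertices_cases)
  have id: "kernel2 q q T T = identity_partition q"
    unfolding identity_partition_def
  proof (rule partitions_eqI[OF kernel_partition_in kernel_partition_in])
    show "conn (kernel2 q q T T) = conn (kernel2 q q (\<lambda>x. x) (\<lambda>x. x))"
      unfolding conn_kernel using Tinj by (auto simp: vertices_def)
  qed
  have "kernel2 m q f T \<odot> kernel2 q n T g = kernel2 m n f g"
    by (rule kernel2_prod) (use through in blast)
  moreover have "kernel2 q m T f \<odot> kernel2 m q f T = kernel2 q q T T"
  proof (rule kernel2_prod)
    fix x z assume "x \<in> {1..q}" "z \<in> {1..q}" "T x = T z"
    then show "\<exists>y\<in>{1..m}. f y = T x" using T\<mu> range by (auto simp: f_def intro!: bexI[of _ "\<mu> x"])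
  qed
  moreover have "kernel2 q n T g \<odot> kernel2 n q g T = kernel2 q q T T"
  proof (rule kernel2_prod)
    fix x z assume "x \<in> {1..q}" "z \<in> {1..q}" "T x = T z"
    then show "\<exists>y\<in>{1..n}. g y = T x" using range by (auto simp: g_def T_def intro!: bexI[of _ "\<nu> x"])
  qed
  moreover
  define \<phi>1 where "\<phi>1 u = (case u of Upper x \<Rightarrow> Upper x | Middle x \<Rightarrow> Middle x | Lower i \<Rightarrow> Lower (\<nu> i))" for u
  define \<phi>2 where "\<phi>2 u = (case u of Upper i \<Rightarrow> Upper (\<mu> i) | Middle x \<Rightarrow> Middle x | Lower x \<Rightarrow> Lower x)" for u
  define \<psi>1 where "\<psi>1 u = (case u of Upper i \<Rightarrow> Lower (\<nu> i) | Middle x \<Rightarrow> Middle x | Lower x \<Rightarrow> Upper x)" for u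
  define \<psi>2 where "\<psi>2 u = (case u of Upper x \<Rightarrow> Lower x | Middle x \<Rightarrow> Middle x | Lower i \<Rightarrow> Upper (\<mu> i))" for u
  have into: "\<phi>1 ` vertices m q \<subseteq> vertices m n" "\<phi>2 ` vertices q n \<subseteq> vertices m n"
    "\<psi>1 ` vertices q m \<subseteq> vertices m n" "\<psi>2 ` vertices n q \<subseteq> vertices m n"
    using range by (auto simp: \<phi>1_def \<phi>2_def \<psi>1_def \<psi>2_def vertices_def)
  have img: "\<psi>1 ` vertices q m = \<phi>1 ` vertices m q" "\<psi>2 ` vertices n q = \<phi>2 ` vertices q n"
    by (auto simp: \<phi>1_def \<phi>2_def \<psi>1_def \<psi>2_def vertices_def image_Un image_image)
  have lab: "label f T u = block \<alpha> (\<phi>1 u)" if "u \<in> vertices m q" for u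
    using that by (auto simp: f_def T_def \<phi>1_def elim!: vertices_cases)
  have lab2: "label T g u = block \<alpha> (\<phi>2 u)" if "u \<in> vertices q n" for u
    using that T\<mu> by (auto simp: g_def \<phi>2_def elim!: vertices_cases)
  have lab3: "label T f u = block \<alpha> (\<psi>1 u)" if "u \<in> vertices q m" for u
    using that by (auto simp: f_def T_def \<psi>1_def elim!: vertices_cases)
  have lab4: "label g T u = block \<alpha> (\<psi>2 u)" if "u \<in> vertices n q" for u
    using that T\<mu> by (auto simp: g_def \<psi>2_def elim!: vertices_cases)
  have labs: "L u = L v \<longleftrightarrow> (\<phi> u, \<phi> v) \<in> conn \<alpha>"
    if "\<And>u. u \<in> V \<Longrightarrow> L u = block \<alpha> (\<phi> u)" "\<phi> ` V \<subseteq> vertices m n" "u \<in> V" "v \<in> V" for L \<phi> u v V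
    using that(1)[OF that(3)] that(1)[OF that(4)] block_eq_iff[OF a(1), of "\<phi> u" "\<phi> v"] that(2-4) by auto
  (* A transversal block of size two is exhausted by its two chosen vertices. *)
  have sat1: "z \<in> \<phi>1 ` vertices m q" if wz: t "w \<in> \<phi>1 ` vertices m q" "(w, z) \<in> conn \<alpha>" for w z
  proof -
    have small: "small_blocks \<alpha>" using a(3) wz(1) by blast
    have I: "z \<in> \<phi>1 ` vertices m q \<longleftrightarrow> (\<exists>x\<in>{1..m}. z = Upper x) \<or> (\<exists>i\<in>{1..q}. z = Lower (\<nu> i))" for z
      by (auto simp: \<phi>1_def vertices_def image_Un image_image)
    have zV: "z \<in> vertices m n" using conn_vertices[OF a(1) wz(3)] by simp
    show ?thesis
    proof (rule ccontr)
      assume z: "z \<notin> \<phi>1 ` vertices m q"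
      then obtain y where y: "z = Lower y" using zV I by (auto elim!: vertices_cases)
      from wz(2) I consider x where "w = Upper x" | i where "i \<in> {1..q}" "w = Lower (\<nu> i)" by blast
      then show False
      proof cases
        case 1
        then obtain i where i: "i \<in> {1..q}" "(Lower (\<nu> i), Lower y) \<in> conn \<alpha>" using e(7) wz(3) y by blast
        then have "(w, Lower (\<nu> i)) \<in> conn \<alpha>" using wz(3) y conn_sym conn_trans[OF a(1)] by metis
        then have "z = Lower (\<nu> i)" using small_blocksD[OF small wz(3)] 1 y by simp
        then show False using z I i(1) by blast
      next
        case 2
        have "z = Upper (\<mu> i)"
          using small_blocksD[OF small wz(3), of "Upper (\<mu> i)"] conn_sym[OF e(5)[OF 2(1)]] 2 z wz(2) by auto
        then show False using y by simp
      qed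
    qed
  qed
  have sat2: "z \<in> \<phi>2 ` vertices q n" if wz: t "w \<in> \<phi>2 ` vertices q n" "(w, z) \<in> conn \<alpha>" for w z
  proof -
    have small: "small_blocks \<alpha>" using a(3) wz(1) by blast
    have I: "z \<in> \<phi>2 ` vertices q n \<longleftrightarrow> (\<exists>x\<in>{1..n}. z = Lower x) \<or> (\<exists>i\<in>{1..q}. z = Upper (\<mu> i))" for z
      by (auto simp: \<phi>2_def vertices_def image_Un image_image)
    have zV: "z \<in> vertices m n" using conn_vertices[OF a(1) wz(3)] by simp
    show ?thesis
    proof (rule ccontr)
      assume z: "z \<notin> \<phi>2 ` vertices q n"
      then obtain y where y: "z = Upper y" using zV I by (auto elim!: vertices_cases)
      from wz(2) I consider x where "w = Lower x" | i where "i \<in> {1..q}" "w = Upper (\<mu> i)" by blast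
      then show False
      proof cases
        case 1
        then obtain i where i: "i \<in> {1..q}" "(Lower (\<nu> i), Lower x) \<in> conn \<alpha>"
          using e(7) conn_sym[OF wz(3)] y by blast
        then have "(w, Upper (\<mu> i)) \<in> conn \<alpha>" using e(5)[OF i(1)] 1 conn_sym conn_trans[OF a(1)] by metis
        then have "z = Upper (\<mu> i)" using small_blocksD[OF small wz(3)] 1 y by simp
        then show False using z I i(1) by blast
      next
        case 2
        have "z = Lower (\<nu> i)"
          using small_blocksD[OF small wz(3), of "Lower (\<nu> i)"] e(5)[OF 2(1)] 2 z wz(2) by auto
        then show False using y by simp
      qed
    qed
  qed
  note sat3 = sat1[folded img(1)] and sat4 = sat2[folded img(2)]
  have "kernel2 m q f T \<in> diagrams s t m q"
  proof (rule diagrams_pullback[OF \<alpha> into(1) disjI1 labs[OF lab into(1)]])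
    show "boundary_increasing (vertices m q) \<phi>1"
      using mono range by (auto simp: \<phi>1_def elim!: vertices_cases)
  qed (use sat1 in blast)+
  moreover have "kernel2 q n T g \<in> diagrams s t q n"
  proof (rule diagrams_pullback[OF \<alpha> into(2) disjI1 labs[OF lab2 into(2)]])
    show "boundary_increasing (vertices q n) \<phi>2"
      using mono range by (auto simp: \<phi>2_def elim!: vertices_cases)
  qed (use sat2 in blast)+
  moreover have "kernel2 q m T f \<in> diagrams s t q m"
  proof (rule diagrams_pullback[OF \<alpha> into(3) disjI2 labs[OF lab3 into(3)]])
    show "boundary_decreasing (vertices q m) \<psi>1"
      using mono range by (auto simp: \<psi>1_def elim!: vertices_cases)
  qed (use sat3 in blast)+
  moreover have "kernel2 n q g T \<in> diagrams s t n q"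
  proof (rule diagrams_pullback[OF \<alpha> into(4) disjI2 labs[OF lab4 into(4)]])
    show "boundary_decreasing (vertices n q) \<psi>2"
      using mono range by (auto simp: \<psi>2_def elim!: vertices_cases)
  qed (use sat4 in blast)+
  ultimately show ?thesis using eq\<alpha> id by metis
qed

text \<open>In a perfect matching the transversal blocks are those with an odd number of lower vertices.\<close>

lemma part_rank_parity:
  assumes \<alpha>: "\<alpha> \<in> partitions m n" and two: "\<forall>A\<in>\<alpha>. card A = 2"
  shows "even (part_rank \<alpha>) \<longleftrightarrow> even n"
proof -
  have P: "partition_on (vertices m n) \<alpha>" using \<alpha> by (simp add: partitions_def)
  have fin: "finite \<alpha>" using finite_elements[OF _ P] by simp
  have finA: "finite A" if "A \<in> \<alpha>" for A using two that card.infinite by fastforce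
  have "(\<Union>A\<in>\<alpha>. A \<inter> range Lower) = Lower ` {1..n}"
    using P by (auto simp: partition_on_def vertices_def)
  then have "n = card (\<Union>A\<in>\<alpha>. A \<inter> range Lower)" by (simp add: card_image inj_on_def)
  also have "\<dots> = (\<Sum>A\<in>\<alpha>. card (A \<inter> range Lower))"
    by (rule card_UN_disjoint) (use fin finA block_unique[OF \<alpha>] in \<open>blast+\<close>)
  finally have n: "even n \<longleftrightarrow> even (card {A \<in> \<alpha>. odd (card (A \<inter> range Lower))})"
    using even_sum_iff[OF fin, of "\<lambda>A. card (A \<inter> range Lower)"] by simp
  have "odd (card (A \<inter> range Lower)) \<longleftrightarrow> A \<inter> range Upper \<noteq> {} \<and> A \<inter> range Lower \<noteq> {}" if A: "A \<in> \<alpha>" for A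
  proof -
    have V: "A \<subseteq> range Upper \<union> range Lower"
    proof -
      have "A \<subseteq> vertices m n" using A P unfolding partition_on_def by blast
      then show ?thesis unfolding vertices_def by blast
    qed
    have "card A = card (A \<inter> range Upper) + card (A \<inter> range Lower)"
      using V finA[OF A] by (subst card_Un_disjoint[symmetric]) (auto intro!: arg_cong[where f = card])
    then have "card (A \<inter> range Upper) + card (A \<inter> range Lower) = 2" using two A by simp
    moreover have "card (A \<inter> range Upper) = 0 \<longleftrightarrow> A \<inter> range Upper = {}"
      "card (A \<inter> range Lower) = 0 \<longleftrightarrow> A \<inter> range Lower = {}" using finA[OF A] by auto
    moreover have "odd c \<longleftrightarrow> b \<noteq> 0 \<and> c \<noteq> 0" if "b + c = 2" for b c :: nat
      using that by presburger
    ultimately show ?thesis by metis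
  qed
  then have "{A \<in> \<alpha>. odd (card (A \<inter> range Lower))} = {A \<in> \<alpha>. A \<inter> range Upper \<noteq> {} \<and> A \<inter> range Lower \<noteq> {}}"
    by blast
  then show ?thesis using n by (simp add: part_rank_def)
qed

text \<open>The identity of \<open>q\<close> factors through \<open>r\<close>: join the first \<open>q\<close> vertices straight and leave the other
\<open>r - q\<close> vertices alone, or pair up neighbours if blocks must have size two. Division by \<open>c\<close> in the
labelling \<open>g\<close> does the pairing.\<close>

lemma diagrams_ladder:
  assumes qr: "q \<le> r" and par: "t \<Longrightarrow> even (r - q)"
  shows "\<exists>\<iota>\<in>diagrams s t q r. \<exists>\<pi>\<in>diagrams s t r q. \<iota> \<odot> \<pi> = identity_partition q"
proof -
  define c :: nat where "c = (if t then 2 else 1)"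
  (* Labels beyond q start at Suc q, so they differ from the labels of the first q vertices. *)
  define g where "g j = (if j \<le> q then j else Suc q + (j - Suc q) div c)" for j
  have g: "g j = j" if "j \<le> q" for j using that by (simp add: g_def)
  have g': "g j > q" if "j > q" for j using that by (simp add: g_def)
  have gmono: "g i \<le> g j" if "i \<le> j" for i j
  proof (cases "i \<le> q \<or> j \<le> q")
    case True
    then show ?thesis using g g'[of j] that by (cases "j \<le> q") auto
  next
    case False
    have "(i - Suc q) div c \<le> (j - Suc q) div c" using that by (intro div_le_mono) simp
    then show ?thesis using False by (simp add: g_def)
  qed
  let ?\<iota> = "kernel2 q r (\<lambda>x. x) g" and ?\<pi> = "kernel2 r q g (\<lambda>x. x)"
  have glow: "g j = i \<longleftrightarrow> j = i" if "i \<le> q" for i j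
    using g[of j] g'[of j] that by (cases "j \<le> q") auto
  have nc: "noncrossing ?\<iota>"
    unfolding noncrossing_def
  proof (intro allI impI)
    fix x y z w
    assume ord: "boundary_pos x < boundary_pos y" "boundary_pos y < boundary_pos z" "boundary_pos z < boundary_pos w"
      and xz: "(x, z) \<in> conn ?\<iota>" and yw: "(y, w) \<in> conn ?\<iota>"
    have V: "x \<in> vertices q r" "y \<in> vertices q r" "z \<in> vertices q r" "w \<in> vertices q r"
      and L: "label (\<lambda>x. x) g x = label (\<lambda>x. x) g z" "label (\<lambda>x. x) g y = label (\<lambda>x. x) g w"
      using xz yw by (auto simp: conn_kernel)
    have "label (\<lambda>x. x) g x = label (\<lambda>x. x) g y"
    proof (cases "\<exists>i. x = Lower i")
      case True
      then obtain i j k where "x = Lower i" "y = Lower j" "z = Lower k"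
        using ord V by (auto elim!: vertices_cases)
      then show ?thesis using L(1) ord gmono[of i j] gmono[of j k] by simp
    next
      case False
      then obtain i where i: "x = Upper i" "1 \<le> i" "i \<le> q" using V by (auto elim!: vertices_cases)
      then have "z \<noteq> Upper k" for k using L(1) ord by auto
      then obtain k where "z = Lower k" using V by (auto elim!: vertices_cases)
      then have z: "z = Lower i" using L(1) i glow[of i k] by auto
      then obtain j where j: "w = Lower j" "j > i" using ord V by (auto elim!: vertices_cases)
      then have "g j > i" using gmono[of i j] glow[of i j] g[of i] i by (metis le_neq_implies_less less_imp_le_nat nat_neq_iff)
      moreover have "label (\<lambda>x. x) g y < i"
        using V(2)
      proof (elim vertices_cases)
        fix a assume "y = Upper a"
        then show ?thesis using ord i by simp
      next
        fix a assume "y = Lower a"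
        then show ?thesis using ord z i g[of a] by simp
      qed
      ultimately show ?thesis using L(2) j by simp
    qed
    then show "(x, y) \<in> conn ?\<iota>" using V by (simp add: conn_kernel)
  qed
  have c2: "c = 1 \<or> c = 2" by (simp add: c_def)
  have halves: "a = b \<or> a = d \<or> b = d" if "a div 2 = b div 2" "a div 2 = d div 2" for a b d :: nat
  proof -
    have half: "x = y" if "x div 2 = y div 2" "even x \<longleftrightarrow> even y" for x y :: nat
      using that div_mult_mod_eq[of x 2] div_mult_mod_eq[of y 2] by (simp add: mod2_eq_if)
    show ?thesis using half[of a b] half[of a d] half[of b d] that by metis
  qed
  have fibre: "i = j \<or> i = k \<or> j = k" if "g i = g j" "g i = g k" for i j k
  proof (cases "i \<le> q \<or> j \<le> q \<or> k \<le> q")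
    case True
    then show ?thesis using that glow by metis
  next
    case False
    then have e: "(i - Suc q) div c = (j - Suc q) div c" "(i - Suc q) div c = (k - Suc q) div c"
      using that by (auto simp: g_def)
    have "i - Suc q = j - Suc q \<or> i - Suc q = k - Suc q \<or> j - Suc q = k - Suc q"
      using c2 e halves[of "i - Suc q" "j - Suc q" "k - Suc q"] by auto
    then show ?thesis using False by auto
  qed
  have sm: "small_blocks ?\<iota>"
    unfolding small_blocks_def
  proof (intro allI impI)
    fix u v w assume uv: "(u, v) \<in> conn ?\<iota>" "(u, w) \<in> conn ?\<iota>" "u \<noteq> v" "u \<noteq> w"
    then have V: "u \<in> vertices q r" "v \<in> vertices q r" "w \<in> vertices q r"
      and L: "label (\<lambda>x. x) g u = label (\<lambda>x. x) g v" "label (\<lambda>x. x) g u = label (\<lambda>x. x) g w"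
      by (auto simp: conn_kernel)
    then show "v = w"
      using uv(3,4) glow fibre by (elim vertices_cases) (auto, (metis le_trans)+)
  qed
  have ns: "no_singletons q r ?\<iota>" if t
    unfolding no_singletons_def
  proof
    have c: "c = 2" using that by (simp add: c_def)
    fix u assume "u \<in> vertices q r"
    then show "\<exists>v. v \<noteq> u \<and> (u, v) \<in> conn ?\<iota>"
    proof (elim vertices_cases)
      fix x assume x: "u = Upper x" "1 \<le> x" "x \<le> q"
      then show ?thesis using g qr by (intro exI[of _ "Lower x"]) (auto simp: conn_kernel vertices_def)
    next
      fix y assume y: "u = Lower y" "1 \<le> y" "y \<le> r"
      show ?thesis
      proof (cases "y \<le> q")
        case True
        then show ?thesis using g y by (intro exI[of _ "Upper y"]) (auto simp: conn_kernel vertices_def)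
      next
        case False
        define d where "d = y - Suc q"
        have yd: "y = Suc q + d" using False by (simp add: d_def)
        define d' where "d' = (if even d then Suc d else d - 1)"
        have "d' div 2 = d div 2" "d' \<noteq> d" unfolding d'_def by (auto elim: oddE)
        moreover have "Suc q + d' \<le> r"
        proof (cases "even d")
          case True
          have "d + 1 \<noteq> r - q"
          proof
            assume "d + 1 = r - q"
            then have "even (d + 1)" using par[OF that] by metis
            then show False using True by simp
          qed
          then show ?thesis using y yd True by (simp add: d'_def)
        qed (use y yd in \<open>simp add: d'_def\<close>)
        ultimately show ?thesis using y yd c
          by (intro exI[of _ "Lower (Suc q + d')"]) (auto simp: conn_kernel vertices_def g_def)
      qed
    qed
  qed
  have \<iota>: "?\<iota> \<in> diagrams s t q r" using nc sm ns by (simp add: diagrams_def)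
  define \<phi> where "\<phi> u = (case u of Upper x \<Rightarrow> Lower x | Middle x \<Rightarrow> Middle x | Lower x \<Rightarrow> Upper x)" for u
  have img: "\<phi> ` vertices r q = vertices q r"
    by (auto simp: \<phi>_def vertices_def image_Un image_image)
  have lab: "label g (\<lambda>x. x) u = label (\<lambda>x. x) g (\<phi> u)" if "u \<in> vertices r q" for u
    using that by (auto simp: \<phi>_def elim!: vertices_cases)
  have "?\<pi> \<in> diagrams s t r q"
  proof (rule diagrams_pullback[OF \<iota>, of \<phi>, OF _ disjI2])
    show "\<phi> ` vertices r q \<subseteq> vertices q r" using img by simp
    show "boundary_decreasing (vertices r q) \<phi>"
      by (auto simp: \<phi>_def elim!: vertices_cases)
    show "label g (\<lambda>x. x) u = label g (\<lambda>x. x) v \<longleftrightarrow> (\<phi> u, \<phi> v) \<in> conn ?\<iota>"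
      if "u \<in> vertices r q" "v \<in> vertices r q" for u v
      using that lab img by (auto simp: conn_kernel)
    show "v \<in> \<phi> ` vertices r q" if "(\<phi> u, v) \<in> conn ?\<iota>" for u v
      using that img by (auto simp: conn_kernel)
  qed
  moreover have "?\<iota> \<odot> ?\<pi> = identity_partition q"
    unfolding identity_partition_def
    by (rule kernel2_prod) (use g qr in \<open>auto intro!: bexI\<close>)
  ultimately show ?thesis using \<iota> by blast
qed

section \<open>Rank and one-sided inverses\<close>

lemma diagrams_assoc:
  assumes "\<alpha> \<in> diagrams s t m n" "\<beta> \<in> diagrams s t n k" "\<gamma> \<in> diagrams s t k l"
  shows "\<alpha> \<odot> \<beta> \<odot> \<gamma> = \<alpha> \<odot> (\<beta> \<odot> \<gamma>)"
  using assms by (intro prod_assoc diagramsD(1))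

lemma diagrams_rank_le:
  assumes "\<alpha> \<in> diagrams s t m n"
  shows "part_rank \<alpha> \<le> m" "part_rank \<alpha> \<le> n"
  using part_rank_le diagramsD[OF assms] by blast+

text \<open>Split the factor in question through its rank, and use that the middle row bounds the rank.\<close>

lemma diagrams_rank_prod:
  assumes \<alpha>: "\<alpha> \<in> diagrams s t m n" and \<beta>: "\<beta> \<in> diagrams s t n k"
  shows "part_rank (\<alpha> \<odot> \<beta>) \<le> part_rank \<alpha>" "part_rank (\<alpha> \<odot> \<beta>) \<le> part_rank \<beta>"
proof -
  obtain \<alpha>\<^sub>1 \<alpha>\<^sub>2 where a: "\<alpha>\<^sub>1 \<in> diagrams s t m (part_rank \<alpha>)" "\<alpha>\<^sub>2 \<in> diagrams s t (part_rank \<alpha>) n" "\<alpha> = \<alpha>\<^sub>1 \<odot> \<alpha>\<^sub>2"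
    using diagrams_split[OF \<alpha>] by blast
  have "\<alpha> \<odot> \<beta> = \<alpha>\<^sub>1 \<odot> (\<alpha>\<^sub>2 \<odot> \<beta>)" using diagrams_assoc[OF a(1,2) \<beta>] a(3) by simp
  then show "part_rank (\<alpha> \<odot> \<beta>) \<le> part_rank \<alpha>"
    using part_rank_prod_le_middle[OF diagramsD(1)[OF a(1)] diagramsD(1)[OF diagrams_prod[OF a(2) \<beta>]]] by simp
  obtain \<beta>\<^sub>1 \<beta>\<^sub>2 where b: "\<beta>\<^sub>1 \<in> diagrams s t n (part_rank \<beta>)" "\<beta>\<^sub>2 \<in> diagrams s t (part_rank \<beta>) k" "\<beta> = \<beta>\<^sub>1 \<odot> \<beta>\<^sub>2"
    using diagrams_split[OF \<beta>] by blast
  have "\<alpha> \<odot> \<beta> = (\<alpha> \<odot> \<beta>\<^sub>1) \<odot> \<beta>\<^sub>2" using diagrams_assoc[OF \<alpha> b(1,2)] b(3) by simp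
  then show "part_rank (\<alpha> \<odot> \<beta>) \<le> part_rank \<beta>"
    using part_rank_prod_le_middle[OF diagramsD(1)[OF diagrams_prod[OF \<alpha> b(1)]] diagramsD(1)[OF b(2)]] by simp
qed

lemma diagrams_full_rank:
  assumes "\<alpha> \<in> diagrams s t n n" "n \<le> part_rank \<alpha>"
  shows "\<alpha> = identity_partition n"
  using full_rank_identity diagramsD[OF assms(1)] diagrams_rank_le[OF assms(1)] assms(2) le_antisym by blast

lemma diagrams_id_right:
  "\<alpha> \<in> diagrams s t m n \<Longrightarrow> \<alpha> \<odot> identity_partition n = \<alpha>"
  by (rule prod_identity_right[OF diagramsD(1)])

text \<open>Split \<open>\<theta>\<close>; the second factor is an endomorphism of full rank, so it is the identity.\<close>

lemma left_inverse_of_full_rank: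
  assumes \<theta>: "\<theta> \<in> diagrams s t n q" and rank: "q \<le> part_rank \<theta>"
  shows "\<exists>\<tau>\<in>diagrams s t q n. \<tau> \<odot> \<theta> = identity_partition q"
proof -
  have q: "part_rank \<theta> = q" using rank diagrams_rank_le[OF \<theta>] by simp
  obtain \<theta>\<^sub>1 \<theta>\<^sub>2 \<tau> where a: "\<theta>\<^sub>1 \<in> diagrams s t n q" "\<theta>\<^sub>2 \<in> diagrams s t q q" "\<tau> \<in> diagrams s t q n"
    "\<theta> = \<theta>\<^sub>1 \<odot> \<theta>\<^sub>2" "\<tau> \<odot> \<theta>\<^sub>1 = identity_partition q"
    using diagrams_split[OF \<theta>] unfolding q by blast
  have "\<theta>\<^sub>2 = identity_partition q"
    using diagrams_full_rank[OF a(2)] diagrams_rank_prod(2)[OF a(1,2)] a(4) rank by simp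
  then have "\<theta> = \<theta>\<^sub>1" using a(4) diagrams_id_right[OF a(1)] by simp
  then show ?thesis using a by blast
qed

text \<open>Stability: a diagram that loses no rank under left multiplication can be recovered from the product,
since the product with the first factor of its splitting still has full rank, hence a left inverse.\<close>

lemma left_stable:
  assumes \<sigma>: "\<sigma> \<in> diagrams s t n m" and \<alpha>: "\<alpha> \<in> diagrams s t m k"
    and rank: "part_rank \<alpha> \<le> part_rank (\<sigma> \<odot> \<alpha>)"
  shows "\<exists>\<xi>\<in>diagrams s t m n. \<alpha> = \<xi> \<odot> (\<sigma> \<odot> \<alpha>)"
proof -
  define q where "q = part_rank \<alpha>"
  obtain \<alpha>\<^sub>1 \<alpha>\<^sub>2 where a: "\<alpha>\<^sub>1 \<in> diagrams s t m q" "\<alpha>\<^sub>2 \<in> diagrams s t q k" "\<alpha> = \<alpha>\<^sub>1 \<odot> \<alpha>\<^sub>2"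
    using diagrams_split[OF \<alpha>] unfolding q_def by blast
  note \<theta> = diagrams_prod[OF \<sigma> a(1)]
  have eq: "\<sigma> \<odot> \<alpha> = (\<sigma> \<odot> \<alpha>\<^sub>1) \<odot> \<alpha>\<^sub>2" using diagrams_assoc[OF \<sigma> a(1,2)] a(3) by simp
  then have "q \<le> part_rank (\<sigma> \<odot> \<alpha>\<^sub>1)"
    using diagrams_rank_prod(1)[OF \<theta> a(2)] rank by (simp add: q_def)
  from left_inverse_of_full_rank[OF \<theta> this]
  obtain \<tau> where \<tau>: "\<tau> \<in> diagrams s t q n" "\<tau> \<odot> (\<sigma> \<odot> \<alpha>\<^sub>1) = identity_partition q" by blast
  have "(\<alpha>\<^sub>1 \<odot> \<tau>) \<odot> (\<sigma> \<odot> \<alpha>) = ((\<alpha>\<^sub>1 \<odot> \<tau>) \<odot> (\<sigma> \<odot> \<alpha>\<^sub>1)) \<odot> \<alpha>\<^sub>2"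
    unfolding eq using diagrams_assoc[OF diagrams_prod[OF a(1) \<tau>(1)] \<theta> a(2)] by simp
  also have "(\<alpha>\<^sub>1 \<odot> \<tau>) \<odot> (\<sigma> \<odot> \<alpha>\<^sub>1) = \<alpha>\<^sub>1"
    using diagrams_assoc[OF a(1) \<tau>(1) \<theta>] \<tau>(2) diagrams_id_right[OF a(1)] by simp
  finally have "\<alpha> = (\<alpha>\<^sub>1 \<odot> \<tau>) \<odot> (\<sigma> \<odot> \<alpha>)" using a(3) by simp
  then show ?thesis using diagrams_prod[OF a(1) \<tau>(1)] by blast
qed

section \<open>Green's relation J in the sandwich semigroup\<close>

lemma mem_principal_ideal:
  "a \<in> principal_ideal S f b \<longleftrightarrow>
     a = b \<or> (\<exists>x\<in>S. a = f x b) \<or> (\<exists>y\<in>S. a = f b y) \<or> (\<exists>x\<in>S. \<exists>y\<in>S. a = f (f x b) y)"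
  unfolding principal_ideal_def by auto

lemma principal_ideal_self: "a \<in> principal_ideal S f a"
  by (simp add: principal_ideal_def)

lemma principal_ideal_trans:
  assumes sg: "semigroup_on S f" and c: "c \<in> S"
    and ab: "a \<in> principal_ideal S f b" and bc: "b \<in> principal_ideal S f c"
  shows "a \<in> principal_ideal S f c"
proof -
  have cl: "f x y \<in> S" if "x \<in> S" "y \<in> S" for x y using sg that unfolding semigroup_on_def by blast
  have as: "f (f x y) z = f x (f y z)" if "x \<in> S" "y \<in> S" "z \<in> S" for x y z
    using sg that unfolding semigroup_on_def by blast
  have left: "f x d \<in> principal_ideal S f c" if x: "x \<in> S" and d: "d \<in> principal_ideal S f c" for x d
    using d[unfolded mem_principal_ideal]
  proof (elim disjE bexE)
    assume "d = c"
    then show ?thesis unfolding mem_principal_ideal using x by blast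
  next
    fix y assume y: "y \<in> S" "d = f y c"
    then have "f x d = f (f x y) c" using as x c by simp
    then show ?thesis unfolding mem_principal_ideal using cl[OF x y(1)] by blast
  next
    fix y assume y: "y \<in> S" "d = f c y"
    then have "f x d = f (f x c) y" using as x c by simp
    then show ?thesis unfolding mem_principal_ideal using x y(1) by blast
  next
    fix y z assume y: "y \<in> S" "z \<in> S" "d = f (f y c) z"
    then have "f x d = f (f (f x y) c) z" using as[of x "f y c" z] as[of x y c] x c cl by simp
    then show ?thesis unfolding mem_principal_ideal using cl[OF x y(1)] y(2) by blast
  qed
  have right: "f d x \<in> principal_ideal S f c" if x: "x \<in> S" and d: "d \<in> principal_ideal S f c" for x d
    using d[unfolded mem_principal_ideal]
  proof (elim disjE bexE)
    assume "d = c"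
    then show ?thesis unfolding mem_principal_ideal using x by blast
  next
    fix y assume y: "y \<in> S" "d = f y c"
    then show ?thesis unfolding mem_principal_ideal using x by blast
  next
    fix y assume y: "y \<in> S" "d = f c y"
    then have "f d x = f c (f y x)" using as x c by simp
    then show ?thesis unfolding mem_principal_ideal using cl[OF y(1) x] by blast
  next
    fix y z assume y: "y \<in> S" "z \<in> S" "d = f (f y c) z"
    then have "f d x = f (f y c) (f z x)" using as[of "f y c" z x] x c cl by simp
    then show ?thesis unfolding mem_principal_ideal using cl[OF y(2) x] y(1) by blast
  qed
  show ?thesis
    using ab[unfolded mem_principal_ideal] left right bc by blast
qed

lemma J_class_cases:
  assumes "C \<in> J_classes S f"
  obtains a where "a \<in> S" "C = {b \<in> S. principal_ideal S f a = principal_ideal S f b}"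
  using assms unfolding J_classes_def green_J_def quotient_def by auto

lemma J_class_of:
  "a \<in> S \<Longrightarrow> {b \<in> S. principal_ideal S f a = principal_ideal S f b} \<in> J_classes S f"
  unfolding J_classes_def green_J_def quotient_def by auto

lemma J_class_eq_iff:
  assumes "semigroup_on S f" "a \<in> S" "b \<in> S"
  shows "principal_ideal S f a = principal_ideal S f b \<longleftrightarrow>
    a \<in> principal_ideal S f b \<and> b \<in> principal_ideal S f a"
  using principal_ideal_trans[OF assms(1)] principal_ideal_self assms(2,3) by (metis subsetI subset_antisym)

text \<open>Here \<open>V\<close> is the set of inverses of \<open>\<sigma>\<close>, and \<open>\<epsilon>\<close> is one of them, built from the one-sided inverses of a
splitting \<open>\<sigma> = \<sigma>\<^sub>1\<sigma>\<^sub>2\<close>. The facts \<open>above\<close>, \<open>below\<close> and \<open>below'\<close> locate \<open>V\<close> in the order of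
principal ideals.\<close>

lemma sandwich_J_classes:
  fixes s t :: bool and m n r :: nat and \<sigma> :: "vertex set set"
  assumes \<sigma>: "\<sigma> \<in> diagrams s t n m" and r: "r = part_rank \<sigma>"
  defines "S \<equiv> diagrams s t m n"
  shows "trivial_maximal_J_classes S \<sigma> = {{\<alpha>} | \<alpha>. \<alpha> \<in> S \<and> part_rank \<alpha> > r}"
    and "nontrivial_maximal_J_classes S \<sigma> \<noteq> {} \<longleftrightarrow> pre_inverses S \<sigma> \<subseteq> rank_class r S"
    and "pre_inverses S \<sigma> \<subseteq> rank_class r S \<longleftrightarrow> pre_inverses S \<sigma> = inverses S \<sigma>"
    and "nontrivial_maximal_J_classes S \<sigma> \<noteq> {} \<Longrightarrow>
      nontrivial_maximal_J_classes S \<sigma> = {regular_rank_class S \<sigma> r}"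
    and "r = n \<Longrightarrow> maximum_J_class S (sandwich \<sigma>) (regular_rank_class S \<sigma> r)"
    and "r = n \<Longrightarrow> left_zero_semigroup (regular_rank_class S \<sigma> r) (sandwich \<sigma>)"
proof -
  let ?f = "sandwich \<sigma>" and ?I = "principal_ideal S (sandwich \<sigma>)"
  define V where "V = inverses S \<sigma>"
  have as1: "\<alpha> \<odot> \<sigma> \<odot> \<beta> = \<alpha> \<odot> (\<sigma> \<odot> \<beta>)" if "\<alpha> \<in> S" "\<beta> \<in> S" for \<alpha> \<beta>
    using diagrams_assoc[OF _ \<sigma>] that unfolding S_def by blast
  have as2: "\<sigma> \<odot> \<alpha> \<odot> \<sigma> = \<sigma> \<odot> (\<alpha> \<odot> \<sigma>)" if "\<alpha> \<in> S" for \<alpha>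
    using diagrams_assoc[OF \<sigma> _ \<sigma>] that unfolding S_def by blast
  have S\<sigma>: "\<alpha> \<odot> \<sigma> \<in> diagrams s t m m" "\<sigma> \<odot> \<alpha> \<in> diagrams s t n n" if "\<alpha> \<in> S" for \<alpha>
    using diagrams_prod \<sigma> that unfolding S_def by blast+
  have S\<sigma>S: "\<alpha> \<odot> \<sigma> \<odot> \<beta> \<in> S" if "\<alpha> \<in> S" "\<beta> \<in> S" for \<alpha> \<beta>
    using diagrams_prod[OF S\<sigma>(1)] that unfolding S_def by blast
  have \<sigma>S\<sigma>: "\<sigma> \<odot> \<alpha> \<odot> \<sigma> \<in> diagrams s t n m" if "\<alpha> \<in> S" for \<alpha>
    using diagrams_prod[OF S\<sigma>(2)[OF that] \<sigma>] .
  have as3: "\<alpha> \<odot> \<sigma> \<odot> \<beta> \<odot> \<sigma> = \<alpha> \<odot> \<sigma> \<odot> (\<beta> \<odot> \<sigma>)" if "\<alpha> \<in> S" "\<beta> \<in> S" for \<alpha> \<beta>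
    using diagrams_assoc[OF S\<sigma>(1)[OF that(1)] _ \<sigma>] that(2) unfolding S_def by blast
  have sg: "semigroup_on S ?f"
    unfolding semigroup_on_def sandwich_def
  proof (intro conjI ballI S\<sigma>S)
    fix x y z assume xyz: "x \<in> S" "y \<in> S" "z \<in> S"
    have "x \<odot> \<sigma> \<odot> y \<odot> \<sigma> \<odot> z = x \<odot> \<sigma> \<odot> (y \<odot> \<sigma>) \<odot> z" using as3 xyz by simp
    also have "\<dots> = x \<odot> \<sigma> \<odot> (y \<odot> \<sigma> \<odot> z)"
      using diagrams_assoc[OF S\<sigma>(1)[OF xyz(1)] S\<sigma>(1)[OF xyz(2)]] xyz(3) unfolding S_def by blast
    finally show "x \<odot> \<sigma> \<odot> y \<odot> \<sigma> \<odot> z = x \<odot> \<sigma> \<odot> (y \<odot> \<sigma> \<odot> z)" .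
  qed
  have fas: "?f (?f x y) z = ?f x (?f y z)" if "x \<in> S" "y \<in> S" "z \<in> S" for x y z
    using sg that unfolding semigroup_on_def by blast
  have fcl: "?f x y \<in> S" if "x \<in> S" "y \<in> S" for x y
    using sg that unfolding semigroup_on_def by blast
  have \<sigma>f: "\<sigma> \<odot> ?f x y \<odot> \<sigma> = \<sigma> \<odot> x \<odot> \<sigma> \<odot> y \<odot> \<sigma>" if xy: "x \<in> S" "y \<in> S" for x y
  proof -
    have "\<sigma> \<odot> ?f x y = \<sigma> \<odot> (x \<odot> (\<sigma> \<odot> y))" using as1 xy by (simp add: sandwich_def)
    also have "\<dots> = \<sigma> \<odot> x \<odot> (\<sigma> \<odot> y)"
      using diagrams_assoc[OF \<sigma> _ S\<sigma>(2)[OF xy(2)]] xy(1) unfolding S_def by simp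
    also have "\<dots> = \<sigma> \<odot> x \<odot> \<sigma> \<odot> y"
      using diagrams_assoc[OF S\<sigma>(2)[OF xy(1)] \<sigma>] xy(2) unfolding S_def by simp
    finally show ?thesis by simp
  qed
  have rf: "part_rank (\<sigma> \<odot> x \<odot> \<sigma> \<odot> y \<odot> \<sigma>) \<le> part_rank (\<sigma> \<odot> x \<odot> \<sigma>)"
    "part_rank (\<sigma> \<odot> x \<odot> \<sigma> \<odot> y \<odot> \<sigma>) \<le> part_rank (\<sigma> \<odot> y \<odot> \<sigma>)" if xy: "x \<in> S" "y \<in> S" for x y
  proof -
    have xy': "x \<in> diagrams s t m n" "y \<in> diagrams s t m n" using xy by (auto simp: S_def)
    have "\<sigma> \<odot> x \<odot> \<sigma> \<odot> y \<odot> \<sigma> = (\<sigma> \<odot> x \<odot> \<sigma>) \<odot> (y \<odot> \<sigma>)"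
      using diagrams_assoc[OF \<sigma>S\<sigma>[OF xy(1)] xy'(2) \<sigma>] .
    then show "part_rank (\<sigma> \<odot> x \<odot> \<sigma> \<odot> y \<odot> \<sigma>) \<le> part_rank (\<sigma> \<odot> x \<odot> \<sigma>)"
      using diagrams_rank_prod(1)[OF \<sigma>S\<sigma>[OF xy(1)] S\<sigma>(1)[OF xy(2)]] by simp
    have "\<sigma> \<odot> x \<odot> \<sigma> \<odot> y \<odot> \<sigma> = (\<sigma> \<odot> x) \<odot> (\<sigma> \<odot> y) \<odot> \<sigma>"
      using diagrams_assoc[OF S\<sigma>(2)[OF xy(1)] \<sigma> xy'(2)] by simp
    also have "\<dots> = (\<sigma> \<odot> x) \<odot> (\<sigma> \<odot> y \<odot> \<sigma>)"
      using diagrams_assoc[OF S\<sigma>(2)[OF xy(1)] S\<sigma>(2)[OF xy(2)] \<sigma>] .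
    finally show "part_rank (\<sigma> \<odot> x \<odot> \<sigma> \<odot> y \<odot> \<sigma>) \<le> part_rank (\<sigma> \<odot> y \<odot> \<sigma>)"
      using diagrams_rank_prod(2)[OF S\<sigma>(2)[OF xy(1)] \<sigma>S\<sigma>[OF xy(2)]] by simp
  qed
  obtain \<sigma>\<^sub>1 \<sigma>\<^sub>2 \<tau>\<^sub>1 \<tau>\<^sub>2 where sp: "\<sigma>\<^sub>1 \<in> diagrams s t n r" "\<sigma>\<^sub>2 \<in> diagrams s t r m"
    "\<tau>\<^sub>1 \<in> diagrams s t r n" "\<tau>\<^sub>2 \<in> diagrams s t m r" "\<sigma> = \<sigma>\<^sub>1 \<odot> \<sigma>\<^sub>2"
    "\<tau>\<^sub>1 \<odot> \<sigma>\<^sub>1 = identity_partition r" "\<sigma>\<^sub>2 \<odot> \<tau>\<^sub>2 = identity_partition r"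
    using diagrams_split[OF \<sigma>] unfolding r[symmetric] by blast
  define \<epsilon> where "\<epsilon> = \<tau>\<^sub>2 \<odot> \<tau>\<^sub>1"
  have \<epsilon>S: "\<epsilon> \<in> S" unfolding \<epsilon>_def S_def by (rule diagrams_prod[OF sp(4,3)])
  have \<sigma>\<tau>: "\<sigma> \<odot> \<tau>\<^sub>2 = \<sigma>\<^sub>1"
    unfolding sp(5) diagrams_assoc[OF sp(1,2,4)] sp(7) by (rule diagrams_id_right[OF sp(1)])
  have \<sigma>\<epsilon>: "\<sigma> \<odot> \<epsilon> = \<sigma>\<^sub>1 \<odot> \<tau>\<^sub>1"
    unfolding \<epsilon>_def diagrams_assoc[OF \<sigma> sp(4,3), symmetric] \<sigma>\<tau> ..
  have \<sigma>\<epsilon>\<sigma>\<^sub>1: "\<sigma>\<^sub>1 \<odot> \<tau>\<^sub>1 \<odot> \<sigma>\<^sub>1 = \<sigma>\<^sub>1"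
    unfolding diagrams_assoc[OF sp(1,3,1)] sp(6) by (rule diagrams_id_right[OF sp(1)])
  have "\<sigma> \<odot> \<epsilon> \<odot> \<sigma> = \<sigma>"
  proof -
    have "\<sigma> \<odot> \<epsilon> \<odot> \<sigma> = \<sigma>\<^sub>1 \<odot> \<tau>\<^sub>1 \<odot> \<sigma>\<^sub>1 \<odot> \<sigma>\<^sub>2"
      unfolding \<sigma>\<epsilon> using diagrams_assoc[OF diagrams_prod[OF sp(1,3)] sp(1,2)] sp(5) by simp
    then show ?thesis unfolding \<sigma>\<epsilon>\<sigma>\<^sub>1 sp(5)[symmetric] .
  qed
  moreover have "\<epsilon> \<odot> \<sigma> \<odot> \<epsilon> = \<epsilon>"
  proof -
    have "\<epsilon> \<odot> \<sigma> \<odot> \<epsilon> = \<tau>\<^sub>2 \<odot> \<tau>\<^sub>1 \<odot> \<sigma>\<^sub>1 \<odot> \<tau>\<^sub>1"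
      unfolding as1[OF \<epsilon>S \<epsilon>S] \<sigma>\<epsilon> unfolding \<epsilon>_def
      using diagrams_assoc[OF diagrams_prod[OF sp(4,3)] sp(1,3)] by simp
    also have "\<tau>\<^sub>2 \<odot> \<tau>\<^sub>1 \<odot> \<sigma>\<^sub>1 = \<tau>\<^sub>2"
      unfolding diagrams_assoc[OF sp(4,3,1)] sp(6) by (rule diagrams_id_right[OF sp(4)])
    finally show ?thesis unfolding \<epsilon>_def .
  qed
  ultimately have \<epsilon>V: "\<epsilon> \<in> V" using \<epsilon>S by (simp add: V_def inverses_def)
  have V: "\<alpha> \<in> V \<longleftrightarrow> \<alpha> \<in> S \<and> \<sigma> \<odot> \<alpha> \<odot> \<sigma> = \<sigma> \<and> \<alpha> \<odot> \<sigma> \<odot> \<alpha> = \<alpha>" for \<alpha>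
    by (auto simp: V_def inverses_def)
  have VS: "V \<subseteq> S" using V by blast
  have Pre: "\<alpha> \<in> pre_inverses S \<sigma> \<longleftrightarrow> \<alpha> \<in> S \<and> \<sigma> \<odot> \<alpha> \<odot> \<sigma> = \<sigma>" for \<alpha>
    by (auto simp: pre_inverses_def)
  (* The middle factor \<sigma>\<^sub>2 \<beta> \<sigma>\<^sub>1 is an endomorphism of r of rank r, hence the identity. *)
  have full: "\<sigma> \<odot> \<beta> \<odot> \<sigma> = \<sigma>" if \<beta>: "\<beta> \<in> S" and rank: "r \<le> part_rank (\<sigma> \<odot> \<beta> \<odot> \<sigma>)" for \<beta>
  proof -
    have \<beta>': "\<beta> \<in> diagrams s t m n" using \<beta> by (simp add: S_def)
    note mid1 = diagrams_prod[OF sp(2) \<beta>']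
    note mid = diagrams_prod[OF mid1 sp(1)]
    have "\<sigma> \<odot> \<beta> \<odot> \<sigma> = \<sigma>\<^sub>1 \<odot> (\<sigma>\<^sub>2 \<odot> \<beta>) \<odot> \<sigma>"
      using diagrams_assoc[OF sp(1,2) \<beta>'] sp(5) by simp
    also have "\<dots> = \<sigma>\<^sub>1 \<odot> (\<sigma>\<^sub>2 \<odot> \<beta>) \<odot> \<sigma>\<^sub>1 \<odot> \<sigma>\<^sub>2"
      using diagrams_assoc[OF diagrams_prod[OF sp(1) mid1] sp(1,2)] sp(5) by simp
    also have "\<sigma>\<^sub>1 \<odot> (\<sigma>\<^sub>2 \<odot> \<beta>) \<odot> \<sigma>\<^sub>1 = \<sigma>\<^sub>1 \<odot> (\<sigma>\<^sub>2 \<odot> \<beta> \<odot> \<sigma>\<^sub>1)"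
      using diagrams_assoc[OF sp(1) mid1 sp(1)] .
    finally have eq: "\<sigma> \<odot> \<beta> \<odot> \<sigma> = \<sigma>\<^sub>1 \<odot> (\<sigma>\<^sub>2 \<odot> \<beta> \<odot> \<sigma>\<^sub>1) \<odot> \<sigma>\<^sub>2" .
    have "r \<le> part_rank (\<sigma>\<^sub>2 \<odot> \<beta> \<odot> \<sigma>\<^sub>1)"
      using rank diagrams_rank_prod(1)[OF diagrams_prod[OF sp(1) mid] sp(2)]
        diagrams_rank_prod(2)[OF sp(1) mid] eq by simp
    from diagrams_full_rank[OF mid this] show ?thesis
      unfolding eq using diagrams_id_right[OF sp(1)] sp(5) by simp
  qed
  have rank_ge: "r \<le> part_rank \<alpha>" "r \<le> part_rank (\<sigma> \<odot> \<alpha>)" if "\<alpha> \<in> S" "\<sigma> \<odot> \<alpha> \<odot> \<sigma> = \<sigma>" for \<alpha>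
  proof -
    show "r \<le> part_rank (\<sigma> \<odot> \<alpha>)" using diagrams_rank_prod(1)[OF S\<sigma>(2)[OF that(1)] \<sigma>] that(2) r by simp
    also have "\<dots> \<le> part_rank \<alpha>" using diagrams_rank_prod(2)[OF \<sigma>] that(1) unfolding S_def by blast
    finally show "r \<le> part_rank \<alpha>" .
  qed
  have rank_ideal: "part_rank (\<gamma> \<odot> \<sigma> \<odot> \<delta>) \<le> r" if "\<gamma> \<in> S" "\<delta> \<in> S" for \<gamma> \<delta>
  proof -
    have "part_rank (\<gamma> \<odot> \<sigma> \<odot> \<delta>) \<le> part_rank (\<gamma> \<odot> \<sigma>)"
      using diagrams_rank_prod(1)[OF S\<sigma>(1)[OF that(1)]] that(2) unfolding S_def by blast
    also have "\<dots> \<le> r" using diagrams_rank_prod(2)[OF _ \<sigma>] that(1) r unfolding S_def by blast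
    finally show ?thesis .
  qed
  have Vrank: "part_rank \<alpha> = r" if "\<alpha> \<in> V" for \<alpha>
    using rank_ge(1)[of \<alpha>] rank_ideal[of \<alpha> \<alpha>] that by (simp add: V)
  have PreV: "\<alpha> \<in> V" if \<alpha>: "\<alpha> \<in> S" "\<sigma> \<odot> \<alpha> \<odot> \<sigma> = \<sigma>" "part_rank \<alpha> \<le> r" for \<alpha>
  proof -
    have \<alpha>': "\<alpha> \<in> diagrams s t m n" using \<alpha>(1) by (simp add: S_def)
    have "part_rank \<alpha> \<le> part_rank (\<sigma> \<odot> \<alpha>)" using rank_ge(2)[OF \<alpha>(1,2)] \<alpha>(3) by simp
    from left_stable[OF \<sigma> \<alpha>' this] obtain \<xi> where \<xi>: "\<xi> \<in> diagrams s t m n" "\<alpha> = \<xi> \<odot> (\<sigma> \<odot> \<alpha>)" by blast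
    have "\<alpha> \<odot> \<sigma> = \<xi> \<odot> \<sigma>"
      using diagrams_assoc[OF \<xi>(1) S\<sigma>(2)[OF \<alpha>(1)] \<sigma>] \<xi>(2) \<alpha>(2) by simp
    then have "\<alpha> \<odot> \<sigma> \<odot> \<alpha> = \<alpha>"
      using diagrams_assoc[OF \<xi>(1) \<sigma> \<alpha>'] \<xi>(2) by simp
    then show ?thesis using \<alpha> V by blast
  qed
  (* Regularity supplies enough rank for left stability, and then for the fact full. *)
  have DV: "regular_rank_class S \<sigma> r = V"
  proof
    show "V \<subseteq> regular_rank_class S \<sigma> r"
    proof
      fix \<alpha> assume \<alpha>: "\<alpha> \<in> V"
      then have "?f (?f \<alpha> \<alpha>) \<alpha> = \<alpha>" "\<alpha> \<in> S" by (auto simp: V sandwich_def)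
      then show "\<alpha> \<in> regular_rank_class S \<sigma> r"
        using Vrank[OF \<alpha>] unfolding regular_rank_class_def regular_elements_def
        by (auto intro!: bexI[of _ \<alpha>])
    qed
    show "regular_rank_class S \<sigma> r \<subseteq> V"
    proof
      fix \<alpha> assume "\<alpha> \<in> regular_rank_class S \<sigma> r"
      then obtain \<xi> where \<alpha>: "\<alpha> \<in> S" "part_rank \<alpha> = r" and \<xi>: "\<xi> \<in> S" "\<alpha> = ?f (?f \<alpha> \<xi>) \<alpha>"
        unfolding regular_rank_class_def regular_elements_def by blast
      have \<alpha>': "\<alpha> \<in> diagrams s t m n" using \<alpha>(1) by (simp add: S_def)
      have "\<alpha> = ?f \<alpha> \<xi> \<odot> (\<sigma> \<odot> \<alpha>)"
        using \<xi> as1[OF fcl[OF \<alpha>(1) \<xi>(1)] \<alpha>(1)] by (simp add: sandwich_def)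
      then have 1: "part_rank \<alpha> \<le> part_rank (\<sigma> \<odot> \<alpha>)"
        using diagrams_rank_prod(2)[OF _ S\<sigma>(2)[OF \<alpha>(1)]] fcl[OF \<alpha>(1) \<xi>(1)] unfolding S_def by metis
      have "\<alpha> = \<alpha> \<odot> \<sigma> \<odot> ?f \<xi> \<alpha>"
        using \<xi> fas[OF \<alpha>(1) \<xi>(1) \<alpha>(1)] by (simp add: sandwich_def)
      then have 2: "part_rank \<alpha> \<le> part_rank (\<alpha> \<odot> \<sigma>)"
        using diagrams_rank_prod(1)[OF S\<sigma>(1)[OF \<alpha>(1)]] fcl[OF \<xi>(1) \<alpha>(1)] unfolding S_def by metis
      from left_stable[OF \<sigma> \<alpha>' 1] obtain \<zeta> where \<zeta>: "\<zeta> \<in> diagrams s t m n" "\<alpha> = \<zeta> \<odot> (\<sigma> \<odot> \<alpha>)" by blast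
      have "\<alpha> \<odot> \<sigma> = \<zeta> \<odot> (\<sigma> \<odot> \<alpha> \<odot> \<sigma>)"
        using diagrams_assoc[OF \<zeta>(1) S\<sigma>(2)[OF \<alpha>(1)] \<sigma>] \<zeta>(2) by simp
      then have "r \<le> part_rank (\<sigma> \<odot> \<alpha> \<odot> \<sigma>)"
        using diagrams_rank_prod(2)[OF \<zeta>(1) \<sigma>S\<sigma>[OF \<alpha>(1)]] 2 \<alpha>(2) by simp
      from PreV[OF \<alpha>(1) full[OF \<alpha>(1) this]] show "\<alpha> \<in> V" using \<alpha>(2) by simp
    qed
  qed
  have above: "\<sigma> \<odot> \<beta> \<odot> \<sigma> = \<sigma>" if \<alpha>: "\<alpha> \<in> V" and \<beta>: "\<beta> \<in> S" and le: "\<alpha> \<in> ?I \<beta>" for \<alpha> \<beta>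
  proof (rule full[OF \<beta>])
    have "r = part_rank (\<sigma> \<odot> \<alpha> \<odot> \<sigma>)" using \<alpha> r by (simp add: V)
    also from le have "\<dots> \<le> part_rank (\<sigma> \<odot> \<beta> \<odot> \<sigma>)"
      unfolding mem_principal_ideal
    proof (elim disjE bexE)
      fix x y assume x: "x \<in> S" "y \<in> S" "\<alpha> = ?f (?f x \<beta>) y"
      have "part_rank (\<sigma> \<odot> ?f (?f x \<beta>) y \<odot> \<sigma>) \<le> part_rank (\<sigma> \<odot> ?f x \<beta> \<odot> \<sigma>)"
        using \<sigma>f[OF fcl[OF x(1) \<beta>] x(2)] rf(1)[OF fcl[OF x(1) \<beta>] x(2)] by simp
      also have "\<dots> \<le> part_rank (\<sigma> \<odot> \<beta> \<odot> \<sigma>)" using \<sigma>f[OF x(1) \<beta>] rf(2)[OF x(1) \<beta>] by simp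
      finally show ?thesis using x by simp
    qed (use \<sigma>f rf \<beta> in auto)
    finally show "r \<le> part_rank (\<sigma> \<odot> \<beta> \<odot> \<sigma>)" .
  qed
  have below: "\<alpha> \<in> ?I \<beta>" if \<alpha>: "\<alpha> \<in> V" and \<beta>: "\<beta> \<in> S" "\<sigma> \<odot> \<beta> \<odot> \<sigma> = \<sigma>" for \<alpha> \<beta>
  proof -
    have \<alpha>': "\<alpha> \<in> diagrams s t m n" "\<alpha> \<in> S" using \<alpha> VS by (auto simp: S_def)
    have "?f (?f \<alpha> \<beta>) \<alpha> = \<alpha> \<odot> (\<sigma> \<odot> \<beta>) \<odot> \<sigma> \<odot> \<alpha>"
      using as1[OF \<alpha>'(2) \<beta>(1)] by (simp add: sandwich_def)
    also have "\<alpha> \<odot> (\<sigma> \<odot> \<beta>) \<odot> \<sigma> = \<alpha> \<odot> \<sigma>"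
      using diagrams_assoc[OF \<alpha>'(1) S\<sigma>(2)[OF \<beta>(1)] \<sigma>] \<beta>(2) by simp
    finally have "\<alpha> = ?f (?f \<alpha> \<beta>) \<alpha>" using \<alpha> by (simp add: V)
    then show ?thesis unfolding mem_principal_ideal using \<alpha>'(2) by blast
  qed
  have below': "\<gamma> \<odot> \<sigma> \<odot> \<delta> \<in> ?I \<alpha>" if \<alpha>: "\<alpha> \<in> V" and \<gamma>\<delta>: "\<gamma> \<in> S" "\<delta> \<in> S" for \<alpha> \<gamma> \<delta>
  proof -
    have \<gamma>: "\<gamma> \<in> diagrams s t m n" "\<alpha> \<in> S" using \<alpha> \<gamma>\<delta> VS by (auto simp: S_def)
    have "?f (?f \<gamma> \<alpha>) \<delta> = \<gamma> \<odot> (\<sigma> \<odot> \<alpha>) \<odot> \<sigma> \<odot> \<delta>"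
      using as1[OF \<gamma>\<delta>(1) \<gamma>(2)] by (simp add: sandwich_def)
    also have "\<gamma> \<odot> (\<sigma> \<odot> \<alpha>) \<odot> \<sigma> = \<gamma> \<odot> \<sigma>"
      using diagrams_assoc[OF \<gamma>(1) S\<sigma>(2)[OF \<gamma>(2)] \<sigma>] \<alpha> by (simp add: V)
    finally show ?thesis unfolding mem_principal_ideal using \<gamma>\<delta> by metis
  qed
  have classV: "{\<beta> \<in> S. ?I \<alpha> = ?I \<beta>} = V" if \<alpha>: "\<alpha> \<in> V" for \<alpha>
  proof (intro equalityI subsetI)
    fix \<beta> assume "\<beta> \<in> {\<beta> \<in> S. ?I \<alpha> = ?I \<beta>}"
    then have \<beta>: "\<beta> \<in> S" "\<alpha> \<in> ?I \<beta>" "\<beta> \<in> ?I \<alpha>" using principal_ideal_self[of \<alpha>] principal_ideal_self[of \<beta>] by auto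
    have \<alpha>S: "\<alpha> \<in> S" using \<alpha> VS by blast
    have "part_rank \<beta> \<le> r"
      using \<beta>(3) unfolding mem_principal_ideal
    proof (elim disjE bexE)
      fix x y assume "x \<in> S" "y \<in> S" "\<beta> = ?f (?f x \<alpha>) y"
      then show ?thesis using rank_ideal[OF fcl[of x \<alpha>], of y] \<alpha>S by (simp add: sandwich_def)
    qed (use Vrank[OF \<alpha>] rank_ideal \<alpha>S in \<open>auto simp: sandwich_def\<close>)
    then show "\<beta> \<in> V" using PreV \<beta>(1) above[OF \<alpha> \<beta>(1,2)] by blast
  next
    fix \<beta> assume \<beta>: "\<beta> \<in> V"
    then have "\<alpha> \<in> ?I \<beta>" "\<beta> \<in> ?I \<alpha>" using below \<alpha> V by blast+
    then show "\<beta> \<in> {\<beta> \<in> S. ?I \<alpha> = ?I \<beta>}"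
      using J_class_eq_iff[OF sg] \<alpha> \<beta> VS by blast
  qed
  have VJ: "V \<in> J_classes S ?f"
    using J_class_of[of \<epsilon> S ?f] classV[OF \<epsilon>V] \<epsilon>S by simp
  have meets: "D = V" if D: "D \<in> J_classes S ?f" and \<alpha>: "\<alpha> \<in> D" "\<alpha> \<in> V" for D \<alpha>
  proof -
    obtain \<beta> where \<beta>: "\<beta> \<in> S" "D = {\<gamma> \<in> S. ?I \<beta> = ?I \<gamma>}" using J_class_cases[OF D] by blast
    then have "?I \<beta> = ?I \<alpha>" using \<alpha>(1) by blast
    then show ?thesis using classV[OF \<alpha>(2)] \<beta>(2) by simp
  qed
  have outside: "\<alpha> = \<beta>" if out: "\<not> (\<exists>\<gamma>\<in>S. \<exists>\<delta>\<in>S. \<alpha> = \<gamma> \<odot> \<sigma> \<odot> \<delta>)" and \<beta>: "\<beta> \<in> S" and le: "\<alpha> \<in> ?I \<beta>" for \<alpha> \<beta>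
    using le unfolding mem_principal_ideal
  proof (elim disjE bexE)
    fix x y assume "x \<in> S" "y \<in> S" "\<alpha> = ?f (?f x \<beta>) y"
    then show ?thesis using out fcl[of x \<beta>] \<beta> unfolding sandwich_def by blast
  qed (use out \<beta> in \<open>auto simp: sandwich_def\<close>)
  have outside_class: "{\<beta> \<in> S. ?I \<alpha> = ?I \<beta>} = {\<alpha>}"
    if out: "\<not> (\<exists>\<gamma>\<in>S. \<exists>\<delta>\<in>S. \<alpha> = \<gamma> \<odot> \<sigma> \<odot> \<delta>)" and \<alpha>: "\<alpha> \<in> S" for \<alpha>
    using outside[OF out] principal_ideal_self[of \<alpha> S ?f] \<alpha> by auto
  have ideal: "(\<exists>\<gamma>\<in>S. \<exists>\<delta>\<in>S. \<alpha> = \<gamma> \<odot> \<sigma> \<odot> \<delta>) \<longleftrightarrow> part_rank \<alpha> \<le> r" if \<alpha>: "\<alpha> \<in> S" for \<alpha>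
  proof
    assume "\<exists>\<gamma>\<in>S. \<exists>\<delta>\<in>S. \<alpha> = \<gamma> \<odot> \<sigma> \<odot> \<delta>"
    then show "part_rank \<alpha> \<le> r" using rank_ideal by blast
  next
    assume le: "part_rank \<alpha> \<le> r"
    have \<alpha>': "\<alpha> \<in> diagrams s t m n" using \<alpha> by (simp add: S_def)
    define q where "q = part_rank \<alpha>"
    obtain \<alpha>\<^sub>1 \<alpha>\<^sub>2 where a: "\<alpha>\<^sub>1 \<in> diagrams s t m q" "\<alpha>\<^sub>2 \<in> diagrams s t q n" "\<alpha> = \<alpha>\<^sub>1 \<odot> \<alpha>\<^sub>2"
      using diagrams_split[OF \<alpha>'] unfolding q_def by blast
    have "even (r - q)" if t
    proof -
      have par: "even (part_rank \<beta>) \<longleftrightarrow> even l" if "\<beta> \<in> diagrams s t k l" for \<beta> k l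
        using part_rank_parity small_blocks_iff(2) diagramsD[OF that] \<open>t\<close> by blast
      have \<epsilon>': "even (part_rank \<epsilon>) \<longleftrightarrow> even n" using par \<epsilon>S unfolding S_def by blast
      show ?thesis using par[OF \<alpha>'] \<epsilon>' Vrank[OF \<epsilon>V] le unfolding q_def by auto
    qed
    from diagrams_ladder[OF le[folded q_def] this]
    obtain \<iota> \<pi> where ip: "\<iota> \<in> diagrams s t q r" "\<pi> \<in> diagrams s t r q" "\<iota> \<odot> \<pi> = identity_partition q" by blast
    define \<gamma> \<delta> where "\<gamma> = \<alpha>\<^sub>1 \<odot> (\<iota> \<odot> \<tau>\<^sub>1)" and "\<delta> = \<tau>\<^sub>2 \<odot> (\<pi> \<odot> \<alpha>\<^sub>2)"
    note \<iota>\<tau> = diagrams_prod[OF ip(1) sp(3)] and \<pi>\<alpha> = diagrams_prod[OF ip(2) a(2)]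
    have \<gamma>: "\<gamma> \<in> diagrams s t m n" and \<delta>: "\<delta> \<in> diagrams s t m n"
      unfolding \<gamma>_def \<delta>_def by (rule diagrams_prod[OF a(1) \<iota>\<tau>], rule diagrams_prod[OF sp(4) \<pi>\<alpha>])
    have \<sigma>\<delta>: "\<sigma> \<odot> \<delta> = \<sigma>\<^sub>1 \<odot> (\<pi> \<odot> \<alpha>\<^sub>2)"
      unfolding \<delta>_def using diagrams_assoc[OF \<sigma> sp(4) \<pi>\<alpha>] \<sigma>\<tau> by simp
    have \<iota>\<tau>\<sigma>: "\<iota> \<odot> \<tau>\<^sub>1 \<odot> \<sigma>\<^sub>1 = \<iota>"
      using diagrams_assoc[OF ip(1) sp(3,1)] sp(6) diagrams_id_right[OF ip(1)] by simp
    have "\<gamma> \<odot> \<sigma> \<odot> \<delta> = \<gamma> \<odot> (\<sigma>\<^sub>1 \<odot> (\<pi> \<odot> \<alpha>\<^sub>2))"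
      using diagrams_assoc[OF \<gamma> \<sigma> \<delta>] \<sigma>\<delta> by simp
    also have "\<dots> = \<gamma> \<odot> \<sigma>\<^sub>1 \<odot> (\<pi> \<odot> \<alpha>\<^sub>2)"
      using diagrams_assoc[OF \<gamma> sp(1) \<pi>\<alpha>] by simp
    also have "\<gamma> \<odot> \<sigma>\<^sub>1 = \<alpha>\<^sub>1 \<odot> \<iota>"
      unfolding \<gamma>_def using diagrams_assoc[OF a(1) \<iota>\<tau> sp(1)] \<iota>\<tau>\<sigma> by simp
    also have "\<alpha>\<^sub>1 \<odot> \<iota> \<odot> (\<pi> \<odot> \<alpha>\<^sub>2) = \<alpha>\<^sub>1 \<odot> \<iota> \<odot> \<pi> \<odot> \<alpha>\<^sub>2"
      using diagrams_assoc[OF diagrams_prod[OF a(1) ip(1)] ip(2) a(2)] by simp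
    also have "\<alpha>\<^sub>1 \<odot> \<iota> \<odot> \<pi> = \<alpha>\<^sub>1"
      using diagrams_assoc[OF a(1) ip(1,2)] ip(3) diagrams_id_right[OF a(1)] by simp
    finally have "\<alpha> = \<gamma> \<odot> \<sigma> \<odot> \<delta>" using a(3) by simp
    then show "\<exists>\<gamma>\<in>S. \<exists>\<delta>\<in>S. \<alpha> = \<gamma> \<odot> \<sigma> \<odot> \<delta>" using \<gamma> \<delta> unfolding S_def by blast
  qed
  have triv: "{\<alpha>} \<in> maximal_J_classes S ?f"
    if out: "\<not> (\<exists>\<gamma>\<in>S. \<exists>\<delta>\<in>S. \<alpha> = \<gamma> \<odot> \<sigma> \<odot> \<delta>)" and \<alpha>: "\<alpha> \<in> S" for \<alpha>
    unfolding maximal_J_classes_def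
  proof (intro CollectI conjI ballI impI)
    show "{\<alpha>} \<in> J_classes S ?f" using J_class_of[OF \<alpha>, of ?f] outside_class[OF out \<alpha>] by simp
    fix D assume D: "D \<in> J_classes S ?f" and "J_le S ?f {\<alpha>} D"
    then obtain \<beta> where \<beta>: "\<beta> \<in> D" "\<alpha> \<in> ?I \<beta>" unfolding J_le_def by blast
    obtain \<delta> where \<delta>: "\<delta> \<in> S" "D = {\<gamma> \<in> S. ?I \<delta> = ?I \<gamma>}" using J_class_cases[OF D] by blast
    then have "\<alpha> = \<beta>" using outside[OF out _ \<beta>(2)] \<beta>(1) by blast
    then show "D = {\<alpha>}" using \<delta> \<beta>(1) outside_class[OF out \<alpha>] by auto
  qed
  show trivial: "trivial_maximal_J_classes S \<sigma> = {{\<alpha>} | \<alpha>. \<alpha> \<in> S \<and> part_rank \<alpha> > r}"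
  proof -
    have "trivial_maximal_J_classes S \<sigma> = {{\<alpha>} | \<alpha>. \<alpha> \<in> S \<and> \<not> (\<exists>\<gamma>\<in>S. \<exists>\<delta>\<in>S. \<alpha> = \<gamma> \<odot> \<sigma> \<odot> \<delta>)}"
      unfolding trivial_maximal_J_classes_def using triv by blast
    also have "\<dots> = {{\<alpha>} | \<alpha>. \<alpha> \<in> S \<and> part_rank \<alpha> > r}"
    proof -
      have "\<not> (\<exists>\<gamma>\<in>S. \<exists>\<delta>\<in>S. \<alpha> = \<gamma> \<odot> \<sigma> \<odot> \<delta>) \<longleftrightarrow> part_rank \<alpha> > r" if "\<alpha> \<in> S" for \<alpha>
        unfolding ideal[OF that] by (rule not_le)
      then show ?thesis by (intro Collect_cong) metis
    qed
    finally show ?thesis .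
  qed
  have nontriv: "C = V" if C: "C \<in> nontrivial_maximal_J_classes S \<sigma>" for C
  proof -
    have max: "C \<in> maximal_J_classes S ?f" and nt: "C \<notin> trivial_maximal_J_classes S \<sigma>"
      using C unfolding nontrivial_maximal_J_classes_def by auto
    then have CJ: "C \<in> J_classes S ?f" unfolding maximal_J_classes_def by blast
    obtain \<alpha> where \<alpha>: "\<alpha> \<in> S" "C = {\<beta> \<in> S. ?I \<alpha> = ?I \<beta>}" using J_class_cases[OF CJ] by blast
    have "\<exists>\<gamma>\<in>S. \<exists>\<delta>\<in>S. \<alpha> = \<gamma> \<odot> \<sigma> \<odot> \<delta>"
    proof (rule ccontr)
      assume out: "\<not> ?thesis"
      then have "C = {\<alpha>}" using outside_class[OF out \<alpha>(1)] \<alpha>(2) by simp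
      then show False using nt max \<alpha>(1) out unfolding trivial_maximal_J_classes_def by blast
    qed
    then have "\<alpha> \<in> ?I \<epsilon>" using below'[OF \<epsilon>V] by blast
    then have "J_le S ?f C V" unfolding J_le_def using \<alpha> \<epsilon>V by blast
    then show "C = V" using max VJ unfolding maximal_J_classes_def by blast
  qed
  have Vnt: "V \<notin> trivial_maximal_J_classes S \<sigma>"
  proof
    assume "V \<in> trivial_maximal_J_classes S \<sigma>"
    then obtain \<alpha> where "V = {\<alpha>}" "\<not> (\<exists>\<gamma>\<in>S. \<exists>\<delta>\<in>S. \<alpha> = \<gamma> \<odot> \<sigma> \<odot> \<delta>)"
      unfolding trivial_maximal_J_classes_def by blast
    then show False using V[of \<alpha>] by (metis insertI1)
  qed
  have nonempty: "nontrivial_maximal_J_classes S \<sigma> \<noteq> {} \<longleftrightarrow> V \<in> maximal_J_classes S ?f"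
    using nontriv Vnt unfolding nontrivial_maximal_J_classes_def by blast
  have "V \<in> maximal_J_classes S ?f \<longleftrightarrow> pre_inverses S \<sigma> \<subseteq> rank_class r S"
  proof
    assume max: "V \<in> maximal_J_classes S ?f"
    show "pre_inverses S \<sigma> \<subseteq> rank_class r S"
    proof
      fix \<alpha> assume "\<alpha> \<in> pre_inverses S \<sigma>"
      then have \<alpha>: "\<alpha> \<in> S" "\<sigma> \<odot> \<alpha> \<odot> \<sigma> = \<sigma>" by (auto simp: Pre)
      let ?D = "{\<beta> \<in> S. ?I \<alpha> = ?I \<beta>}"
      have "J_le S ?f V ?D" unfolding J_le_def using below[OF \<epsilon>V \<alpha>] \<epsilon>V \<alpha>(1) by blast
      then have "?D = V" using max J_class_of[OF \<alpha>(1), of ?f] unfolding maximal_J_classes_def by blast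
      then show "\<alpha> \<in> rank_class r S" using Vrank \<alpha>(1) unfolding rank_class_def by blast
    qed
  next
    assume sub: "pre_inverses S \<sigma> \<subseteq> rank_class r S"
    show "V \<in> maximal_J_classes S ?f"
      unfolding maximal_J_classes_def
    proof (intro CollectI conjI ballI impI VJ)
      fix D assume D: "D \<in> J_classes S ?f" and "J_le S ?f V D"
      then obtain \<alpha> \<beta> where \<alpha>\<beta>: "\<alpha> \<in> V" "\<beta> \<in> D" "\<alpha> \<in> ?I \<beta>" unfolding J_le_def by blast
      have \<beta>S: "\<beta> \<in> S" using J_class_cases[OF D] \<alpha>\<beta>(2) by blast
      have "\<sigma> \<odot> \<beta> \<odot> \<sigma> = \<sigma>" using above[OF \<alpha>\<beta>(1) \<beta>S \<alpha>\<beta>(3)] .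
      then have "\<beta> \<in> V" using PreV[OF \<beta>S] sub Pre \<beta>S unfolding rank_class_def by blast
      then show "D = V" using meets[OF D \<alpha>\<beta>(2)] by blast
    qed
  qed
  with nonempty show "nontrivial_maximal_J_classes S \<sigma> \<noteq> {} \<longleftrightarrow> pre_inverses S \<sigma> \<subseteq> rank_class r S" by simp
  show "pre_inverses S \<sigma> \<subseteq> rank_class r S \<longleftrightarrow> pre_inverses S \<sigma> = inverses S \<sigma>"
  proof
    assume sub: "pre_inverses S \<sigma> \<subseteq> rank_class r S"
    have "pre_inverses S \<sigma> = V"
      using PreV sub Pre V unfolding rank_class_def by blast
    then show "pre_inverses S \<sigma> = inverses S \<sigma>" by (simp add: V_def)
  next
    assume "pre_inverses S \<sigma> = inverses S \<sigma>"
    then show "pre_inverses S \<sigma> \<subseteq> rank_class r S"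
      using Vrank VS unfolding rank_class_def V_def[symmetric] by blast
  qed
  show "nontrivial_maximal_J_classes S \<sigma> = {regular_rank_class S \<sigma> r}"
    if "nontrivial_maximal_J_classes S \<sigma> \<noteq> {}"
    using that nontriv unfolding DV by blast
  have \<sigma>\<alpha>id: "\<sigma> \<odot> \<alpha> = identity_partition n" if "r = n" "\<alpha> \<in> V" for \<alpha>
    using diagrams_full_rank[OF S\<sigma>(2)[of \<alpha>]] rank_ge(2)[of \<alpha>] that V by simp
  have cancel: "\<beta> \<odot> \<sigma> \<odot> \<alpha> = \<beta>" if "r = n" "\<alpha> \<in> V" "\<beta> \<in> S" for \<alpha> \<beta>
    using as1[of \<beta> \<alpha>] \<sigma>\<alpha>id[OF that(1,2)] diagrams_id_right[of \<beta> s t m n] that VS unfolding S_def by auto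
  show "maximum_J_class S ?f (regular_rank_class S \<sigma> r)" if rn: "r = n"
    unfolding DV maximum_J_class_def
  proof (intro conjI VJ ballI)
    fix D assume D: "D \<in> J_classes S ?f"
    obtain \<beta> where \<beta>: "\<beta> \<in> S" "D = {\<gamma> \<in> S. ?I \<beta> = ?I \<gamma>}" using J_class_cases[OF D] by blast
    have "\<beta> = ?f \<beta> \<epsilon>" using cancel[OF rn \<epsilon>V \<beta>(1)] by (simp add: sandwich_def)
    then have "\<beta> \<in> ?I \<epsilon>" unfolding mem_principal_ideal using \<beta>(1) by blast
    then show "J_le S ?f D V" unfolding J_le_def using \<beta> \<epsilon>V by blast
  qed
  show "left_zero_semigroup (regular_rank_class S \<sigma> r) ?f" if rn: "r = n"
  proof -
    have "?f u v = u" if "u \<in> V" "v \<in> V" for u v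
      using cancel[OF rn that(2)] that(1) VS by (auto simp: sandwich_def)
    then show ?thesis unfolding DV left_zero_semigroup_def semigroup_on_def by simp
  qed
qed

theorem proposition5p11:
  fixes K :: "nat \<Rightarrow> nat \<Rightarrow> vertex set set set"
    and m n r :: nat
    and \<sigma> :: "vertex set set"
  assumes "K = planar_partitions \<or> K = motzkin \<or> K = temperley_lieb"
    and "m \<ge> n"
    and "\<sigma> \<in> K n m"
    and "r = part_rank \<sigma>"
  shows
    "(r < n \<longrightarrow>
        trivial_maximal_J_classes (K m n) \<sigma> = {{\<alpha>} | \<alpha>. \<alpha> \<in> K m n \<and> part_rank \<alpha> > r} \<and>
        (nontrivial_maximal_J_classes (K m n) \<sigma> \<noteq> {} \<longleftrightarrow>
           pre_inverses (K m n) \<sigma> \<subseteq> rank_class r (K m n)) \<and>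
        (pre_inverses (K m n) \<sigma> \<subseteq> rank_class r (K m n) \<longleftrightarrow>
           pre_inverses (K m n) \<sigma> = inverses (K m n) \<sigma>) \<and>
        (nontrivial_maximal_J_classes (K m n) \<sigma> \<noteq> {} \<longrightarrow>
           nontrivial_maximal_J_classes (K m n) \<sigma> = {regular_rank_class (K m n) \<sigma> r})) \<and>
     (r = n \<longrightarrow>
        maximum_J_class (K m n) (sandwich \<sigma>) (regular_rank_class (K m n) \<sigma> r) \<and>
        left_zero_semigroup (regular_rank_class (K m n) \<sigma> r) (sandwich \<sigma>))"
proof -
  obtain s t where K: "K = diagrams s t" using assms(1) diagrams_eq by metis
  note J = sandwich_J_classes[OF assms(3)[unfolded K] assms(4), folded K]
  show ?thesis using J by blast
qed

end
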